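(* Let $\alpha\ge0$, $v>0$ and let $E\in\mathcal{A}^x(v)\cap\mathcal{S}_x\cap\mathcal{S}_y^*$ be an $x$-regular minimizer of the problem $\inf\{\mathcal{P}_\alpha^x(E') : E'\in\mathcal{A}^x(v)\}$, with profile function $f\in C([0,r])\cap\mathrm{Lip}_{loc}(]0,r[)$, $r\in\,]0,+\infty[$. Then $E$ is unique and its profile function is given by $$f(x)=-\frac{1}{|k|^{\alpha+1}}\int_{-1}^{kx+\frac12}\frac{t(\frac12-t)^\alpha}{\sqrt{1-t^2}}\,dt$$ for all $x\in[0,r]$, where $$k=-\left(-\frac{2}{v}\int_{-1}^{\frac12}\frac{t(\frac12-t)^{\alpha+1}}{\sqrt{1-t^2}}\,dt\right)^{\frac{1}{\alpha+2}}.$$ In particular, $f\in C^\infty(]0,r[)$ and $r=-\frac{3}{2k}$. Moreover, $f(0)>0$, $f(r)=0$ and $f'(r)=-\infty$. In addition, if $\alpha>0$ then $f'(0)=0$ and $f$ has a strict maximum at $x=-\frac{1}{2k}$. Finally, the minimum of the problem is $$\mathcal{P}_\alpha^x(E)=\frac{2}{|k|^{\alpha+1}}\int_{-1}^{\frac12}\frac{(2-t)(\frac12-t)^\alpha}{\sqrt{1-t^2}}\,dt.$$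
   Context: For $\alpha\ge0$ and an $\mathcal{L}^2$-measurable set $E\subset\mathbb{R}^2$, the Grushin $\alpha$-perimeter is $$P_\alpha(E)=\sup\left\{\int_E(\partial_x\phi_1+|x|^\alpha\partial_y\phi_2)\,dx\,dy : \phi_1,\phi_2\in C^1_c(\mathbb{R}^2),\ \sup_{\mathbb{R}^2}\sqrt{\phi_1^2+\phi_2^2}\le1\right\}.$$ Set $E^{+x}=E\cap\{x>0\}$, $E^{-x}=E\cap\{x<0\}$. For $v>0$, $\mathcal{A}^x(v)$ is the class of $\mathcal{L}^2$-measurable $E\subset\mathbb{R}^2$ with $\mathcal{L}^2(E^{+x})=\mathcal{L}^2(E^{-x})=v$, and $\mathcal{P}_\alpha^x(E)=\frac12(P_\alpha(E^{+x})+P_\alpha(E^{-x})+P_\alpha(E))$. Sets are considered up to $\mathcal{L}^2$-negligible sets. $\mathcal{S}_x$ is the class of $\mathcal{L}^2$-measurable $x$-symmetric sets ($(x,y)\in E$ implies $(-x,y)\in E$). $\mathcal{S}_y^*$ is the class of $\mathcal{L}^2$-measurable $y$-Schwarz symmetric sets, i.e. $y$-symmetric ($(x,y)\in E$ implies $(x,-y)\in E$) and $y$-convex (for each $t$ the section $\{y:(t,y)\in E\}$ is a, possibly empty, open interval). A set $E\in\mathcal{S}_x$ is $x$-transformed-convex if $\Psi(E^{+x})$ is convex, where $\Psi(x,y)=\left(\operatorname{sgn}(x)\frac{|x|^{\alpha+1}}{\alpha+1},\,y\right)$. An $x$-regular minimizer is a minimizer $E\in\mathcal{A}^x(v)\cap\mathcal{S}_x\cap\mathcal{S}_y^*$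 of the problem $\inf\{\mathcal{P}_\alpha^x(E') : E'\in\mathcal{A}^x(v)\}$ that is bounded, $x$-transformed-convex and of the form $E=\{(x,y)\in\mathbb{R}^2 : |y|\le f(|x|),\ |x|\le r\}$ for some (profile) function $f\in C([0,r])\cap\mathrm{Lip}_{loc}(]0,r[)$ with $r\in\,]0,+\infty[$. The values $f'(0)$ and $f'(r)$ denote $\lim_{x\to0^+}f'(x)$ and $\lim_{x\to r^-}f'(x)$. *)

theory Defs
  imports "HOL-Analysis.Analysis"
begin

definition partial_x :: "(real \<times> real \<Rightarrow> real) \<Rightarrow> real \<times> real \<Rightarrow> real" where
  "partial_x \<phi> p = deriv (\<lambda>s. \<phi> (s, snd p)) (fst p)"

definition partial_y :: "(real \<times> real \<Rightarrow> real) \<Rightarrow> real \<times> real \<Rightarrow> real" where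
  "partial_y \<phi> p = deriv (\<lambda>s. \<phi> (fst p, s)) (snd p)"

definition C1c :: "(real \<times> real \<Rightarrow> real) set" where
  "C1c = {\<phi>. (\<forall>p. \<phi> differentiable (at p)) \<and>
     continuous_on UNIV (partial_x \<phi>) \<and> continuous_on UNIV (partial_y \<phi>) \<and>
     compact (closure {p. \<phi> p \<noteq> 0})}"

text \<open>
  For \<open>\<alpha> = 0\<close> the factor \<open>\<bar>x\<bar> powr \<alpha>\<close> equals 1 except on the null set \<open>x = 0\<close>, where
  \<open>0 powr 0 = 0\<close>; this does not affect the integral. For measurable \<open>E\<close> all the integrands are
  integrable. The supremum is taken in the extended reals, since the perimeter may be infinite.
\<close>
definition grushin_perimeter :: "real \<Rightarrow> (real \<times> real) set \<Rightarrow> ereal" where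
  "grushin_perimeter \<alpha> E =
     (SUP (\<phi>\<^sub>1, \<phi>\<^sub>2) \<in> {(\<phi>\<^sub>1, \<phi>\<^sub>2). \<phi>\<^sub>1 \<in> C1c \<and> \<phi>\<^sub>2 \<in> C1c \<and>
                           (\<forall>p. sqrt ((\<phi>\<^sub>1 p)\<^sup>2 + (\<phi>\<^sub>2 p)\<^sup>2) \<le> 1)}.
        ereal (LINT p:E|lebesgue. partial_x \<phi>\<^sub>1 p + \<bar>fst p\<bar> powr \<alpha> * partial_y \<phi>\<^sub>2 p))"

definition pos_x :: "(real \<times> real) set \<Rightarrow> (real \<times> real) set" where
  "pos_x E = E \<inter> {p. fst p > 0}"

definition neg_x :: "(real \<times> real) set \<Rightarrow> (real \<times> real) set" where
  "neg_x E = E \<inter> {p. fst p < 0}"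

definition admissible_x :: "real \<Rightarrow> (real \<times> real) set set" where
  "admissible_x v = {E \<in> sets lebesgue.
     emeasure lebesgue (pos_x E) = ennreal v \<and> emeasure lebesgue (neg_x E) = ennreal v}"

definition double_perimeter_x :: "real \<Rightarrow> (real \<times> real) set \<Rightarrow> ereal" where
  "double_perimeter_x \<alpha> E =
     (1/2) * (grushin_perimeter \<alpha> (pos_x E) + grushin_perimeter \<alpha> (neg_x E) + grushin_perimeter \<alpha> E)"

definition eq_ae :: "(real \<times> real) set \<Rightarrow> (real \<times> real) set \<Rightarrow> bool" where
  "eq_ae E F \<longleftrightarrow> sym_diff E F \<in> null_sets lebesgue"

text \<open>
  Sets are considered up to null sets: a set belongs to one of the two symmetry classes if some
  representative of it has the property pointwise.
\<close>
definition x_symmetric :: "(real \<times> real) set \<Rightarrow> bool" where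
  "x_symmetric E \<longleftrightarrow> (\<forall>x y. (x, y) \<in> E \<longrightarrow> (- x, y) \<in> E)"

definition y_schwarz_symmetric :: "(real \<times> real) set \<Rightarrow> bool" where
  "y_schwarz_symmetric E \<longleftrightarrow>
     (\<forall>x y. (x, y) \<in> E \<longrightarrow> (x, - y) \<in> E) \<and>
     (\<forall>t. open {y. (t, y) \<in> E} \<and> is_interval {y. (t, y) \<in> E})"

definition class_Sx :: "(real \<times> real) set set" where
  "class_Sx = {E \<in> sets lebesgue. \<exists>F \<in> sets lebesgue. eq_ae E F \<and> x_symmetric F}"

definition class_Sy_star :: "(real \<times> real) set set" where
  "class_Sy_star = {E \<in> sets lebesgue. \<exists>F \<in> sets lebesgue. eq_ae E F \<and> y_schwarz_symmetric F}"

definition Psi :: "real \<Rightarrow> real \<times> real \<Rightarrow> real \<times> real" where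
  "Psi \<alpha> = (\<lambda>(x, y). (sgn x * (\<bar>x\<bar> powr (\<alpha> + 1) / (\<alpha> + 1)), y))"

definition x_transformed_convex :: "real \<Rightarrow> (real \<times> real) set \<Rightarrow> bool" where
  "x_transformed_convex \<alpha> E \<longleftrightarrow> convex (Psi \<alpha> ` pos_x E)"

definition is_minimizer_x :: "real \<Rightarrow> real \<Rightarrow> (real \<times> real) set \<Rightarrow> bool" where
  "is_minimizer_x \<alpha> v E \<longleftrightarrow> E \<in> admissible_x v \<and>
     (\<forall>E' \<in> admissible_x v. double_perimeter_x \<alpha> E \<le> double_perimeter_x \<alpha> E')"

definition profile_set :: "(real \<Rightarrow> real) \<Rightarrow> real \<Rightarrow> (real \<times> real) set" where
  "profile_set f r = {(x, y). \<bar>x\<bar> \<le> r \<and> \<bar>y\<bar> \<le> f \<bar>x\<bar>}"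

definition locally_lipschitz_on :: "real set \<Rightarrow> (real \<Rightarrow> real) \<Rightarrow> bool" where
  "locally_lipschitz_on S f \<longleftrightarrow> (\<forall>K. compact K \<and> K \<subseteq> S \<longrightarrow> (\<exists>L. L-lipschitz_on K f))"

text \<open>
  A profile function is a half-height, hence nonnegative on \<open>[0,r]\<close>. Boundedness and transformed
  convexity are required of the closed representative \<open>profile_set f r\<close> itself. If \<open>f\<close> could be
  negative near \<open>r\<close>, or if convexity were only required up to null sets, then \<open>f\<close> and \<open>r\<close> would
  not be determined by \<open>E\<close>: one could enlarge \<open>r\<close> and extend \<open>f\<close> by negative values or by zero.
  Only the values of \<open>f\<close> on \<open>[0,r]\<close> matter.
\<close>
definition x_regular_minimizer_with_profile ::
    "real \<Rightarrow> real \<Rightarrow> (real \<times> real) set \<Rightarrow> (real \<Rightarrow> real) \<Rightarrow> real \<Rightarrow> bool" where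
  "x_regular_minimizer_with_profile \<alpha> v E f r \<longleftrightarrow>
     E \<in> admissible_x v \<inter> class_Sx \<inter> class_Sy_star \<and>
     is_minimizer_x \<alpha> v E \<and>
     0 < r \<and> continuous_on {0..r} f \<and> locally_lipschitz_on {0<..<r} f \<and>
     (\<forall>x\<in>{0..r}. 0 \<le> f x) \<and>
     eq_ae E (profile_set f r) \<and>
     bounded (profile_set f r) \<and>
     x_transformed_convex \<alpha> (profile_set f r)"

definition x_regular_minimizer :: "real \<Rightarrow> real \<Rightarrow> (real \<times> real) set \<Rightarrow> bool" where
  "x_regular_minimizer \<alpha> v E \<longleftrightarrow> (\<exists>f r. x_regular_minimizer_with_profile \<alpha> v E f r)"

end

theory Submission
  imports Defs
begin

text \<open>
  For a profile set with half-height \<open>f\<close> on \<open>[0,r]\<close>, \<open>f > 0\<close> on \<open>(0,r)\<close>, the double perimeter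
  is formally \<open>4 \<integral> sqrt (f'\<^sup>2 + x\<^sup>2\<^sup>\<alpha>) + 4 f(r) + 2 f(0)\<close>, with all integrals over \<open>[0,r]\<close>. The term
  \<open>2 f(0)\<close> counts the segment on the axis \<open>x = 0\<close>, and the Euler--Lagrange equation with its natural
  boundary conditions is
  \<open>f' / sqrt (f'\<^sup>2 + x\<^sup>2\<^sup>\<alpha>) = u(x)\<close> with \<open>u(x) = 1/2 - p x\<close>, \<open>u(r) = -1\<close>. Integrating it gives the
  \<open>optimal_profile\<close> with \<open>r = 3 / (2 p)\<close>; below \<open>p = -k = \<bar>k\<bar>\<close>.

  The proof never uses this functional. It bounds the double perimeter \<open>P(E)\<close> of the given minimizer from below by
  testing with explicit vector fields, that is, by calibrations. For every \<open>C\<^sup>1\<close> function \<open>W\<close> with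
  \<open>W(0) = 1/2\<close> and \<open>-1 \<le> W \<le> 1/2\<close> on \<open>[0,r]\<close>, lemma \<open>double_perimeter_ge\<close> gives
  \<open>P(E) \<ge> -4 \<integral> f W' + 4 \<integral> x\<^sup>\<alpha> sqrt (1 - W\<^sup>2)\<close>.
  For \<open>x > 0\<close> the test fields are \<open>\<phi>\<^sub>1 = -W\<close> and \<open>\<phi>\<^sub>2 = sgn y \<cdot> sqrt (1 - W\<^sup>2)\<close>, smoothed and cut off, with one
  modification: near \<open>x = 0\<close> the right and left halves are tested with a field that is larger than
  \<open>W\<close>, the whole set with an odd field that vanishes there, and in the sum over the three
  perimeters the two modifications cancel.

  Conversely, lemma \<open>optimal_set_upper_bound\<close> shows by the divergence theorem that the optimal set is
  admissible and that its double perimeter is at most \<open>4 (C + K) / p\<^sup>\<alpha>\<^sup>+\<^sup>1\<close>, where \<open>C\<close> is \<open>bubble_flux\<close>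
  and \<open>K\<close> is \<open>bubble_moment\<close>, related by \<open>K = (\<alpha> + 1) C\<close>. A minimizer therefore satisfies the same bound.

  Two choices of \<open>W\<close> turn this into rigidity. With \<open>W = 1/2 - q x\<close>, \<open>q = 3 / (2 r)\<close>, the lower
  bound is \<open>2 q v + 4 C / q\<^sup>\<alpha>\<^sup>+\<^sup>1\<close>; as a function of \<open>q\<close> it has the strict minimum \<open>4 (C + K) / p\<^sup>\<alpha>\<^sup>+\<^sup>1\<close> at
  \<open>q = p\<close>, so that the radius and the minimal value are determined (\<open>regular_minimizer_radius\<close>).
  With \<open>W = u + e \<eta>\<close>, where \<open>\<eta>(x)\<close> is the integral over \<open>[0,x]\<close> of \<open>d = optimal_profile - f\<close>, the
  lower bound exceeds the minimal value by at least \<open>4 e \<integral> d\<^sup>2 - O(e\<^sup>2)\<close>. Hence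
  \<open>\<integral> d\<^sup>2 = 0\<close> and \<open>f\<close> is the optimal profile (\<open>regular_minimizer_profile\<close>). The remaining assertions are
  read off from the explicit formula.
\<close>

section \<open>One-variable integrals with the weight of the optimal profile\<close>

lemma inverse_sqrt_absolutely_integrable:
  "(\<lambda>t::real. 1 / sqrt (1 - t\<^sup>2)) absolutely_integrable_on {-1..1/2}"
proof -
  have "((\<lambda>t::real. 1 / sqrt (1 - t\<^sup>2)) has_integral (arcsin (1/2) - arcsin (-1))) {-1..1/2}"
  proof (rule fundamental_theorem_of_calculus_interior)
    fix t :: real assume "t \<in> {-1<..<1/2}"
    then show "(arcsin has_vector_derivative 1 / sqrt (1 - t\<^sup>2)) (at t)"
      unfolding has_real_derivative_iff_has_vector_derivative[symmetric]
      using DERIV_arcsin[of t] by (simp add: inverse_eq_divide)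
  qed (auto intro!: continuous_on_subset[OF continuous_on_arcsin'])
  then have "(\<lambda>t::real. 1 / sqrt (1 - t\<^sup>2)) integrable_on {-1..1/2}" by blast
  moreover have "0 \<le> 1 / sqrt (1 - t\<^sup>2)" if "t \<in> {-1..1/2}" for t :: real
    using that by (auto simp: abs_square_le_1)
  ultimately show ?thesis
    by (rule nonnegative_absolutely_integrable_1)
qed

text \<open>
  The integrands below are products of a bounded measurable function and the integrable
  weight \<open>1 / sqrt (1 - t\<^sup>2)\<close>. For \<open>\<beta> = 0\<close> the factor \<open>(1/2 - t) powr \<beta>\<close> is not continuous at
  \<open>t = 1/2\<close>, as \<open>0 powr 0 = 0\<close>; this is why measurability is used instead of continuity.
\<close>

lemma weight_absolutely_integrable:
  fixes c :: "real \<Rightarrow> real"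
  assumes "\<beta> \<ge> 0" and c: "continuous_on {-1..1/2} c"
  shows "(\<lambda>t. c t * (1/2 - t) powr \<beta> / sqrt (1 - t\<^sup>2)) absolutely_integrable_on {-1..1/2}"
proof -
  let ?h = "\<lambda>t::real. c t * (1/2 - t) powr \<beta>"
  have m1: "c \<in> borel_measurable (lebesgue_on {-1..1/2})"
    using c by (intro continuous_imp_measurable_on_sets_lebesgue) auto
  have "(\<lambda>t::real. (1/2 - t) powr \<beta>) \<in> borel_measurable borel" by measurable
  then have m2: "(\<lambda>t::real. (1/2 - t) powr \<beta>) \<in> borel_measurable (lebesgue_on {-1..1/2})"
    by (intro measurable_restrict_space1 borel_measurable_if_lebesgue_on) (auto intro: measurable_completion)
  have m: "?h \<in> borel_measurable (lebesgue_on {-1..1/2})"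
    using m1 m2 by (rule borel_measurable_times)
  have "bounded (c ` {-1..1/2})"
    by (intro compact_imp_bounded compact_continuous_image[OF c]) auto
  then obtain B where B: "\<And>t. t \<in> {-1..1/2} \<Longrightarrow> norm (c t) \<le> B"
    unfolding bounded_iff by blast
  have "norm (?h t) \<le> B * (3/2) powr \<beta>" if t: "t \<in> {-1..1/2}" for t
  proof -
    have "(1/2 - t) powr \<beta> \<le> (3/2) powr \<beta>" using t \<open>\<beta> \<ge> 0\<close> by (intro powr_mono2) auto
    then show ?thesis unfolding norm_mult
      using B[OF t] by (intro mult_mono) (auto intro: order_trans[OF norm_ge_zero B[OF t]])
  qed
  then have "bounded (?h ` {-1..1/2})" unfolding bounded_iff by blast
  from absolutely_integrable_bounded_measurable_product_real[OF m _ this inverse_sqrt_absolutely_integrable]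
  show ?thesis by simp
qed

lemmas weight_integrable = set_lebesgue_integral_eq_integral(1)[OF weight_absolutely_integrable]

text \<open>
  After the substitution \<open>t = 1/2 - p x\<close> this constant is, up to powers of \<open>p\<close>, half of the
  area of the right half of the optimal set.
\<close>

definition bubble_moment :: "real \<Rightarrow> real" where
  "bubble_moment \<alpha> = - integral {-1..1/2} (\<lambda>t. t * (1/2 - t) powr (\<alpha> + 1) / sqrt (1 - t\<^sup>2))"

text \<open>
  The constant to which the integral of \<open>x\<^sup>\<alpha> sqrt (1 - u\<^sup>2)\<close> over \<open>[0, 3 / (2 p)]\<close> reduces, again
  up to a power of \<open>p\<close>: the flux of the calibrating field across the axis \<open>y = 0\<close>.
\<close>

definition bubble_flux :: "real \<Rightarrow> real" where
  "bubble_flux \<alpha> = integral {-1..1/2} (\<lambda>t. (1/2 - t) powr \<alpha> * sqrt (1 - t\<^sup>2))"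

text \<open>
  The optimal profile for \<open>p = 1\<close>, as a function of \<open>s = 1/2 - x\<close>.
\<close>

definition profile_primitive :: "real \<Rightarrow> real \<Rightarrow> real" where
  "profile_primitive \<alpha> s = - integral {-1..s} (\<lambda>t. t * (1/2 - t) powr \<alpha> / sqrt (1 - t\<^sup>2))"

lemma flux_integrand_eq:
  assumes "t \<in> {-1..1/2::real}"
  shows "(1/2 - t) powr \<alpha> * sqrt (1 - t\<^sup>2) = (1 - t\<^sup>2) * (1/2 - t) powr \<alpha> / sqrt (1 - t\<^sup>2)"
proof -
  have "1 - t\<^sup>2 \<ge> 0" using assms by (auto simp: abs_square_le_1)
  then have "sqrt (1 - t\<^sup>2) = (1 - t\<^sup>2) / sqrt (1 - t\<^sup>2)" by (simp add: real_div_sqrt)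
  then show ?thesis by (metis mult.commute times_divide_eq_left)
qed

lemma flux_has_integral:
  assumes "\<alpha> \<ge> 0"
  shows "((\<lambda>t. (1/2 - t) powr \<alpha> * sqrt (1 - t\<^sup>2)) has_integral bubble_flux \<alpha>) {-1..1/2}"
proof -
  have "(\<lambda>t. (1 - t\<^sup>2) * (1/2 - t) powr \<alpha> / sqrt (1 - t\<^sup>2)) integrable_on {-1..1/2::real}"
    using assms by (intro weight_integrable continuous_intros)
  then have "(\<lambda>t. (1/2 - t) powr \<alpha> * sqrt (1 - t\<^sup>2)) integrable_on {-1..1/2::real}"
    by (rule integrable_eq) (simp add: flux_integrand_eq)
  then show ?thesis unfolding bubble_flux_def by (rule integrable_integral)
qed

lemma moment_has_integral:
  assumes "\<alpha> \<ge> 0"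
  shows "((\<lambda>t. t * (1/2 - t) powr (\<alpha>+1) / sqrt (1 - t\<^sup>2)) has_integral - bubble_moment \<alpha>) {-1..1/2}"
  unfolding bubble_moment_def minus_minus using assms
  by (intro integrable_integral weight_integrable continuous_intros) auto

lemma one_minus_square_pos: "t \<in> {-1<..<1::real} \<Longrightarrow> 0 < 1 - t\<^sup>2"
  using abs_square_less_1[of t] by auto

lemma sqrt_one_minus_square_derivative:
  assumes "t \<in> {-1<..<1::real}"
  shows "((\<lambda>t. sqrt (1 - t\<^sup>2)) has_real_derivative - (t / sqrt (1 - t\<^sup>2))) (at t)"
proof -
  have "((\<lambda>t::real. 1 - t\<^sup>2) has_real_derivative - (2 * t)) (at t)"
    by (auto intro!: derivative_eq_intros)
  from DERIV_chain2[OF DERIV_real_sqrt[OF one_minus_square_pos[OF assms]] this]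
  have "((\<lambda>t. sqrt (1 - t\<^sup>2)) has_real_derivative inverse (sqrt (1 - t\<^sup>2)) / 2 * - (2 * t)) (at t)" .
  moreover have "inverse (sqrt (1 - t\<^sup>2)) / 2 * - (2 * t) = - (t / sqrt (1 - t\<^sup>2))"
    by (simp add: inverse_eq_divide)
  ultimately show ?thesis by metis
qed

lemma moment_eq_flux:
  assumes "\<alpha> \<ge> 0" shows "bubble_moment \<alpha> = (\<alpha> + 1) * bubble_flux \<alpha>"
proof -
  have exact: "((\<lambda>t. - ((\<alpha>+1) * ((1/2 - t) powr \<alpha> * sqrt (1 - t\<^sup>2))) - t * (1/2 - t) powr (\<alpha>+1) / sqrt (1 - t\<^sup>2))
     has_integral ((1/2 - 1/2) powr (\<alpha>+1) * sqrt (1 - (1/2)\<^sup>2) - (1/2 - (-1)) powr (\<alpha>+1) * sqrt (1 - (-1)\<^sup>2))) {-1..1/2}"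
  proof (rule fundamental_theorem_of_calculus_interior)
    fix t :: real assume t: "t \<in> {-1<..<1/2}"
    have "((\<lambda>t. (1/2 - t) powr (\<alpha>+1)) has_real_derivative - ((\<alpha>+1) * (1/2 - t) powr \<alpha>)) (at t)"
      using t by (auto intro!: derivative_eq_intros)
    moreover have "((\<lambda>t. sqrt (1 - t\<^sup>2)) has_real_derivative - (t / sqrt (1 - t\<^sup>2))) (at t)"
      using t by (intro sqrt_one_minus_square_derivative) auto
    ultimately have "((\<lambda>t. (1/2 - t) powr (\<alpha>+1) * sqrt (1 - t\<^sup>2)) has_real_derivative
        - ((\<alpha>+1) * (1/2 - t) powr \<alpha>) * sqrt (1 - t\<^sup>2) + - (t / sqrt (1 - t\<^sup>2)) * (1/2 - t) powr (\<alpha>+1)) (at t)"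
      by (rule DERIV_mult)
    moreover have "- ((\<alpha>+1) * (1/2 - t) powr \<alpha>) * sqrt (1 - t\<^sup>2) + - (t / sqrt (1 - t\<^sup>2)) * (1/2 - t) powr (\<alpha>+1)
      = - ((\<alpha>+1) * ((1/2 - t) powr \<alpha> * sqrt (1 - t\<^sup>2))) - t * (1/2 - t) powr (\<alpha>+1) / sqrt (1 - t\<^sup>2)"
      by simp
    ultimately show "((\<lambda>t. (1/2 - t) powr (\<alpha>+1) * sqrt (1 - t\<^sup>2)) has_vector_derivative
        - ((\<alpha>+1) * ((1/2 - t) powr \<alpha> * sqrt (1 - t\<^sup>2))) - t * (1/2 - t) powr (\<alpha>+1) / sqrt (1 - t\<^sup>2)) (at t)"
      unfolding has_real_derivative_iff_has_vector_derivative[symmetric] by metis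
  next
    show "continuous_on {- 1..1/2} (\<lambda>t. (1/2 - t) powr (\<alpha>+1) * sqrt (1 - t\<^sup>2))"
      using assms by (intro continuous_intros continuous_on_powr') auto
  qed simp
  have "((\<lambda>t. - ((\<alpha>+1) * ((1/2 - t) powr \<alpha> * sqrt (1 - t\<^sup>2))) - t * (1/2 - t) powr (\<alpha>+1) / sqrt (1 - t\<^sup>2))
     has_integral (- ((\<alpha> + 1) * bubble_flux \<alpha>) - (- bubble_moment \<alpha>))) {-1..1/2}"
    using assms by (intro has_integral_diff has_integral_neg has_integral_mult_right flux_has_integral moment_has_integral)
  from has_integral_unique[OF exact this] show ?thesis by simp
qed

lemma profile_primitive_has_integral:
  assumes "\<alpha> \<ge> 0" "s \<in> {-1..1/2}"
  shows "((\<lambda>t. t * (1/2 - t) powr \<alpha> / sqrt (1 - t\<^sup>2)) has_integral - profile_primitive \<alpha> s) {-1..s}"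
proof -
  have "(\<lambda>t. t * (1/2 - t) powr \<alpha> / sqrt (1 - t\<^sup>2)) integrable_on {-1..1/2}"
    using assms by (intro weight_integrable continuous_intros)
  then have "(\<lambda>t. t * (1/2 - t) powr \<alpha> / sqrt (1 - t\<^sup>2)) integrable_on {-1..s}"
    by (rule integrable_subinterval_real) (use assms in auto)
  then show ?thesis unfolding profile_primitive_def by (simp add: has_integral_integral)
qed

text \<open>
  Positivity of the profile, including \<open>s = 1/2\<close> where the integrand has no constant sign: for all
  \<open>t \<le> 1/2\<close> one has \<open>- t (1/2 - t)\<^sup>\<alpha> \<ge> - t (1/2)\<^sup>\<alpha>\<close>, and the right-hand side has the primitive
  \<open>(1/2)\<^sup>\<alpha> sqrt (1 - t\<^sup>2)\<close> after division by \<open>sqrt (1 - t\<^sup>2)\<close>.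
\<close>

lemma profile_primitive_ge:
  assumes "\<alpha> \<ge> 0" "s \<in> {-1..1/2}"
  shows "(1/2) powr \<alpha> * sqrt (1 - s\<^sup>2) \<le> profile_primitive \<alpha> s"
proof -
  have lower: "((\<lambda>t. (1/2) powr \<alpha> * (- t / sqrt (1 - t\<^sup>2))) has_integral
      ((1/2) powr \<alpha> * sqrt (1 - s\<^sup>2) - (1/2) powr \<alpha> * sqrt (1 - (-1)\<^sup>2))) {-1..s}"
  proof (rule fundamental_theorem_of_calculus_interior)
    fix t :: real assume t: "t \<in> {-1<..<s}"
    then show "((\<lambda>t. (1/2) powr \<alpha> * sqrt (1 - t\<^sup>2)) has_vector_derivative (1/2) powr \<alpha> * (- t / sqrt (1 - t\<^sup>2))) (at t)"
      unfolding has_real_derivative_iff_has_vector_derivative[symmetric]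
      using assms DERIV_cmult[OF sqrt_one_minus_square_derivative[of t], of "(1/2) powr \<alpha>"] by simp
  qed (use assms in \<open>auto intro!: continuous_intros\<close>)
  have upper: "((\<lambda>t. - (t * (1/2 - t) powr \<alpha> / sqrt (1 - t\<^sup>2))) has_integral profile_primitive \<alpha> s) {-1..s}"
    using has_integral_neg[OF profile_primitive_has_integral[OF assms]] by simp
  have "(1/2) powr \<alpha> * (- t / sqrt (1 - t\<^sup>2)) \<le> - (t * (1/2 - t) powr \<alpha> / sqrt (1 - t\<^sup>2))"
    if "t \<in> {-1..s}" for t
  proof -
    \<comment> \<open>both sides change sign at \<open>t = 0\<close>, where the comparison of the powers is reversed as well\<close>
    have "t * (1/2 - t) powr \<alpha> \<le> t * (1/2) powr \<alpha>"
    proof (cases "t \<le> 0")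
      case True
      have "(1/2) powr \<alpha> \<le> (1/2 - t) powr \<alpha>" using True assms by (intro powr_mono2) auto
      then show ?thesis using True by (rule mult_left_mono_neg)
    next
      case False
      have "(1/2 - t) powr \<alpha> \<le> (1/2) powr \<alpha>" using False assms that by (intro powr_mono2) auto
      then show ?thesis using False by (intro mult_left_mono) auto
    qed
    moreover have "0 \<le> sqrt (1 - t\<^sup>2)" using that assms by (auto simp: abs_square_le_1)
    ultimately have "t * (1/2 - t) powr \<alpha> / sqrt (1 - t\<^sup>2) \<le> t * (1/2) powr \<alpha> / sqrt (1 - t\<^sup>2)"
      by (rule divide_right_mono)
    then show ?thesis by (simp add: mult.commute)
  qed
  from has_integral_le[OF lower upper this] show ?thesis by simp
qed

lemma profile_primitive_continuous:
  assumes "\<alpha> \<ge> 0" shows "continuous_on {-1..1/2} (profile_primitive \<alpha>)"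
  unfolding profile_primitive_def
  by (intro continuous_intros indefinite_integral_continuous_1 weight_integrable assms)

lemma profile_primitive_derivative:
  assumes "\<alpha> \<ge> 0" "s \<in> {-1<..<1/2}"
  shows "(profile_primitive \<alpha> has_real_derivative - (s * (1/2 - s) powr \<alpha> / sqrt (1 - s\<^sup>2))) (at s)"
proof -
  let ?m = "\<lambda>t. t * (1/2 - t) powr \<alpha> / sqrt (1 - t\<^sup>2)"
  have pos: "0 < 1 - s\<^sup>2" using assms by (intro one_minus_square_pos) auto
  have "continuous (at s within {-1..1/2}) ?m"
    using pos assms by (intro continuous_intros continuous_at_imp_continuous_within) auto
  moreover have "?m integrable_on {-1..1/2}"
    using assms by (intro weight_integrable continuous_intros)
  ultimately have "((\<lambda>u. integral {-1..u} ?m) has_vector_derivative ?m s) (at s within {-1..1/2})"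
    using assms integral_has_vector_derivative_continuous_at[of ?m "-1" "1/2" s "{}"] by simp
  moreover have "at s within {-1..1/2} = at s"
    using assms by (intro at_within_interior) auto
  ultimately have "((\<lambda>u. integral {-1..u} ?m) has_real_derivative ?m s) (at s)"
    by (simp add: has_real_derivative_iff_has_vector_derivative)
  from DERIV_minus[OF this] show ?thesis unfolding profile_primitive_def[abs_def] .
qed

lemma profile_primitive_left [simp]: "profile_primitive \<alpha> (-1) = 0"
  by (simp add: profile_primitive_def)

lemma integral_profile_primitive:
  assumes "\<alpha> \<ge> 0"
  shows "(profile_primitive \<alpha> has_integral bubble_moment \<alpha>) {-1..1/2}"
proof -
  let ?F = "profile_primitive \<alpha>"
  \<comment> \<open>integration by parts with \<open>(s - 1/2) F(s)\<close>, which vanishes at both ends\<close>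
  have "((\<lambda>s. ?F s + s * (1/2 - s) powr (\<alpha>+1) / sqrt (1 - s\<^sup>2)) has_integral
     ((1/2 - 1/2) * ?F (1/2) - (-1 - 1/2) * ?F (-1))) {-1..1/2}"
  proof (rule fundamental_theorem_of_calculus_interior)
    fix s :: real assume s: "s \<in> {-1<..<1/2}"
    have "((\<lambda>s. (s - 1/2) * ?F s) has_real_derivative
         1 * ?F s + - (s * (1/2 - s) powr \<alpha> / sqrt (1 - s\<^sup>2)) * (s - 1/2)) (at s)"
      by (intro DERIV_mult profile_primitive_derivative assms s) (auto intro!: derivative_eq_intros)
    moreover have "1 * ?F s + - (s * (1/2 - s) powr \<alpha> / sqrt (1 - s\<^sup>2)) * (s - 1/2)
        = ?F s + s * (1/2 - s) powr (\<alpha>+1) / sqrt (1 - s\<^sup>2)"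
    proof -
      have "(1/2 - s) powr (\<alpha>+1) = (1/2 - s) * (1/2 - s) powr \<alpha>"
        using s by (simp add: powr_mult_base add.commute)
      moreover have "1 * F + - (s * P / D) * (s - 1/2) = F + s * ((1/2 - s) * P) / D" for F P D :: real
        by (simp add: add_divide_distrib diff_divide_distrib algebra_simps)
      ultimately show ?thesis by metis
    qed
    ultimately show "((\<lambda>s. (s - 1/2) * ?F s) has_vector_derivative
        ?F s + s * (1/2 - s) powr (\<alpha>+1) / sqrt (1 - s\<^sup>2)) (at s)"
      unfolding has_real_derivative_iff_has_vector_derivative[symmetric] by metis
  qed (auto intro!: continuous_intros profile_primitive_continuous assms)
  from has_integral_diff[OF this moment_has_integral[OF assms]] show ?thesis by simp
qed

lemma bubble_flux_pos: assumes "\<alpha> \<ge> 0" shows "0 < bubble_flux \<alpha>"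
proof -
  have "0 < integral {-1..1/2} (profile_primitive \<alpha>)"
  proof (rule ccontr)
    let ?F = "profile_primitive \<alpha>"
    assume neg: "\<not> ?thesis"
    have "0 \<le> ?F s" if "s \<in> {-1..1/2}" for s
      using profile_primitive_ge[OF assms that] that
      by (intro order_trans[OF _ profile_primitive_ge[OF assms that]]) (auto simp: abs_square_le_1)
    then have "integral {-1..1/2} ?F = 0" "\<And>s. s \<in> {-1..1/2} \<Longrightarrow> 0 \<le> ?F s"
      using neg integral_nonneg[of ?F "{-1..1/2}"] integral_profile_primitive[OF assms] by force+
    then have "?F 0 = 0"
      using integral_eq_0_iff[of "-1" "1/2" ?F] profile_primitive_continuous[OF assms] by auto
    with profile_primitive_ge[OF assms, of 0] show False by simp
  qed
  then have "0 < bubble_moment \<alpha>" using integral_profile_primitive[OF assms] by (simp add: integral_unique)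
  then show ?thesis using moment_eq_flux[OF assms] assms by (simp add: zero_less_mult_iff)
qed

lemma bubble_moment_pos: assumes "\<alpha> \<ge> 0" shows "0 < bubble_moment \<alpha>"
  using moment_eq_flux[OF assms] bubble_flux_pos[OF assms] assms by simp

lemma perimeter_integral_eq:
  assumes "\<alpha> \<ge> 0"
  shows "integral {-1..1/2} (\<lambda>t. (2 - t) * (1/2 - t) powr \<alpha> / sqrt (1 - t\<^sup>2)) = 2 * (bubble_flux \<alpha> + bubble_moment \<alpha>)"
proof -
  have "((\<lambda>t. 2 * ((1/2 - t) powr \<alpha> * sqrt (1 - t\<^sup>2)) - 2 * (t * (1/2 - t) powr (\<alpha>+1) / sqrt (1 - t\<^sup>2)))
     has_integral (2 * bubble_flux \<alpha> - 2 * (- bubble_moment \<alpha>))) {-1..1/2}"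
    using assms by (intro has_integral_diff has_integral_mult_right flux_has_integral moment_has_integral)
  moreover have "2 * ((1/2 - t) powr \<alpha> * sqrt (1 - t\<^sup>2)) - 2 * (t * (1/2 - t) powr (\<alpha>+1) / sqrt (1 - t\<^sup>2))
    = (2 - t) * (1/2 - t) powr \<alpha> / sqrt (1 - t\<^sup>2)" if t: "t \<in> {-1..1/2}" for t
  proof -
    have "(1/2 - t) powr (\<alpha>+1) = (1/2 - t) * (1/2 - t) powr \<alpha>"
      using t by (simp add: powr_mult_base add.commute)
    moreover have "2 * ((1 - t\<^sup>2) * P / D) - 2 * (t * ((1/2 - t) * P) / D) = (2 - t) * P / D" for P D :: real
      unfolding times_divide_eq_right diff_divide_distrib[symmetric]
      by (rule arg_cong[where f = "\<lambda>x. x / D"]) (simp add: algebra_simps power2_eq_square)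
    ultimately show ?thesis unfolding flux_integrand_eq[OF t] by metis
  qed
  ultimately have "((\<lambda>t. (2 - t) * (1/2 - t) powr \<alpha> / sqrt (1 - t\<^sup>2))
     has_integral (2 * bubble_flux \<alpha> - 2 * (- bubble_moment \<alpha>))) {-1..1/2}"
    by (rule has_integral_eq[rotated])
  then show ?thesis by (simp add: integral_unique)
qed

lemma affine_substitution:
  fixes h :: "real \<Rightarrow> real"
  assumes "(h has_integral I) {-1..1/2}" "p > 0"
  shows "((\<lambda>x. h (1/2 - p * x)) has_integral I / p) {0..3 / (2 * p)}"
proof -
  have "(\<lambda>x. (1 / - p) *\<^sub>R x + - ((1 / - p) *\<^sub>R (1/2))) ` cbox (-1) (1/2) = {0..3 / (2*p)}"
  proof -
    have "(\<lambda>x. (1 / - p) *\<^sub>R x + - ((1 / - p) *\<^sub>R (1/2))) = (\<lambda>x. (- (1/p)) * x + 1/(2*p))"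
      by auto
    moreover have "(\<lambda>x. (- (1/p)) * x + 1/(2*p)) ` {-1..1/2} = {0..3 / (2*p)}"
      unfolding image_affinity_atLeastAtMost using assms(2) by (simp add: field_simps)
    ultimately show ?thesis by (metis box_real(2))
  qed
  moreover have "(\<lambda>x. h ((- p) *\<^sub>R x + 1/2)) = (\<lambda>x. h (1/2 - p * x))" by (simp add: algebra_simps)
  ultimately show ?thesis
    using has_integral_affinity[of h I "-1" "1/2" "-p" "1/2"] assms by simp
qed

section \<open>Regions between two graphs and the perimeter functional\<close>

text \<open>
  The set between the graphs of \<open>- g\<close> and \<open>g\<close> over \<open>[a,b]\<close>. A profile set and its two halves are of
  this form up to null sets.
\<close>

definition region :: "real \<Rightarrow> real \<Rightarrow> (real \<Rightarrow> real) \<Rightarrow> (real \<times> real) set" where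
  "region a b g = {(x, y). a \<le> x \<and> x \<le> b \<and> \<bar>y\<bar> \<le> g x}"

lemma compact_region:
  assumes "continuous_on UNIV g" shows "compact (region a b g)"
proof -
  have "compact (g ` {a..b})"
    by (intro compact_continuous_image continuous_on_subset[OF assms]) auto
  then obtain B where B: "\<And>x. x \<in> {a..b} \<Longrightarrow> g x \<le> B"
    by (metis bounded_imp_bdd_above bdd_above_def compact_imp_bounded imageI)
  have "region a b g \<subseteq> {a..b} \<times> {-B..B}"
    using B by (fastforce simp: region_def abs_le_iff)
  moreover have "bounded ({a..b} \<times> {-B..B})" by (intro bounded_Times) auto
  moreover have "closed (region a b g)"
  proof -
    have g': "continuous_on UNIV (\<lambda>p::real \<times> real. g (fst p))"
      by (rule continuous_on_compose2[OF assms]) (auto intro!: continuous_intros)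
    have "region a b g = {p. a \<le> fst p} \<inter> {p. fst p \<le> b} \<inter> {p. \<bar>snd p\<bar> \<le> g (fst p)}"
      by (auto simp: region_def)
    then show ?thesis
      using g' by (auto intro!: closed_Int closed_Collect_le continuous_intros)
  qed
  ultimately show ?thesis by (metis bounded_subset compact_eq_bounded_closed)
qed

lemma region_borel: "continuous_on UNIV g \<Longrightarrow> region a b g \<in> sets borel"
  by (intro borel_compact compact_region)

lemma region_integral:
  fixes h :: "real \<times> real \<Rightarrow> real"
  assumes g: "continuous_on UNIV g" and h: "h \<in> borel_measurable borel"
    and bound: "\<And>p. p \<in> region a b g \<Longrightarrow> \<bar>h p\<bar> \<le> B"
  shows "((\<lambda>x. integral {- g x..g x} (\<lambda>y. h (x, y))) has_integral (LINT p:region a b g|lebesgue. h p)) {a..b}"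
proof -
  let ?H = "\<lambda>p. indicator (region a b g) p *\<^sub>R h p"
  note R = region_borel[OF g, of a b]
  have fin: "emeasure lborel (region a b g) < \<infinity>"
    using emeasure_compact_finite[OF compact_region[OF g, of a b]] by simp
  have int: "integrable lborel ?H"
    using R fin bound h by (intro integrableI_bounded_set_indicator[where B = B]) auto
  then have int2: "integrable (lborel \<Otimes>\<^sub>M lborel) ?H" by (simp add: lborel_prod)
  have HI: "((\<lambda>x. \<integral>y. ?H (x, y) \<partial>lborel) has_integral (\<integral>x. (\<integral>y. ?H (x, y) \<partial>lborel) \<partial>lborel)) UNIV"
    by (rule has_integral_integral_lborel) (rule lborel_pair.integrable_fst'[OF int2])
  have eq: "(\<integral>x. (\<integral>y. ?H (x, y) \<partial>lborel) \<partial>lborel) = (LINT p:region a b g|lebesgue. h p)"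
    unfolding set_lebesgue_integral_def lborel_pair.integral_fst'[OF int2] lborel_prod
    by (rule integral_completion[symmetric]) (use int in auto)
  have inner: "(\<integral>y. ?H (x, y) \<partial>lborel) = (if x \<in> {a..b} then integral {- g x..g x} (\<lambda>y. h (x, y)) else 0)" for x
  proof (cases "x \<in> {a..b}")
    case True
    have ind: "?H (x, y) = indicator {- g x..g x} y *\<^sub>R h (x, y)" for y
      using True by (auto simp: region_def indicator_def abs_le_iff)
    have "(\<lambda>y. h (x, y)) \<in> borel_measurable lborel"
      using measurable_compose[OF _ h, of "Pair x" lborel] by simp
    then have "set_integrable lborel {- g x..g x} (\<lambda>y. h (x, y))"
      unfolding set_integrable_def
      using bound True by (intro integrableI_bounded_set_indicator[where B = B])
        (auto simp: region_def abs_le_iff emeasure_lborel_Icc_eq)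
    from set_borel_integral_eq_integral(2)[OF this] show ?thesis
      unfolding ind set_lebesgue_integral_def using True by simp
  qed (auto simp: region_def)
  from HI[unfolded eq] show ?thesis unfolding inner has_integral_restrict_UNIV .
qed

lemma region_measure:
  assumes g: "continuous_on UNIV g" and nonneg: "\<And>x. x \<in> {a..b} \<Longrightarrow> 0 \<le> g x"
  shows "emeasure lebesgue (region a b g) = ennreal (integral {a..b} (\<lambda>x. 2 * g x))"
proof -
  have "((\<lambda>x. integral {- g x..g x} (\<lambda>y. 1::real)) has_integral (LINT p:region a b g|lebesgue. (1::real))) {a..b}"
    using assms by (intro region_integral[where B = 1]) auto
  then have "integral {a..b} (\<lambda>x. integral {- g x..g x} (\<lambda>y. 1::real)) = measure lebesgue (region a b g)"
    by (simp add: integral_unique set_lebesgue_integral_def)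
  also have "integral {a..b} (\<lambda>x. integral {- g x..g x} (\<lambda>y. 1::real)) = integral {a..b} (\<lambda>x. 2 * g x)"
    using nonneg by (intro integral_cong) auto
  moreover have "region a b g \<in> lmeasurable" by (intro lmeasurable_compact compact_region g)
  ultimately show ?thesis by (simp add: emeasure_eq_measure2 fmeasurableD2)
qed

lemma C1cD:
  assumes "\<phi> \<in> C1c"
  shows "continuous_on UNIV \<phi>" "continuous_on UNIV (partial_x \<phi>)" "continuous_on UNIV (partial_y \<phi>)"
    "((\<lambda>s. \<phi> (s, y)) has_real_derivative partial_x \<phi> (x, y)) (at x)"
    "((\<lambda>s. \<phi> (x, s)) has_real_derivative partial_y \<phi> (x, y)) (at y)"
proof -
  have d: "\<phi> differentiable (at p)" for p using assms unfolding C1c_def by blast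
  show "continuous_on UNIV \<phi>"
    using d by (intro continuous_at_imp_continuous_on) (auto intro: differentiable_imp_continuous_within)
  show "continuous_on UNIV (partial_x \<phi>)" "continuous_on UNIV (partial_y \<phi>)"
    using assms by (auto simp: C1c_def)
  have "(\<lambda>s. (s, y)) differentiable (at x)" "(\<lambda>s. (x, s)) differentiable (at y)"
    unfolding differentiable_def by (auto intro!: derivative_eq_intros exI)
  then have "(\<phi> \<circ> (\<lambda>s. (s, y))) differentiable (at x)" "(\<phi> \<circ> (\<lambda>s. (x, s))) differentiable (at y)"
    by (auto intro!: differentiable_chain_at d)
  then show "((\<lambda>s. \<phi> (s, y)) has_real_derivative partial_x \<phi> (x, y)) (at x)"
    "((\<lambda>s. \<phi> (x, s)) has_real_derivative partial_y \<phi> (x, y)) (at y)"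
    by (auto simp: partial_x_def partial_y_def o_def DERIV_deriv_iff_real_differentiable)
qed

text \<open>
  The integrand in the definition of the perimeter.
\<close>

definition divergence :: "real \<Rightarrow> (real \<times> real \<Rightarrow> real) \<Rightarrow> (real \<times> real \<Rightarrow> real) \<Rightarrow> real \<times> real \<Rightarrow> real" where
  "divergence \<alpha> \<phi>\<^sub>1 \<phi>\<^sub>2 p = partial_x \<phi>\<^sub>1 p + \<bar>fst p\<bar> powr \<alpha> * partial_y \<phi>\<^sub>2 p"

lemma divergence_measurable:
  assumes "\<phi>\<^sub>1 \<in> C1c" "\<phi>\<^sub>2 \<in> C1c"
  shows "divergence \<alpha> \<phi>\<^sub>1 \<phi>\<^sub>2 \<in> borel_measurable borel"
proof -
  have "partial_x \<phi>\<^sub>1 \<in> borel_measurable borel" "partial_y \<phi>\<^sub>2 \<in> borel_measurable borel"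
    using C1cD assms by (auto intro: borel_measurable_continuous_onI)
  moreover have "(\<lambda>p::real\<times>real. \<bar>fst p\<bar> powr \<alpha>) \<in> borel_measurable borel"
    by (intro powr_real_measurable borel_measurable_abs borel_measurable_const
        borel_measurable_continuous_onI continuous_intros)
  ultimately show ?thesis unfolding divergence_def[abs_def] by measurable
qed

lemma perimeter_cong:
  assumes "E \<in> sets lebesgue" "F \<in> sets lebesgue" "eq_ae E F"
  shows "grushin_perimeter \<alpha> E = grushin_perimeter \<alpha> F"
proof -
  have "(LINT p:E|lebesgue. divergence \<alpha> \<phi>\<^sub>1 \<phi>\<^sub>2 p) = (LINT p:F|lebesgue. divergence \<alpha> \<phi>\<^sub>1 \<phi>\<^sub>2 p)"
    if "\<phi>\<^sub>1 \<in> C1c" "\<phi>\<^sub>2 \<in> C1c" for \<phi>\<^sub>1 \<phi>\<^sub>2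
  proof -
    have m: "divergence \<alpha> \<phi>\<^sub>1 \<phi>\<^sub>2 \<in> borel_measurable lebesgue"
      using divergence_measurable[OF that] by (intro measurable_completion) simp
    have "AE p in lebesgue. p \<notin> sym_diff E F"
      using assms(3) unfolding eq_ae_def by (rule AE_not_in)
    then have "AE p in lebesgue. indicator E p *\<^sub>R divergence \<alpha> \<phi>\<^sub>1 \<phi>\<^sub>2 p = indicator F p *\<^sub>R divergence \<alpha> \<phi>\<^sub>1 \<phi>\<^sub>2 p"
      by eventually_elim (auto simp: indicator_def)
    then show ?thesis unfolding set_lebesgue_integral_def
      using m assms by (intro integral_cong_AE) auto
  qed
  then show ?thesis unfolding grushin_perimeter_def divergence_def
    by (intro SUP_cong) auto
qed

text \<open>
  Fubini's theorem for the integral of the divergence; the part with \<open>\<phi>\<^sub>2\<close> is integrated in \<open>y\<close>.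
\<close>

lemma region_divergence_has_integral:
  assumes g: "continuous_on UNIV g" and nonneg: "\<And>x. x \<in> {a..b} \<Longrightarrow> 0 \<le> g x"
    and "\<alpha> \<ge> 0" and \<phi>: "\<phi>\<^sub>1 \<in> C1c" "\<phi>\<^sub>2 \<in> C1c"
  shows "((\<lambda>x. integral {- g x..g x} (\<lambda>y. partial_x \<phi>\<^sub>1 (x, y)) + \<bar>x\<bar> powr \<alpha> * (\<phi>\<^sub>2 (x, g x) - \<phi>\<^sub>2 (x, - g x)))
    has_integral (LINT p:region a b g|lebesgue. partial_x \<phi>\<^sub>1 p + \<bar>fst p\<bar> powr \<alpha> * partial_y \<phi>\<^sub>2 p)) {a..b}"
proof -
  have bd: "\<exists>B. \<forall>p \<in> region a b g. \<bar>h p\<bar> \<le> B" if "continuous_on UNIV h" for h :: "real \<times> real \<Rightarrow> real"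
  proof -
    have "compact (h ` region a b g)"
      by (intro compact_continuous_image compact_region g continuous_on_subset[OF that]) auto
    then show ?thesis by (auto dest!: compact_imp_bounded simp: bounded_iff)
  qed
  obtain B1 where B1: "\<And>p. p \<in> region a b g \<Longrightarrow> \<bar>partial_x \<phi>\<^sub>1 p\<bar> \<le> B1"
    using bd[OF C1cD(2)[OF \<phi>(1)]] by blast
  obtain B2 where B2: "\<And>p. p \<in> region a b g \<Longrightarrow> \<bar>partial_y \<phi>\<^sub>2 p\<bar> \<le> B2"
    using bd[OF C1cD(3)[OF \<phi>(2)]] by blast
  define M where "M = max \<bar>a\<bar> \<bar>b\<bar> powr \<alpha>"
  have bound: "\<bar>divergence \<alpha> \<phi>\<^sub>1 \<phi>\<^sub>2 p\<bar> \<le> B1 + M * B2" if p: "p \<in> region a b g" for p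
  proof -
    have "\<bar>fst p\<bar> \<le> max \<bar>a\<bar> \<bar>b\<bar>" using p by (auto simp: region_def)
    then have "\<bar>fst p\<bar> powr \<alpha> \<le> M" unfolding M_def using \<open>\<alpha> \<ge> 0\<close> by (intro powr_mono2) auto
    then have "\<bar>fst p\<bar> powr \<alpha> * \<bar>partial_y \<phi>\<^sub>2 p\<bar> \<le> M * B2"
      using B2[OF p] by (intro mult_mono) (auto simp: M_def)
    then show ?thesis unfolding divergence_def using B1[OF p]
      by (intro order_trans[OF abs_triangle_ineq] add_mono) (auto simp: abs_mult)
  qed
  note I = region_integral[OF g divergence_measurable[OF \<phi>] bound]
  have "integral {- g x..g x} (\<lambda>y. divergence \<alpha> \<phi>\<^sub>1 \<phi>\<^sub>2 (x, y)) =
     integral {- g x..g x} (\<lambda>y. partial_x \<phi>\<^sub>1 (x, y)) + \<bar>x\<bar> powr \<alpha> * (\<phi>\<^sub>2 (x, g x) - \<phi>\<^sub>2 (x, - g x))"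
    if x: "x \<in> {a..b}" for x
  proof -
    have "continuous_on {- g x..g x} (\<lambda>y. partial_x \<phi>\<^sub>1 (x, y))"
      by (rule continuous_on_compose2[OF C1cD(2)[OF \<phi>(1)]]) (auto intro!: continuous_intros)
    then have i1: "((\<lambda>y. partial_x \<phi>\<^sub>1 (x, y)) has_integral integral {- g x..g x} (\<lambda>y. partial_x \<phi>\<^sub>1 (x, y))) {- g x..g x}"
      by (intro integrable_integral integrable_continuous_real)
    have i2: "((\<lambda>y. partial_y \<phi>\<^sub>2 (x, y)) has_integral (\<phi>\<^sub>2 (x, g x) - \<phi>\<^sub>2 (x, - g x))) {- g x..g x}"
      using nonneg[OF x] C1cD(5)[OF \<phi>(2)]
      by (intro fundamental_theorem_of_calculus)
         (auto simp: has_real_derivative_iff_has_vector_derivative[symmetric] intro: DERIV_subset)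
    from has_integral_add[OF i1 has_integral_mult_right[OF i2, of "\<bar>x\<bar> powr \<alpha>"]]
    show ?thesis unfolding divergence_def by (simp add: integral_unique)
  qed
  from has_integral_eq[OF this I] show ?thesis unfolding divergence_def .
qed

lemma perimeter_ge:
  assumes "\<phi>\<^sub>1 \<in> C1c" "\<phi>\<^sub>2 \<in> C1c" "\<And>p. (\<phi>\<^sub>1 p)\<^sup>2 + (\<phi>\<^sub>2 p)\<^sup>2 \<le> 1"
  shows "ereal (LINT p:E|lebesgue. partial_x \<phi>\<^sub>1 p + \<bar>fst p\<bar> powr \<alpha> * partial_y \<phi>\<^sub>2 p) \<le> grushin_perimeter \<alpha> E"
  unfolding grushin_perimeter_def
  by (rule SUP_upper2[of "(\<phi>\<^sub>1, \<phi>\<^sub>2)"]) (use assms in auto)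

lemma perimeter_le:
  assumes "\<And>\<phi>\<^sub>1 \<phi>\<^sub>2. \<phi>\<^sub>1 \<in> C1c \<Longrightarrow> \<phi>\<^sub>2 \<in> C1c \<Longrightarrow> (\<And>p. (\<phi>\<^sub>1 p)\<^sup>2 + (\<phi>\<^sub>2 p)\<^sup>2 \<le> 1) \<Longrightarrow>
     (LINT p:E|lebesgue. partial_x \<phi>\<^sub>1 p + \<bar>fst p\<bar> powr \<alpha> * partial_y \<phi>\<^sub>2 p) \<le> C"
  shows "grushin_perimeter \<alpha> E \<le> ereal C"
  unfolding grushin_perimeter_def by (rule SUP_least) (use assms in auto)

text \<open>
  The flux of the first component through the vertical section of the region at \<open>x\<close>.
\<close>

definition line_flux :: "(real \<times> real \<Rightarrow> real) \<Rightarrow> (real \<Rightarrow> real) \<Rightarrow> real \<Rightarrow> real" where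
  "line_flux \<phi> g x = integral {- g x..g x} (\<lambda>y. \<phi> (x, y))"

lemma line_flux_bound:
  assumes "\<phi> \<in> C1c" "\<And>p. \<bar>\<phi> p\<bar> \<le> 1" "0 \<le> g x"
  shows "\<bar>line_flux \<phi> g x\<bar> \<le> 2 * g x"
proof -
  have "continuous_on {- g x..g x} (\<lambda>y. \<phi> (x, y))"
    by (rule continuous_on_compose2[OF C1cD(1)[OF assms(1)]]) (auto intro!: continuous_intros)
  then have "(\<lambda>y. \<phi> (x, y)) integrable_on cbox (- g x) (g x)"
    by (metis box_real(2) integrable_continuous_real)
  then have "norm (integral (cbox (- g x) (g x)) (\<lambda>y. \<phi> (x, y))) \<le> 1 * measure lborel (cbox (- g x) (g x))"
    using assms(2) by (intro integrable_bound) auto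
  then show ?thesis using assms(3) by (simp add: line_flux_def)
qed

section \<open>The divergence theorem on a region between two graphs\<close>

text \<open>
  Joint differentiability in the abscissa and the upper limit, so that the chain rule applies when
  the upper limit is a function of the abscissa.
\<close>

lemma integral_upper_limit_has_derivative:
  assumes \<phi>: "\<phi> \<in> C1c" and "c < h"
  shows "((\<lambda>(x, y). integral {c..y} (\<lambda>t. \<phi> (x, t))) has_derivative
     (\<lambda>(dx, dy). dx * integral {c..h} (\<lambda>t. partial_x \<phi> (x, t)) + dy * \<phi> (x, h))) (at (x, h))"
proof -
  note cont = C1cD(1,2)[OF \<phi>]
  have line: "continuous_on S (\<lambda>t. \<phi> (x, t))" for x S
    by (rule continuous_on_compose2[OF cont(1)]) (auto intro!: continuous_intros)
  have "((\<lambda>x. integral (cbox c h) (\<lambda>t. \<phi> (x, t))) has_real_derivative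
      integral (cbox c h) (\<lambda>t. partial_x \<phi> (x, t))) (at x within UNIV)"
  proof (rule leibniz_rule_field_derivative)
    show "continuous_on (UNIV \<times> cbox c h) (\<lambda>(x, t). partial_x \<phi> (x, t))"
      using continuous_on_subset[OF cont(2)] by (simp add: case_prod_beta')
  qed (use C1cD(4)[OF \<phi>] line in \<open>auto simp flip: interval_cbox intro!: integrable_continuous_real\<close>)
  then have dx: "((\<lambda>x. integral {c..h} (\<lambda>t. \<phi> (x, t))) has_derivative
      (\<lambda>dx. dx * integral {c..h} (\<lambda>t. partial_x \<phi> (x, t)))) (at x within UNIV)"
    by (simp add: has_field_derivative_def mult_commute_abs)
  have dy: "((\<lambda>y. integral {c..y} (\<lambda>t. \<phi> (x, t))) has_derivative
      blinfun_apply (blinfun_scaleR_left (\<phi> (x, y)))) (at y within {c<..})" if "y \<in> {c<..}" for x y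
  proof -
    have "((\<lambda>u. integral {c..u} (\<lambda>t. \<phi> (x, t))) has_real_derivative \<phi> (x, y)) (at y within {c..y + 1})"
      using that by (intro integral_has_real_derivative line) auto
    moreover have "at y within {c..y + 1} = at y" using that by (intro at_within_interior) auto
    ultimately have "((\<lambda>u. integral {c..u} (\<lambda>t. \<phi> (x, t))) has_real_derivative \<phi> (x, y)) (at y)"
      by simp
    from has_field_derivative_at_within[OF this, of "{c<..}"] show ?thesis by (simp add: has_field_derivative_def mult_commute_abs)
  qed
  have "((\<lambda>(x, y). integral {c..y} (\<lambda>t. \<phi> (x, t))) has_derivative
     (\<lambda>(tx, ty). tx * integral {c..h} (\<lambda>t. partial_x \<phi> (x, t)) + blinfun_apply (blinfun_scaleR_left (\<phi> (x, h))) ty))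
     (at (x, h) within UNIV \<times> {c<..})"
  proof (rule has_derivative_partialsI[where f = "\<lambda>x y. integral {c..y} (\<lambda>t. \<phi> (x, t))"
        and fy = "\<lambda>x y. blinfun_scaleR_left (\<phi> (x, y))"])
    show "((\<lambda>x. integral {c..h} (\<lambda>t. \<phi> (x, t))) has_derivative
      (\<lambda>dx. dx * integral {c..h} (\<lambda>t. partial_x \<phi> (x, t)))) (at x within UNIV)"
      by (rule dx)
    show "((\<lambda>y. integral {c..y} (\<lambda>t. \<phi> (x, t))) has_derivative
      blinfun_apply (blinfun_scaleR_left (\<phi> (x, y)))) (at y within {c<..})" if "y \<in> {c<..}" for x y
      using that by (rule dy)
    have "isCont \<phi> p" for p by (rule bspec[OF cont(1)[unfolded continuous_on_eq_continuous_at[OF open_UNIV]]]) simp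
    then have "continuous (at (x, h) within UNIV \<times> {c<..}) \<phi>"
      by (rule continuous_at_imp_continuous_within)
    then have "continuous (at (x, h) within UNIV \<times> {c<..}) (\<lambda>p. blinfun_scaleR_left (\<phi> p) :: real \<Rightarrow>\<^sub>L real)"
      by (rule bounded_linear.continuous[OF bounded_linear_blinfun_scaleR_left])
    moreover have "(\<lambda>p. blinfun_scaleR_left (\<phi> p) :: real \<Rightarrow>\<^sub>L real) = (\<lambda>(x, y). blinfun_scaleR_left (\<phi> (x, y)))"
      by auto
    ultimately show "continuous (at (x, h) within UNIV \<times> {c<..}) (\<lambda>(x, y). blinfun_scaleR_left (\<phi> (x, y)) :: real \<Rightarrow>\<^sub>L real)"
      by metis
    show "h \<in> {c<..}" using \<open>c < h\<close> by simp
    show "convex {c<..}" by (rule convex_real_interval)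
  qed
  moreover have "at (x, h) within UNIV \<times> {c<..} = at (x, h)"
    using \<open>c < h\<close> by (intro at_within_open open_Times) auto
  ultimately show ?thesis by simp
qed

lemma line_flux_eq_difference:
  assumes \<phi>: "\<phi> \<in> C1c" and "0 \<le> g x" "g x \<le> B"
  shows "line_flux \<phi> g x = integral {- B..g x} (\<lambda>t. \<phi> (x, t)) - integral {- B..- g x} (\<lambda>t. \<phi> (x, t))"
proof -
  have "(\<lambda>t. \<phi> (x, t)) integrable_on {- B..g x}"
    by (intro integrable_continuous_real continuous_on_compose2[OF C1cD(1)[OF \<phi>]]) (auto intro!: continuous_intros)
  from Henstock_Kurzweil_Integration.integral_combine[OF _ _ this, of "- g x"] assms show ?thesis
    by (simp add: line_flux_def)
qed

lemma integral_variable_limit_derivative: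
  assumes \<phi>: "\<phi> \<in> C1c" and h: "(h has_real_derivative h') (at x)" and "c < h x"
  shows "((\<lambda>x. integral {c..h x} (\<lambda>t. \<phi> (x, t))) has_real_derivative
     integral {c..h x} (\<lambda>t. partial_x \<phi> (x, t)) + h' * \<phi> (x, h x)) (at x)"
proof -
  have "((\<lambda>x. (x, h x)) has_derivative (\<lambda>d. (d, d * h'))) (at x)"
    using h by (auto intro!: has_derivative_Pair simp: has_field_derivative_def mult_commute_abs)
  from has_derivative_compose[OF this integral_upper_limit_has_derivative[OF \<phi> \<open>c < h x\<close>, of x]]
  have "((\<lambda>x. integral {c..h x} (\<lambda>t. \<phi> (x, t))) has_derivative
    (\<lambda>d. d * integral {c..h x} (\<lambda>t. partial_x \<phi> (x, t)) + d * h' * \<phi> (x, h x))) (at x)" by simp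
  moreover have "(\<lambda>d. d * integral {c..h x} (\<lambda>t. partial_x \<phi> (x, t)) + d * h' * \<phi> (x, h x))
     = (*) (integral {c..h x} (\<lambda>t. partial_x \<phi> (x, t)) + h' * \<phi> (x, h x))"
    by (auto simp: algebra_simps)
  ultimately show ?thesis by (simp add: has_field_derivative_def)
qed

lemma integral_variable_limit_continuous:
  assumes \<phi>: "\<phi> \<in> C1c" and h: "continuous_on S h" and "\<And>x. x \<in> S \<Longrightarrow> c < h x"
  shows "continuous_on S (\<lambda>x. integral {c..h x} (\<lambda>t. \<phi> (x, t)))"
proof -
  have "continuous_on {p. c < snd p} (\<lambda>(x, y). integral {c..y} (\<lambda>t. \<phi> (x, t)))"
    using has_derivative_continuous[OF integral_upper_limit_has_derivative[OF \<phi>]]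
    by (intro continuous_at_imp_continuous_on) auto
  moreover have "continuous_on S (\<lambda>x. (x, h x))" by (intro continuous_intros h)
  moreover have "(\<lambda>x. (x, h x)) ` S \<subseteq> {p. c < snd p}" using assms(3) by auto
  ultimately show ?thesis by (auto dest: continuous_on_compose2)
qed

text \<open>
  The divergence theorem on a region between two graphs, with the boundary integral over the graphs
  estimated by the Cauchy--Schwarz inequality. The profile is only differentiable in the interior, and the
  bound \<open>l\<close> for the boundary density need only be integrable; the optimal profile has an infinite slope
  at the right end.
\<close>

lemma region_divergence_le:
  assumes "a \<le> b" and g: "continuous_on UNIV g" and nonneg: "\<And>x. 0 \<le> g x"
    and deriv: "\<And>x. x \<in> {a<..<b} \<Longrightarrow> (g has_real_derivative g' x) (at x)"
    and l: "(l has_integral L) {a..b}"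
    and l_bound: "\<And>x. x \<in> {a<..<b} \<Longrightarrow> sqrt ((\<bar>x\<bar> powr \<alpha>)\<^sup>2 + (g' x)\<^sup>2) \<le> l x"
    and "\<alpha> \<ge> 0" and \<phi>: "\<phi>\<^sub>1 \<in> C1c" "\<phi>\<^sub>2 \<in> C1c" and unit: "\<And>p. (\<phi>\<^sub>1 p)\<^sup>2 + (\<phi>\<^sub>2 p)\<^sup>2 \<le> 1"
  shows "(LINT p:region a b g|lebesgue. partial_x \<phi>\<^sub>1 p + \<bar>fst p\<bar> powr \<alpha> * partial_y \<phi>\<^sub>2 p)
     \<le> line_flux \<phi>\<^sub>1 g b - line_flux \<phi>\<^sub>1 g a + 2 * L"
proof -
  define dx where "dx x = integral {- g x..g x} (\<lambda>y. partial_x \<phi>\<^sub>1 (x, y))" for x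
  define bd where "bd x = g' x * (\<phi>\<^sub>1 (x, g x) + \<phi>\<^sub>1 (x, - g x))" for x
  have "compact (g ` {a..b})"
    by (intro compact_continuous_image continuous_on_subset[OF g]) auto
  then obtain B0 where B0: "\<And>x. x \<in> {a..b} \<Longrightarrow> g x \<le> B0"
    by (metis bounded_imp_bdd_above bdd_above_def compact_imp_bounded imageI)
  define B where "B = B0 + 1"
  have B: "g x < B" if "x \<in> {a..b}" for x using B0[OF that] by (simp add: B_def)
  have gminus: "- B < g x" if "x \<in> {a..b}" for x using B[OF that] nonneg[of x] by linarith
  \<comment> \<open>the flux is a difference of integrals with the fixed lower limit \<open>- B\<close>, to which the chain rule applies\<close>
  define \<Phi> where "\<Phi> x = integral {- B..g x} (\<lambda>t. \<phi>\<^sub>1 (x, t)) - integral {- B..- g x} (\<lambda>t. \<phi>\<^sub>1 (x, t))" for x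
  have \<Phi>: "line_flux \<phi>\<^sub>1 g x = \<Phi> x" if "x \<in> {a..b}" for x
    unfolding \<Phi>_def using B[OF that] nonneg by (intro line_flux_eq_difference \<phi>) auto
  have "((\<lambda>x. dx x + bd x) has_integral (\<Phi> b - \<Phi> a)) {a..b}"
  proof (rule fundamental_theorem_of_calculus_interior[OF \<open>a \<le> b\<close>])
    show "continuous_on {a..b} \<Phi>" unfolding \<Phi>_def
      using B gminus by (intro continuous_intros integral_variable_limit_continuous \<phi> continuous_on_subset[OF g]) auto
    fix x assume x: "x \<in> {a<..<b}"
    then have x': "x \<in> {a..b}" by auto
    have "(\<Phi> has_real_derivative
       (integral {- B..g x} (\<lambda>t. partial_x \<phi>\<^sub>1 (x, t)) + g' x * \<phi>\<^sub>1 (x, g x))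
       - (integral {- B..- g x} (\<lambda>t. partial_x \<phi>\<^sub>1 (x, t)) + (- g' x) * \<phi>\<^sub>1 (x, - g x))) (at x)"
      unfolding \<Phi>_def using B[OF x'] gminus[OF x']
      by (intro DERIV_diff integral_variable_limit_derivative \<phi> deriv x DERIV_minus) auto
    moreover have "integral {- B..g x} (\<lambda>t. partial_x \<phi>\<^sub>1 (x, t)) - integral {- B..- g x} (\<lambda>t. partial_x \<phi>\<^sub>1 (x, t)) = dx x"
    proof -
      have "(\<lambda>t. partial_x \<phi>\<^sub>1 (x, t)) integrable_on {- B..g x}"
        by (intro integrable_continuous_real continuous_on_compose2[OF C1cD(2)[OF \<phi>(1)]]) (auto intro!: continuous_intros)
      from Henstock_Kurzweil_Integration.integral_combine[OF _ _ this, of "- g x"] B[OF x'] nonneg[of x]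
      show ?thesis by (simp add: dx_def)
    qed
    ultimately show "(\<Phi> has_vector_derivative dx x + bd x) (at x)"
      unfolding has_real_derivative_iff_has_vector_derivative[symmetric] bd_def
      by (simp add: algebra_simps)
  qed
  note flux = this
  note div = region_divergence_has_integral[OF g nonneg \<open>\<alpha> \<ge> 0\<close> \<phi>, of a b]
  let ?I = "LINT p:region a b g|lebesgue. partial_x \<phi>\<^sub>1 p + \<bar>fst p\<bar> powr \<alpha> * partial_y \<phi>\<^sub>2 p"
  have rest: "((\<lambda>x. (dx x + \<bar>x\<bar> powr \<alpha> * (\<phi>\<^sub>2 (x, g x) - \<phi>\<^sub>2 (x, - g x))) - (dx x + bd x)) has_integral
      (?I - (\<Phi> b - \<Phi> a))) {a..b}"
    using has_integral_diff[OF div flux] by (simp add: dx_def)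
  have "?I - (\<Phi> b - \<Phi> a) \<le> 2 * L"
  proof (rule has_integral_le)
    show "((\<lambda>x. (dx x + \<bar>x\<bar> powr \<alpha> * (\<phi>\<^sub>2 (x, g x) - \<phi>\<^sub>2 (x, - g x))) - (dx x + bd x)) has_integral
      (?I - (\<Phi> b - \<Phi> a))) {a<..<b}" using rest by (simp add: has_integral_Icc_iff_Ioo)
    show "((\<lambda>x. 2 * l x) has_integral 2 * L) {a<..<b}"
      using has_integral_mult_right[OF l, of 2] by (simp add: has_integral_Icc_iff_Ioo)
    fix x assume x: "x \<in> {a<..<b}"
    have cs: "\<bar>x\<bar> powr \<alpha> * u - g' x * w \<le> l x" if "w\<^sup>2 + u\<^sup>2 \<le> 1" for u w
    proof -
      have "(A\<^sup>2 + G\<^sup>2) * (w\<^sup>2 + u\<^sup>2) = (A * u - G * w)\<^sup>2 + (A * w + G * u)\<^sup>2" for A G :: real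
        by (simp add: power2_eq_square algebra_simps)
      then have "(\<bar>x\<bar> powr \<alpha> * u - g' x * w)\<^sup>2 \<le> ((\<bar>x\<bar> powr \<alpha>)\<^sup>2 + (g' x)\<^sup>2) * (w\<^sup>2 + u\<^sup>2)"
        by simp
      also have "\<dots> \<le> ((\<bar>x\<bar> powr \<alpha>)\<^sup>2 + (g' x)\<^sup>2) * 1"
        using that by (intro mult_left_mono) auto
      finally have "\<bar>x\<bar> powr \<alpha> * u - g' x * w \<le> sqrt ((\<bar>x\<bar> powr \<alpha>)\<^sup>2 + (g' x)\<^sup>2)"
        by (intro real_le_rsqrt) simp
      then show ?thesis using l_bound[OF x] by linarith
    qed
    have "(\<phi>\<^sub>1 (x, - g x))\<^sup>2 + (- \<phi>\<^sub>2 (x, - g x))\<^sup>2 \<le> 1" using unit by simp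
    from cs[OF this] cs[OF unit, of "(x, g x)"]
    show "(dx x + \<bar>x\<bar> powr \<alpha> * (\<phi>\<^sub>2 (x, g x) - \<phi>\<^sub>2 (x, - g x))) - (dx x + bd x) \<le> 2 * l x"
      by (simp add: bd_def algebra_simps)
  qed
  then show ?thesis using \<Phi> \<open>a \<le> b\<close> by simp
qed

section \<open>Symmetric profile sets and the optimal profile\<close>

lemma half_ereal_sum:
  "(1/2 :: ereal) * (ereal a + ereal b + ereal c) = ereal ((a + b + c) / 2)"
proof -
  have "(1/2 :: ereal) = ereal (1/2)" by (simp add: one_ereal_def)
  then show ?thesis by simp
qed

lemma half_ereal_mono:
  fixes x y :: ereal assumes "x \<le> y" shows "(1/2 :: ereal) * x \<le> 1/2 * y"
  using assms by (intro ereal_mult_left_mono) auto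

text \<open>
  An even function on the whole line that agrees with \<open>f\<close> on \<open>[0,r]\<close> and is constant beyond \<open>r\<close>. The
  values of a profile outside \<open>[0,r]\<close> are irrelevant, and this extension is continuous everywhere.
\<close>

definition even_extension :: "(real \<Rightarrow> real) \<Rightarrow> real \<Rightarrow> real \<Rightarrow> real" where
  "even_extension f r x = f (min \<bar>x\<bar> r)"

lemma even_extension_simps [simp]:
  "x \<in> {0..r} \<Longrightarrow> even_extension f r x = f x"
  "even_extension f r (- x) = even_extension f r x"
  by (auto simp: even_extension_def min_def)

lemma even_extension_continuous:
  assumes "continuous_on {0..r} f" "0 < r"
  shows "continuous_on UNIV (even_extension f r)"
  unfolding even_extension_def[abs_def]
  by (rule continuous_on_compose2[OF assms(1)]) (use assms(2) in \<open>auto intro!: continuous_intros\<close>)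

lemma even_extension_nonneg:
  assumes "\<And>x. x \<in> {0..r} \<Longrightarrow> 0 \<le> f x" "0 < r"
  shows "0 \<le> even_extension f r x"
  using assms by (auto simp: even_extension_def)

lemma profile_set_eq_region: "profile_set f r = region (- r) r (even_extension f r)"
  by (auto simp: profile_set_def region_def even_extension_def min_def abs_le_iff)

lemma vertical_line_null: "{p :: real \<times> real. fst p = 0} \<in> null_sets lebesgue"
proof -
  have "negligible {p :: real \<times> real. (1, 0) \<bullet> p = 0}"
    by (rule negligible_hyperplane) (auto simp: zero_prod_def)
  then show ?thesis by (simp add: negligible_iff_null_sets inner_prod_def)
qed

lemma eq_ae_sym: "eq_ae E F \<Longrightarrow> eq_ae F E"
  by (simp add: eq_ae_def Un_commute)

lemma eq_ae_trans:
  assumes "eq_ae E F" "eq_ae F G" shows "eq_ae E G"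
proof -
  have "sym_diff E F \<union> sym_diff F G \<in> null_sets lebesgue"
    using assms unfolding eq_ae_def by (rule null_sets.Un)
  moreover have "sym_diff E G \<subseteq> sym_diff E F \<union> sym_diff F G" by blast
  ultimately show ?thesis unfolding eq_ae_def
    by (metis negligible_iff_null_sets negligible_subset)
qed

lemma eq_ae_emeasure:
  assumes "E \<in> sets lebesgue" "F \<in> sets lebesgue" "eq_ae E F"
  shows "emeasure lebesgue E = emeasure lebesgue F"
proof (rule emeasure_eq_AE)
  have "AE p in lebesgue. p \<notin> sym_diff E F"
    using assms(3) unfolding eq_ae_def by (rule AE_not_in)
  then show "AE p in lebesgue. p \<in> E \<longleftrightarrow> p \<in> F" by eventually_elim auto
qed (use assms in auto)

lemma pos_neg_x_measurable:
  assumes "E \<in> sets lebesgue" shows "pos_x E \<in> sets lebesgue" "neg_x E \<in> sets lebesgue"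
proof -
  have "open {p :: real \<times> real. fst p > 0}" "open {p :: real \<times> real. fst p < 0}"
    by (auto intro!: open_Collect_less continuous_intros)
  then have "{p :: real \<times> real. fst p > 0} \<in> sets lebesgue" "{p :: real \<times> real. fst p < 0} \<in> sets lebesgue"
    by (auto intro: borel_open)
  then show "pos_x E \<in> sets lebesgue" "neg_x E \<in> sets lebesgue"
    using assms by (auto simp: pos_x_def neg_x_def)
qed

lemma region_lebesgue: "continuous_on UNIV g \<Longrightarrow> region a b g \<in> sets lebesgue"
  using region_borel by auto

lemma half_regions:
  assumes "eq_ae E (region (- r) r g)" "0 < r"
  shows "eq_ae (pos_x E) (region 0 r g)" "eq_ae (neg_x E) (region (- r) 0 g)"
proof -
  have n: "sym_diff E (region (- r) r g) \<union> {p. fst p = 0} \<in> null_sets lebesgue"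
    using assms(1) vertical_line_null unfolding eq_ae_def by (rule null_sets.Un)
  have "sym_diff (pos_x E) (region 0 r g) \<subseteq> sym_diff E (region (- r) r g) \<union> {p. fst p = 0}"
    "sym_diff (neg_x E) (region (- r) 0 g) \<subseteq> sym_diff E (region (- r) r g) \<union> {p. fst p = 0}"
    using assms(2) by (auto simp: pos_x_def neg_x_def region_def)
  with n show "eq_ae (pos_x E) (region 0 r g)" "eq_ae (neg_x E) (region (- r) 0 g)"
    unfolding eq_ae_def by (metis negligible_iff_null_sets negligible_subset)+
qed

lemma double_perimeter_region:
  assumes "E \<in> sets lebesgue" "eq_ae E (region (- r) r g)" "0 < r" "continuous_on UNIV g"
  shows "double_perimeter_x \<alpha> E = 1/2 * (grushin_perimeter \<alpha> (region 0 r g)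
    + grushin_perimeter \<alpha> (region (- r) 0 g) + grushin_perimeter \<alpha> (region (- r) r g))"
  unfolding double_perimeter_x_def
    perimeter_cong[OF pos_neg_x_measurable(1)[OF assms(1)] region_lebesgue[OF assms(4)] half_regions(1)[OF assms(2,3)]]
    perimeter_cong[OF pos_neg_x_measurable(2)[OF assms(1)] region_lebesgue[OF assms(4)] half_regions(2)[OF assms(2,3)]]
    perimeter_cong[OF assms(1) region_lebesgue[OF assms(4)] assms(2)] ..

lemma half_region_measures:
  assumes "E \<in> sets lebesgue" "eq_ae E (region (- r) r g)" "0 < r" "continuous_on UNIV g"
    and "\<And>x. 0 \<le> g x" "\<And>x. g (- x) = g x"
  shows "emeasure lebesgue (pos_x E) = ennreal (2 * integral {0..r} g)"
    "emeasure lebesgue (neg_x E) = ennreal (2 * integral {0..r} g)"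
proof -
  have "integral {- r..0} g = integral {0..r} g"
    using Henstock_Kurzweil_Integration.integral_reflect_real[of r 0 g] assms(6) by simp
  moreover have "integral {a..b} (\<lambda>x. 2 * g x) = 2 * integral {a..b} g" for a b by simp
  ultimately have m: "emeasure lebesgue (region 0 r g) = ennreal (2 * integral {0..r} g)"
    "emeasure lebesgue (region (- r) 0 g) = ennreal (2 * integral {0..r} g)"
    using region_measure[of g, OF assms(4,5)] by simp_all
  show "emeasure lebesgue (pos_x E) = ennreal (2 * integral {0..r} g)"
    unfolding m(1)[symmetric]
    by (intro eq_ae_emeasure pos_neg_x_measurable region_lebesgue half_regions assms)
  show "emeasure lebesgue (neg_x E) = ennreal (2 * integral {0..r} g)"
    unfolding m(2)[symmetric]
    by (intro eq_ae_emeasure pos_neg_x_measurable region_lebesgue half_regions assms)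
qed

text \<open>
  The profile from the theorem, with \<open>p\<close> in place of \<open>- k\<close>.
\<close>

definition optimal_profile :: "real \<Rightarrow> real \<Rightarrow> real \<Rightarrow> real" where
  "optimal_profile \<alpha> p x = profile_primitive \<alpha> (1/2 - p * x) / p powr (\<alpha> + 1)"

lemma affine_range:
  fixes p x :: real
  assumes "p > 0" "x \<in> {0..3 / (2 * p)}" shows "1/2 - p * x \<in> {-1..1/2}"
proof -
  have "p * x \<le> 3/2" using assms pos_le_divide_eq[of "2 * p" x 3] by (simp add: algebra_simps)
  then show ?thesis using assms by auto
qed

lemma affine_range_interior:
  fixes p x :: real
  assumes "p > 0" "x \<in> {0<..<3 / (2 * p)}" shows "1/2 - p * x \<in> {-1<..<1/2}"
proof -
  have "p * x < 3/2" using assms pos_less_divide_eq[of "2 * p" x 3] by (simp add: algebra_simps)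
  then show ?thesis using assms by auto
qed

lemma optimal_profile_continuous:
  assumes "\<alpha> \<ge> 0" "p > 0"
  shows "continuous_on {0..3 / (2 * p)} (optimal_profile \<alpha> p)"
  unfolding optimal_profile_def[abs_def]
proof (intro continuous_intros)
  show "continuous_on {0..3 / (2 * p)} (\<lambda>x. profile_primitive \<alpha> (1/2 - p * x))"
    using affine_range[OF assms(2)]
    by (intro continuous_on_compose2[OF profile_primitive_continuous[OF assms(1)]] continuous_intros) auto
qed (use assms in auto)

lemma optimal_profile_nonneg:
  assumes "\<alpha> \<ge> 0" "p > 0" "x \<in> {0..3 / (2 * p)}"
  shows "0 \<le> optimal_profile \<alpha> p x"
proof -
  note s = affine_range[OF assms(2,3)]
  have "0 \<le> (1/2) powr \<alpha> * sqrt (1 - (1/2 - p * x)\<^sup>2)"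
    using s by (intro mult_nonneg_nonneg) (auto simp: abs_square_le_1)
  then show ?thesis using profile_primitive_ge[OF assms(1) s] by (simp add: optimal_profile_def)
qed

lemma optimal_profile_derivative:
  assumes "\<alpha> \<ge> 0" "p > 0" "x \<in> {0<..<3 / (2 * p)}"
  shows "(optimal_profile \<alpha> p has_real_derivative
     (1/2 - p * x) * x powr \<alpha> / sqrt (1 - (1/2 - p * x)\<^sup>2)) (at x)"
proof -
  let ?u = "1/2 - p * x"
  note s = affine_range_interior[OF assms(2,3)]
  have "((\<lambda>x. 1/2 - p * x) has_real_derivative - p) (at x)"
    by (auto intro!: derivative_eq_intros)
  from DERIV_chain2[OF profile_primitive_derivative[OF assms(1) s] this]
  have "(optimal_profile \<alpha> p has_real_derivative
     (- (?u * (1/2 - ?u) powr \<alpha> / sqrt (1 - ?u\<^sup>2)) * - p) / p powr (\<alpha> + 1)) (at x)"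
    unfolding optimal_profile_def[abs_def] by (rule DERIV_cdivide)
  moreover have "(- (?u * (1/2 - ?u) powr \<alpha> / sqrt (1 - ?u\<^sup>2)) * - p) / p powr (\<alpha> + 1)
     = ?u * x powr \<alpha> / sqrt (1 - ?u\<^sup>2)"
  proof -
    have "(1/2 - ?u) powr \<alpha> = p powr \<alpha> * x powr \<alpha>" using assms by (simp add: powr_mult)
    moreover have "p powr (\<alpha> + 1) = p powr \<alpha> * p" using assms by (simp add: powr_add)
    moreover have "p powr \<alpha> > 0" using assms by simp
    moreover have "(- (w * (q * z) / D) * - p) / (q * p) = w * z / D" if "q > 0" for w q z D :: real
      using that assms(2) by (cases "D = 0") (simp_all add: field_simps)
    ultimately show ?thesis by metis
  qed
  ultimately show ?thesis by metis
qed

text \<open>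
  Up to a power of \<open>p\<close>, the integral of \<open>sqrt (f'\<^sup>2 + x\<^sup>2\<^sup>\<alpha>)\<close> over \<open>[0, 3 / (2 p)]\<close>, where \<open>f\<close> is the
  optimal profile: the Grushin length of its graph.
\<close>

definition slope_integral :: "real \<Rightarrow> real" where
  "slope_integral \<alpha> = integral {-1..1/2} (\<lambda>t. (1/2 - t) powr \<alpha> / sqrt (1 - t\<^sup>2))"

lemma slope_has_integral:
  assumes "\<alpha> \<ge> 0" "p > 0"
  shows "((\<lambda>x. x powr \<alpha> / sqrt (1 - (1/2 - p * x)\<^sup>2)) has_integral slope_integral \<alpha> / p powr (\<alpha> + 1)) {0..3 / (2 * p)}"
proof -
  have "(\<lambda>t. 1 * (1/2 - t) powr \<alpha> / sqrt (1 - t\<^sup>2)) integrable_on {-1..1/2}"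
    using assms by (intro weight_integrable continuous_intros)
  then have "((\<lambda>t. (1/2 - t) powr \<alpha> / sqrt (1 - t\<^sup>2)) has_integral slope_integral \<alpha>) {-1..1/2}"
    unfolding slope_integral_def by (simp add: has_integral_integral)
  from has_integral_divide[OF affine_substitution[OF this assms(2)], of "p powr \<alpha>"]
  have I: "((\<lambda>x. (1/2 - (1/2 - p * x)) powr \<alpha> / sqrt (1 - (1/2 - p * x)\<^sup>2) / p powr \<alpha>) has_integral
     slope_integral \<alpha> / p / p powr \<alpha>) {0..3 / (2 * p)}" .
  have eq: "slope_integral \<alpha> / p / p powr \<alpha> = slope_integral \<alpha> / p powr (\<alpha> + 1)"
    using assms by (simp add: powr_add mult.commute)
  have "(1/2 - (1/2 - p * x)) powr \<alpha> / sqrt (1 - (1/2 - p * x)\<^sup>2) / p powr \<alpha>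
    = x powr \<alpha> / sqrt (1 - (1/2 - p * x)\<^sup>2)" if "x \<in> {0..3 / (2 * p)}" for x
    using that assms by (simp add: powr_mult)
  from has_integral_eq[OF this I] show ?thesis unfolding eq .
qed

lemma flux_scaled_has_integral:
  assumes "\<alpha> \<ge> 0" "p > 0"
  shows "((\<lambda>x. x powr \<alpha> * sqrt (1 - (1/2 - p * x)\<^sup>2)) has_integral bubble_flux \<alpha> / p powr (\<alpha> + 1)) {0..3 / (2 * p)}"
proof -
  from has_integral_divide[OF affine_substitution[OF flux_has_integral[OF assms(1)] assms(2)], of "p powr \<alpha>"]
  have I: "((\<lambda>x. (1/2 - (1/2 - p * x)) powr \<alpha> * sqrt (1 - (1/2 - p * x)\<^sup>2) / p powr \<alpha>) has_integral
     bubble_flux \<alpha> / p / p powr \<alpha>) {0..3 / (2 * p)}" .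
  have eq: "bubble_flux \<alpha> / p / p powr \<alpha> = bubble_flux \<alpha> / p powr (\<alpha> + 1)"
    using assms by (simp add: powr_add mult.commute)
  have "(1/2 - (1/2 - p * x)) powr \<alpha> * sqrt (1 - (1/2 - p * x)\<^sup>2) / p powr \<alpha>
    = x powr \<alpha> * sqrt (1 - (1/2 - p * x)\<^sup>2)" if "x \<in> {0..3 / (2 * p)}" for x
    using that assms by (simp add: powr_mult)
  from has_integral_eq[OF this I] show ?thesis unfolding eq .
qed

lemma optimal_profile_has_integral:
  assumes "\<alpha> \<ge> 0" "p > 0"
  shows "(optimal_profile \<alpha> p has_integral bubble_moment \<alpha> / p powr (\<alpha> + 2)) {0..3 / (2 * p)}"
proof -
  have "(optimal_profile \<alpha> p has_integral bubble_moment \<alpha> / p / p powr (\<alpha> + 1)) {0..3 / (2 * p)}"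
    unfolding optimal_profile_def[abs_def]
    by (intro has_integral_divide affine_substitution integral_profile_primitive assms)
  moreover have "p powr (\<alpha> + 2) = p * p powr (\<alpha> + 1)"
    using assms by (simp add: powr_mult_base add.commute)
  ultimately show ?thesis by simp
qed

lemma perimeter_constants:
  assumes "\<alpha> \<ge> 0"
  shows "4 * slope_integral \<alpha> + 2 * profile_primitive \<alpha> (1/2) = 4 * (bubble_flux \<alpha> + bubble_moment \<alpha>)"
proof -
  have "(\<lambda>t. 1 * (1/2 - t) powr \<alpha> / sqrt (1 - t\<^sup>2)) integrable_on {-1..1/2}"
    using assms by (intro weight_integrable continuous_intros)
  then have "((\<lambda>t. 2 * ((1/2 - t) powr \<alpha> / sqrt (1 - t\<^sup>2)) - t * (1/2 - t) powr \<alpha> / sqrt (1 - t\<^sup>2))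
     has_integral 2 * slope_integral \<alpha> - - profile_primitive \<alpha> (1/2)) {-1..1/2}"
    unfolding slope_integral_def using assms
    by (intro has_integral_diff has_integral_mult_right profile_primitive_has_integral) (auto simp: has_integral_integral)
  then have "integral {-1..1/2} (\<lambda>t. 2 * ((1/2 - t) powr \<alpha> / sqrt (1 - t\<^sup>2)) - t * (1/2 - t) powr \<alpha> / sqrt (1 - t\<^sup>2))
     = 2 * slope_integral \<alpha> + profile_primitive \<alpha> (1/2)" by (simp add: integral_unique)
  moreover have "(\<lambda>t. 2 * ((1/2 - t) powr \<alpha> / sqrt (1 - t\<^sup>2)) - t * (1/2 - t) powr \<alpha> / sqrt (1 - t\<^sup>2))
     = (\<lambda>t::real. (2 - t) * (1/2 - t) powr \<alpha> / sqrt (1 - t\<^sup>2))"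
    by (auto simp: diff_divide_distrib left_diff_distrib)
  ultimately show ?thesis using perimeter_integral_eq[OF assms] by simp
qed

section \<open>The perimeter of the optimal set\<close>

text \<open>
  If the slope is \<open>u A / sqrt (1 - u\<^sup>2)\<close> with \<open>A = x\<^sup>\<alpha>\<close>, then the length density is \<open>A / sqrt (1 - u\<^sup>2)\<close>.
\<close>

lemma sqrt_slope:
  fixes A u :: real
  assumes "0 \<le> A" "u\<^sup>2 < 1"
  shows "sqrt (A\<^sup>2 + (u * A / sqrt (1 - u\<^sup>2))\<^sup>2) = A / sqrt (1 - u\<^sup>2)"
proof -
  have "A\<^sup>2 + (u * A / sqrt (1 - u\<^sup>2))\<^sup>2 = (A / sqrt (1 - u\<^sup>2))\<^sup>2"
    using assms by (simp add: power_divide power_mult_distrib field_simps)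
  moreover have "0 \<le> A / sqrt (1 - u\<^sup>2)" using assms by simp
  ultimately show ?thesis by (metis real_sqrt_unique)
qed

text \<open>
  The segment on the axis \<open>x = 0\<close> contributes to the perimeters of the two halves, but not to that of
  their union, where the two fluxes through it cancel.
\<close>

lemma optimal_region_perimeters:
  fixes \<alpha> p :: real
  assumes \<alpha>: "\<alpha> \<ge> 0" and p: "p > 0"
  defines "R \<equiv> 3 / (2 * p)" and "L \<equiv> slope_integral \<alpha> / p powr (\<alpha> + 1)"
    and "g \<equiv> even_extension (optimal_profile \<alpha> p) (3 / (2 * p))"
  shows "grushin_perimeter \<alpha> (region 0 R g) \<le> ereal (2 * L + 2 * optimal_profile \<alpha> p 0)"
    "grushin_perimeter \<alpha> (region (- R) 0 g) \<le> ereal (2 * L + 2 * optimal_profile \<alpha> p 0)"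
    "grushin_perimeter \<alpha> (region (- R) R g) \<le> ereal (4 * L)"
proof -
  have R: "R > 0" using p by (simp add: R_def)
  have g_cont: "continuous_on UNIV g"
    unfolding g_def using R \<alpha> p by (intro even_extension_continuous optimal_profile_continuous) (auto simp: R_def)
  have g_nonneg: "0 \<le> g x" for x
    unfolding g_def using R \<alpha> p by (intro even_extension_nonneg optimal_profile_nonneg) (auto simp: R_def)
  have g_eq: "g x = optimal_profile \<alpha> p x" if "x \<in> {0..R}" for x
    using that by (simp add: g_def R_def)
  have g_even: "g (- x) = g x" for x by (simp add: g_def)
  have gR: "g R = 0" "g (- R) = 0"
  proof -
    have "g R = optimal_profile \<alpha> p R" using g_eq[of R] R by simp
    also have "\<dots> = 0" using p by (simp add: optimal_profile_def R_def)
    finally show "g R = 0" .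
    then show "g (- R) = 0" by (simp add: g_even)
  qed
  have g0: "g 0 = optimal_profile \<alpha> p 0" using g_eq R by simp
  let ?u = "\<lambda>x. 1/2 - p * x"
  let ?g' = "\<lambda>x. ?u x * x powr \<alpha> / sqrt (1 - (?u x)\<^sup>2)"
  let ?l = "\<lambda>x. x powr \<alpha> / sqrt (1 - (?u x)\<^sup>2)"
  have deriv: "(g has_real_derivative ?g' x) (at x)" if x: "x \<in> {0<..<R}" for x
  proof (rule has_field_derivative_transform_within_open[where S = "{0<..<R}"])
    show "(optimal_profile \<alpha> p has_real_derivative ?g' x) (at x)"
      using x by (intro optimal_profile_derivative \<alpha> p) (simp add: R_def)
  qed (use x g_eq in auto)
  have bound: "sqrt ((\<bar>x\<bar> powr \<alpha>)\<^sup>2 + (?g' x)\<^sup>2) \<le> ?l x" if x: "x \<in> {0<..<R}" for x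
  proof -
    have "(?u x)\<^sup>2 < 1"
      using affine_range_interior[OF p, of x] x by (auto simp: R_def intro: one_minus_square_pos[simplified])
    then show ?thesis using x sqrt_slope[of "x powr \<alpha>" "?u x"] by simp
  qed
  have l: "(?l has_integral L) {0..R}" unfolding L_def R_def by (rule slope_has_integral[OF \<alpha> p])
  \<comment> \<open>on the left half everything is obtained by reflection\<close>
  have deriv': "(g has_real_derivative - ?g' (- x)) (at x)" if x: "x \<in> {- R<..<0}" for x
  proof -
    have "((\<lambda>x. g (- x)) has_real_derivative ?g' (- x) * - 1) (at x)"
      by (rule DERIV_chain2[OF deriv]) (use x in \<open>auto intro!: derivative_eq_intros\<close>)
    then show ?thesis by (simp add: g_even)
  qed
  have bound': "sqrt ((\<bar>x\<bar> powr \<alpha>)\<^sup>2 + (- ?g' (- x))\<^sup>2) \<le> ?l (- x)" if x: "x \<in> {- R<..<0}" for x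
    using bound[of "- x"] x by simp
  have l': "((\<lambda>x. ?l (- x)) has_integral L) {- R..0}"
    using has_integral_reflect_real[of ?l L R 0] l by simp
  let ?I = "\<lambda>\<phi>\<^sub>1 \<phi>\<^sub>2 a b. LINT p:region a b g|lebesgue. partial_x \<phi>\<^sub>1 p + \<bar>fst p\<bar> powr \<alpha> * partial_y \<phi>\<^sub>2 p"
  have right: "?I \<phi>\<^sub>1 \<phi>\<^sub>2 0 R \<le> line_flux \<phi>\<^sub>1 g R - line_flux \<phi>\<^sub>1 g 0 + 2 * L"
    and left: "?I \<phi>\<^sub>1 \<phi>\<^sub>2 (- R) 0 \<le> line_flux \<phi>\<^sub>1 g 0 - line_flux \<phi>\<^sub>1 g (- R) + 2 * L"
    if "\<phi>\<^sub>1 \<in> C1c" "\<phi>\<^sub>2 \<in> C1c" "\<And>p. (\<phi>\<^sub>1 p)\<^sup>2 + (\<phi>\<^sub>2 p)\<^sup>2 \<le> 1" for \<phi>\<^sub>1 \<phi>\<^sub>2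
    using region_divergence_le[OF _ g_cont g_nonneg deriv l bound \<alpha> that]
      region_divergence_le[OF _ g_cont g_nonneg deriv' l' bound' \<alpha> that] R by auto
  have flux_end: "line_flux \<phi> g R = 0" "line_flux \<phi> g (- R) = 0" for \<phi>
    by (simp_all add: line_flux_def gR)
  have unit: "\<bar>\<phi>\<^sub>1 p\<bar> \<le> 1" if "\<And>p. (\<phi>\<^sub>1 p)\<^sup>2 + (\<phi>\<^sub>2 p)\<^sup>2 \<le> 1" for \<phi>\<^sub>1 \<phi>\<^sub>2 :: "real \<times> real \<Rightarrow> real" and p
  proof -
    have "(\<phi>\<^sub>1 p)\<^sup>2 \<le> 1" using that[of p] zero_le_power2[of "\<phi>\<^sub>2 p"] by linarith
    then show ?thesis by (simp add: abs_square_le_1)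
  qed
  show "grushin_perimeter \<alpha> (region 0 R g) \<le> ereal (2 * L + 2 * optimal_profile \<alpha> p 0)"
  proof (rule perimeter_le)
    fix \<phi>\<^sub>1 \<phi>\<^sub>2 assume \<phi>: "\<phi>\<^sub>1 \<in> C1c" "\<phi>\<^sub>2 \<in> C1c" "\<And>p. (\<phi>\<^sub>1 p)\<^sup>2 + (\<phi>\<^sub>2 p)\<^sup>2 \<le> 1"
    show "(LINT p:region 0 R g|lebesgue. partial_x \<phi>\<^sub>1 p + \<bar>fst p\<bar> powr \<alpha> * partial_y \<phi>\<^sub>2 p) \<le> 2 * L + 2 * optimal_profile \<alpha> p 0"
      using right[OF \<phi>] line_flux_bound[of \<phi>\<^sub>1 g 0, OF \<phi>(1) unit[of \<phi>\<^sub>1 \<phi>\<^sub>2, OF \<phi>(3)] g_nonneg] by (simp add: flux_end g0)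
  qed
  show "grushin_perimeter \<alpha> (region (- R) 0 g) \<le> ereal (2 * L + 2 * optimal_profile \<alpha> p 0)"
  proof (rule perimeter_le)
    fix \<phi>\<^sub>1 \<phi>\<^sub>2 assume \<phi>: "\<phi>\<^sub>1 \<in> C1c" "\<phi>\<^sub>2 \<in> C1c" "\<And>p. (\<phi>\<^sub>1 p)\<^sup>2 + (\<phi>\<^sub>2 p)\<^sup>2 \<le> 1"
    show "(LINT p:region (- R) 0 g|lebesgue. partial_x \<phi>\<^sub>1 p + \<bar>fst p\<bar> powr \<alpha> * partial_y \<phi>\<^sub>2 p) \<le> 2 * L + 2 * optimal_profile \<alpha> p 0"
      using left[OF \<phi>] line_flux_bound[of \<phi>\<^sub>1 g 0, OF \<phi>(1) unit[of \<phi>\<^sub>1 \<phi>\<^sub>2, OF \<phi>(3)] g_nonneg] by (simp add: flux_end g0)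
  qed
  show "grushin_perimeter \<alpha> (region (- R) R g) \<le> ereal (4 * L)"
  proof (rule perimeter_le)
    fix \<phi>\<^sub>1 \<phi>\<^sub>2 assume \<phi>: "\<phi>\<^sub>1 \<in> C1c" "\<phi>\<^sub>2 \<in> C1c" "\<And>p. (\<phi>\<^sub>1 p)\<^sup>2 + (\<phi>\<^sub>2 p)\<^sup>2 \<le> 1"
    note div = region_divergence_has_integral[OF g_cont g_nonneg \<alpha> \<phi>(1,2)]
    have "?I \<phi>\<^sub>1 \<phi>\<^sub>2 (- R) R = ?I \<phi>\<^sub>1 \<phi>\<^sub>2 (- R) 0 + ?I \<phi>\<^sub>1 \<phi>\<^sub>2 0 R"
      using has_integral_combine[OF _ _ div[of "- R" 0] div[of 0 R]] R
      by (intro has_integral_unique[OF div[of "- R" R]]) auto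
    then show "?I \<phi>\<^sub>1 \<phi>\<^sub>2 (- R) R \<le> 4 * L"
      using right[OF \<phi>] left[OF \<phi>] by (simp add: flux_end)
  qed
qed

lemma optimal_set_upper_bound:
  fixes \<alpha> p v :: real
  assumes \<alpha>: "\<alpha> \<ge> 0" and p: "p > 0" and v: "v = 2 * bubble_moment \<alpha> / p powr (\<alpha> + 2)"
  defines "E \<equiv> profile_set (optimal_profile \<alpha> p) (3 / (2 * p))"
  shows "E \<in> admissible_x v"
    "double_perimeter_x \<alpha> E \<le> ereal (4 * (bubble_flux \<alpha> + bubble_moment \<alpha>) / p powr (\<alpha> + 1))"
proof -
  let ?R = "3 / (2 * p)" and ?g = "even_extension (optimal_profile \<alpha> p) (3 / (2 * p))"
  have R: "?R > 0" using p by simp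
  have g: "continuous_on UNIV ?g" "\<And>x. 0 \<le> ?g x" "\<And>x. ?g (- x) = ?g x"
    using R \<alpha> p by (auto intro!: even_extension_continuous optimal_profile_continuous
        even_extension_nonneg optimal_profile_nonneg)
  have E: "E = region (- ?R) ?R ?g" by (simp add: E_def profile_set_eq_region)
  have Em: "E \<in> sets lebesgue" unfolding E by (rule region_lebesgue[OF g(1)])
  have ae: "eq_ae E (region (- ?R) ?R ?g)" by (simp add: E eq_ae_def)
  have "integral {0..?R} ?g = integral {0..?R} (optimal_profile \<alpha> p)"
    by (intro integral_cong) simp
  also have "\<dots> = v / 2" using optimal_profile_has_integral[OF \<alpha> p] v by (simp add: integral_unique)
  finally have "2 * integral {0..?R} ?g = v" by simp
  then show "E \<in> admissible_x v"
    using half_region_measures[OF Em ae R g] Em by (simp only: admissible_x_def mem_Collect_eq)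
  let ?L = "slope_integral \<alpha> / p powr (\<alpha> + 1)" and ?f0 = "optimal_profile \<alpha> p 0"
  have "double_perimeter_x \<alpha> E \<le> 1/2 * (ereal (2 * ?L + 2 * ?f0) + ereal (2 * ?L + 2 * ?f0) + ereal (4 * ?L))"
    unfolding double_perimeter_region[OF Em ae R g(1)]
    by (intro half_ereal_mono add_mono optimal_region_perimeters \<alpha> p)
  also have "\<dots> = ereal (4 * ?L + 2 * ?f0)" unfolding half_ereal_sum by simp
  also have "4 * ?L + 2 * ?f0 = (4 * slope_integral \<alpha> + 2 * profile_primitive \<alpha> (1/2)) / p powr (\<alpha> + 1)"
    by (simp add: optimal_profile_def add_divide_distrib)
  finally show "double_perimeter_x \<alpha> E \<le> ereal (4 * (bubble_flux \<alpha> + bubble_moment \<alpha>) / p powr (\<alpha> + 1))"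
    unfolding perimeter_constants[OF \<alpha>] .
qed

section \<open>Continuously differentiable cutoffs on the line\<close>

lemma C1_real_iff:
  fixes f :: "real \<Rightarrow> real"
  shows "f C1_differentiable_on UNIV \<longleftrightarrow>
    (\<forall>x. (f has_real_derivative deriv f x) (at x)) \<and> continuous_on UNIV (deriv f)" (is "_ = ?R")
proof
  assume "f C1_differentiable_on UNIV"
  then obtain D where D: "\<And>x. (f has_real_derivative D x) (at x)" "continuous_on UNIV D"
    unfolding C1_differentiable_on_def has_real_derivative_iff_has_vector_derivative[symmetric] by auto
  moreover have "deriv f = D" using D(1) by (auto intro: DERIV_imp_deriv)
  ultimately show ?R by simp
next
  assume ?R then show "f C1_differentiable_on UNIV"
    unfolding C1_differentiable_on_def has_real_derivative_iff_has_vector_derivative[symmetric] by blast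
qed

lemma C1_realI:
  fixes f :: "real \<Rightarrow> real"
  assumes "\<And>x. (f has_real_derivative D x) (at x)" "continuous_on UNIV D"
  shows "f C1_differentiable_on UNIV"
  unfolding C1_differentiable_on_def has_real_derivative_iff_has_vector_derivative[symmetric]
  using assms by blast

lemma C1_realD:
  fixes f :: "real \<Rightarrow> real"
  assumes "f C1_differentiable_on UNIV"
  shows "(f has_real_derivative deriv f x) (at x)" "continuous_on UNIV (deriv f)" "continuous_on UNIV f"
  using assms[unfolded C1_real_iff] C1_differentiable_imp_continuous_on[OF assms] by auto

lemma C1_real_compose:
  fixes f g :: "real \<Rightarrow> real"
  assumes "f C1_differentiable_on UNIV" "g C1_differentiable_on UNIV"
  shows "(\<lambda>x. f (g x)) C1_differentiable_on UNIV"
proof (rule C1_realI)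
  show "((\<lambda>x. f (g x)) has_real_derivative deriv f (g x) * deriv g x) (at x)" for x
    by (rule DERIV_chain2[OF C1_realD(1)[OF assms(1)] C1_realD(1)[OF assms(2)]])
  show "continuous_on UNIV (\<lambda>x. deriv f (g x) * deriv g x)"
    by (intro continuous_on_mult continuous_on_compose2[OF C1_realD(2)[OF assms(1)] C1_realD(3)[OF assms(2)]]
        C1_realD(2)[OF assms(2)]) auto
qed

lemma C1_real_divide:
  fixes f g :: "real \<Rightarrow> real"
  assumes "f C1_differentiable_on UNIV" "g C1_differentiable_on UNIV" "\<And>x. g x \<noteq> 0"
  shows "(\<lambda>x. f x / g x) C1_differentiable_on UNIV"
proof (rule C1_realI)
  show "((\<lambda>x. f x / g x) has_real_derivative (deriv f x * g x - f x * deriv g x) / (g x * g x)) (at x)" for x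
    by (rule DERIV_divide[OF C1_realD(1)[OF assms(1)] C1_realD(1)[OF assms(2)] assms(3)])
  show "continuous_on UNIV (\<lambda>x. (deriv f x * g x - f x * deriv g x) / (g x * g x))"
    using C1_realD(2,3) assms by (intro continuous_intros) auto
qed

lemma C1_real_sqrt:
  fixes g :: "real \<Rightarrow> real"
  assumes "g C1_differentiable_on UNIV" "\<And>x. 0 < g x"
  shows "(\<lambda>x. sqrt (g x)) C1_differentiable_on UNIV"
proof (rule C1_realI)
  show "((\<lambda>x. sqrt (g x)) has_real_derivative inverse (sqrt (g x)) / 2 * deriv g x) (at x)" for x
    by (rule DERIV_chain2[OF DERIV_real_sqrt[OF assms(2)] C1_realD(1)[OF assms(1)]])
  have "sqrt (g x) \<noteq> 0" for x using assms(2)[of x] by simp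
  then show "continuous_on UNIV (\<lambda>x. inverse (sqrt (g x)) / 2 * deriv g x)"
    using C1_realD(2,3) assms(1) by (intro continuous_intros) auto
qed

lemma C1_real_power2:
  fixes g :: "real \<Rightarrow> real"
  assumes "g C1_differentiable_on UNIV"
  shows "(\<lambda>x. (g x)\<^sup>2) C1_differentiable_on UNIV"
  unfolding power2_eq_square using assms by (intro C1_differentiable_on_mult)

lemmas C1_real_intros = C1_differentiable_on_ident C1_differentiable_on_const C1_differentiable_on_add
  C1_differentiable_on_minus C1_differentiable_on_diff C1_differentiable_on_mult C1_real_power2

lemma C1_mult_abs: "(\<lambda>t::real. t * \<bar>t\<bar>) C1_differentiable_on UNIV"
proof (rule C1_realI[where D = "\<lambda>t. 2 * \<bar>t\<bar>"])
  fix t :: real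
  consider "t > 0" | "t < 0" | "t = 0" by linarith
  then show "((\<lambda>t. t * \<bar>t\<bar>) has_real_derivative 2 * \<bar>t\<bar>) (at t)"
  proof cases
    case 1
    have "((\<lambda>t. t * t) has_real_derivative 2 * t) (at t)" by (auto intro!: derivative_eq_intros)
    then have "((\<lambda>t. t * \<bar>t\<bar>) has_real_derivative 2 * t) (at t)"
      by (rule has_field_derivative_transform_within_open[where S = "{0<..}"]) (use 1 in auto)
    then show ?thesis using 1 by simp
  next
    case 2
    have "((\<lambda>t. - (t * t)) has_real_derivative - (2 * t)) (at t)" by (auto intro!: derivative_eq_intros)
    then have "((\<lambda>t. t * \<bar>t\<bar>) has_real_derivative - (2 * t)) (at t)"
      by (rule has_field_derivative_transform_within_open[where S = "{..<0}"]) (use 2 in auto)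
    then show ?thesis using 2 by simp
  next
    case 3
    have "((\<lambda>h::real. \<bar>h\<bar>) \<longlongrightarrow> \<bar>0\<bar>) (at 0)" by (intro tendsto_intros)
    moreover have "(\<lambda>h::real. ((0 + h) * \<bar>0 + h\<bar> - 0 * \<bar>0\<bar>) / h) = (\<lambda>h. \<bar>h\<bar>)" by auto
    ultimately show ?thesis unfolding 3 by (simp add: DERIV_def)
  qed
qed (auto intro!: continuous_intros)

text \<open>
  A \<open>C\<^sup>1\<close> transition from 0 to 1 on \<open>[0,1]\<close>, built from \<open>t\<^sup>2 + t \<bar>t\<bar>\<close>, which is \<open>2 t\<^sup>2\<close> for positive \<open>t\<close>
  and zero otherwise.
\<close>

definition smooth_step :: "real \<Rightarrow> real" where
  "smooth_step t = (t\<^sup>2 + t * \<bar>t\<bar>) / ((t\<^sup>2 + t * \<bar>t\<bar>) + ((1 - t)\<^sup>2 + (1 - t) * \<bar>1 - t\<bar>))"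

lemma square_plus_mult_abs:
  fixes t :: real
  shows "0 \<le> t\<^sup>2 + t * \<bar>t\<bar>" "t \<le> 0 \<Longrightarrow> t\<^sup>2 + t * \<bar>t\<bar> = 0" "0 < t \<Longrightarrow> 0 < t\<^sup>2 + t * \<bar>t\<bar>"
  by (cases "t \<ge> 0"; simp add: power2_eq_square)+

lemma smooth_step_simps:
  "t \<le> 0 \<Longrightarrow> smooth_step t = 0" "1 \<le> t \<Longrightarrow> smooth_step t = 1"
  "0 \<le> smooth_step t" "smooth_step t \<le> 1"
proof -
  show "t \<le> 0 \<Longrightarrow> smooth_step t = 0" by (simp only: smooth_step_def square_plus_mult_abs(2) div_0)
  show "1 \<le> t \<Longrightarrow> smooth_step t = 1"
    using square_plus_mult_abs(2)[of "1 - t"] square_plus_mult_abs(3)[of t] by (simp add: smooth_step_def)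
  show "0 \<le> smooth_step t" "smooth_step t \<le> 1"
    using square_plus_mult_abs(1)[of t] square_plus_mult_abs(1)[of "1 - t"]
    unfolding smooth_step_def by (auto intro!: divide_nonneg_nonneg simp: divide_le_eq_1)
qed

lemma C1_smooth_step: "smooth_step C1_differentiable_on UNIV"
proof -
  have B: "(\<lambda>t::real. t\<^sup>2 + t * \<bar>t\<bar>) C1_differentiable_on UNIV"
    by (intro C1_differentiable_on_add C1_mult_abs C1_real_intros)
  have B': "(\<lambda>t::real. (1 - t)\<^sup>2 + (1 - t) * \<bar>1 - t\<bar>) C1_differentiable_on UNIV"
    by (rule C1_real_compose[OF B]) (intro C1_real_intros)
  have "(t\<^sup>2 + t * \<bar>t\<bar>) + ((1 - t)\<^sup>2 + (1 - t) * \<bar>1 - t\<bar>) \<noteq> 0" for t :: real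
    using square_plus_mult_abs(1,3)[of t] square_plus_mult_abs(1,3)[of "1 - t"] by (cases "t > 0") force+
  then show ?thesis unfolding smooth_step_def[abs_def]
    by (intro C1_real_divide C1_differentiable_on_add[OF B B'] B)
qed

text \<open>
  For \<open>a < b\<close>, an even \<open>C\<^sup>1\<close> cutoff that is 1 on \<open>[-a,a]\<close> and 0 outside \<open>(-b,b)\<close>.
\<close>

definition plateau :: "real \<Rightarrow> real \<Rightarrow> real \<Rightarrow> real" where
  "plateau a b t = smooth_step ((b - t) / (b - a)) * smooth_step ((b + t) / (b - a))"

lemma plateau_simps:
  assumes "a < b"
  shows "\<bar>t\<bar> \<le> a \<Longrightarrow> plateau a b t = 1" "b \<le> \<bar>t\<bar> \<Longrightarrow> plateau a b t = 0"
    "0 \<le> plateau a b t" "plateau a b t \<le> 1" "plateau a b (- t) = plateau a b t"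
proof -
  show "\<bar>t\<bar> \<le> a \<Longrightarrow> plateau a b t = 1"
    using assms unfolding plateau_def by (subst (1 2) smooth_step_simps(2)) (auto simp: le_divide_eq)
  show "b \<le> \<bar>t\<bar> \<Longrightarrow> plateau a b t = 0"
    using assms by (cases "t \<ge> 0") (auto simp: plateau_def smooth_step_simps(1) divide_le_0_iff)
  show "0 \<le> plateau a b t" "plateau a b t \<le> 1"
    unfolding plateau_def by (auto intro!: mult_nonneg_nonneg mult_le_one smooth_step_simps)
  show "plateau a b (- t) = plateau a b t" by (simp add: plateau_def mult.commute)
qed

lemma C1_plateau: "plateau a b C1_differentiable_on UNIV"
  unfolding plateau_def[abs_def] divide_inverse
  by (intro C1_differentiable_on_mult C1_real_compose[OF C1_smooth_step] C1_real_intros)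

text \<open>
  For \<open>0 \<le> a < b\<close>, a \<open>C\<^sup>1\<close> function that is the identity on \<open>[-a,a]\<close> and has values in \<open>[-b,b]\<close>.
  Composing with it turns a field bounded on an interval into a globally bounded one.
\<close>

definition smooth_clamp :: "real \<Rightarrow> real \<Rightarrow> real \<Rightarrow> real" where
  "smooth_clamp a b t = t * plateau a b t"

lemma smooth_clamp_eq: "a < b \<Longrightarrow> \<bar>t\<bar> \<le> a \<Longrightarrow> smooth_clamp a b t = t"
  by (simp add: smooth_clamp_def plateau_simps)

lemma abs_smooth_clamp_le:
  assumes "0 \<le> a" "a < b" shows "\<bar>smooth_clamp a b t\<bar> \<le> b"
proof (cases "\<bar>t\<bar> \<le> b")
  case True
  then have "\<bar>t\<bar> * plateau a b t \<le> b * 1"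
    using assms by (intro mult_mono plateau_simps) auto
  then show ?thesis using plateau_simps(3)[OF assms(2)] by (simp add: smooth_clamp_def abs_mult)
qed (use assms in \<open>simp add: smooth_clamp_def plateau_simps\<close>)

lemma C1_smooth_clamp: "smooth_clamp a b C1_differentiable_on UNIV"
  unfolding smooth_clamp_def[abs_def] by (intro C1_real_intros C1_plateau)

text \<open>
  All test fields used below are products of functions of one variable.
\<close>

lemma product_C1c:
  fixes f h :: "real \<Rightarrow> real"
  assumes f: "f C1_differentiable_on UNIV" and h: "h C1_differentiable_on UNIV"
    and supp: "\<And>x. M \<le> \<bar>x\<bar> \<Longrightarrow> f x = 0" "\<And>x. M \<le> \<bar>x\<bar> \<Longrightarrow> h x = 0"
  shows "(\<lambda>p. f (fst p) * h (snd p)) \<in> C1c"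
    "partial_x (\<lambda>p. f (fst p) * h (snd p)) = (\<lambda>p. deriv f (fst p) * h (snd p))"
    "partial_y (\<lambda>p. f (fst p) * h (snd p)) = (\<lambda>p. f (fst p) * deriv h (snd p))"
proof -
  let ?F = "\<lambda>p. f (fst p) * h (snd p)"
  show px: "partial_x ?F = (\<lambda>p. deriv f (fst p) * h (snd p))"
    unfolding partial_x_def fst_conv snd_conv
    by (intro ext DERIV_imp_deriv DERIV_cmult_right C1_realD(1)[OF f])
  show py: "partial_y ?F = (\<lambda>p. f (fst p) * deriv h (snd p))"
    unfolding partial_y_def fst_conv snd_conv
    by (intro ext DERIV_imp_deriv DERIV_cmult C1_realD(1)[OF h])
  have diff: "?F differentiable (at p)" for p
  proof -
    have "f differentiable (at (fst p))" "h differentiable (at (snd p))"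
      using C1_realD(1)[OF f] C1_realD(1)[OF h] by (simp_all add: DERIV_deriv_iff_real_differentiable)
    moreover have "fst differentiable (at p)" "snd differentiable (at p)"
      by (intro bounded_linear_imp_differentiable bounded_linear_fst bounded_linear_snd)+
    ultimately have "(\<lambda>p. f (fst p)) differentiable (at p)" "(\<lambda>p. h (snd p)) differentiable (at p)"
      by (auto intro: differentiable_compose)
    then show ?thesis by (rule differentiable_mult)
  qed
  have cont: "continuous_on UNIV (\<lambda>p::real\<times>real. u (fst p) * w (snd p))"
    if "continuous_on UNIV u" "continuous_on UNIV w" for u w :: "real \<Rightarrow> real"
    by (intro continuous_on_mult continuous_on_compose2[OF that(1)] continuous_on_compose2[OF that(2)] continuous_intros) auto
  have "{p. ?F p \<noteq> 0} \<subseteq> {- M..M} \<times> {- M..M}"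
  proof
    fix p assume "p \<in> {p. ?F p \<noteq> 0}"
    then have "\<not> M \<le> \<bar>fst p\<bar>" "\<not> M \<le> \<bar>snd p\<bar>" using supp by auto
    then show "p \<in> {- M..M} \<times> {- M..M}" by (cases p) auto
  qed
  then have "bounded {p. ?F p \<noteq> 0}"
    by (rule bounded_subset[rotated]) (intro bounded_Times bounded_closed_interval)
  then have compact: "compact (closure {p. ?F p \<noteq> 0})" by (simp only: compact_closure)
  show "?F \<in> C1c"
    unfolding C1c_def mem_Collect_eq px py by (intro conjI allI diff cont C1_realD f h compact)
qed

section \<open>Lower bounds for the perimeter by calibration\<close>

text \<open>
  The case \<open>\<alpha> = 0\<close> is separate since then \<open>\<bar>x\<bar> powr \<alpha>\<close> is discontinuous at 0.
\<close>

lemma powr_weight_integrable: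
  fixes c :: "real \<Rightarrow> real"
  assumes "\<alpha> \<ge> 0" "continuous_on {a..b} c"
  shows "(\<lambda>x. \<bar>x\<bar> powr \<alpha> * c x) integrable_on {a..b}"
proof (cases "\<alpha> = 0")
  case True
  show ?thesis
    by (rule integrable_spike_finite[of "{0}" _ _ c])
      (use True assms integrable_continuous_real in auto)
next
  case False
  then have "\<alpha> > 0" using assms by simp
  then show ?thesis using assms
    by (intro integrable_continuous_real continuous_intros continuous_on_powr') auto
qed

text \<open>
  Testing with \<open>\<phi>\<^sub>1 = w(x)\<close>, up to a cutoff in \<open>y\<close>, and \<open>\<phi>\<^sub>2 = s(x) \<tau>\<^sub>n(y)\<close>, where \<open>\<tau>\<^sub>n\<close> is a \<open>C\<^sup>1\<close>
  approximation of the sign of \<open>y\<close>. In the limit the sign jumps across \<open>y = 0\<close>, which gives the term \<open>2 \<bar>x\<bar>\<^sup>\<alpha> s\<close> at those \<open>x\<close>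
  where \<open>g\<close> is positive.
\<close>

lemma perimeter_region_ge:
  fixes w s g :: "real \<Rightarrow> real"
  assumes \<alpha>: "\<alpha> \<ge> 0" and "a \<le> b"
    and g: "continuous_on UNIV g" "\<And>x. 0 \<le> g x"
    and N: "finite N" "\<And>x. x \<in> {a..b} - N \<Longrightarrow> 0 < g x"
    and w: "w C1_differentiable_on UNIV" and s: "s C1_differentiable_on UNIV"
    and supp: "\<And>x. M \<le> \<bar>x\<bar> \<Longrightarrow> w x = 0 \<and> s x = 0"
    and unit: "\<And>x. (w x)\<^sup>2 + (s x)\<^sup>2 \<le> 1"
  shows "ereal (integral {a..b} (\<lambda>x. 2 * g x * deriv w x + 2 * (\<bar>x\<bar> powr \<alpha> * s x))) \<le> grushin_perimeter \<alpha> (region a b g)"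
proof -
  have "compact (g ` {a..b})"
    by (intro compact_continuous_image continuous_on_subset[OF g(1)]) auto
  then obtain B0 where B0: "\<And>x. x \<in> {a..b} \<Longrightarrow> g x \<le> B0"
    by (metis bounded_imp_bdd_above bdd_above_def compact_imp_bounded imageI)
  define B where "B = max B0 (max M 0) + 1"
  have B: "0 < B" "M \<le> B + 1" "\<And>x. x \<in> {a..b} \<Longrightarrow> g x \<le> B" using B0 by (force simp: B_def)+
  let ?\<psi> = "plateau B (B + 1)"
  \<comment> \<open>\<open>B\<close> bounds \<open>g\<close> on \<open>[a,b]\<close>, so that the cutoff is 1 on the region\<close>
  define \<tau> where "\<tau> n y = ?\<psi> y * (y / sqrt (y\<^sup>2 + inverse (real (Suc n))))" for n :: nat and y
  have rad: "0 < y\<^sup>2 + inverse (real (Suc n))" for n and y :: real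
    by (intro add_nonneg_pos) auto
  have \<tau>C1: "\<tau> n C1_differentiable_on UNIV" for n
    unfolding \<tau>_def[abs_def] using rad
    by (intro C1_real_intros C1_plateau C1_real_divide C1_real_sqrt) (auto simp: less_imp_neq[symmetric])
  have sgn_le: "\<bar>y / sqrt (y\<^sup>2 + inverse (real (Suc n)))\<bar> \<le> 1" for n and y :: real
  proof -
    have "\<bar>y\<bar> \<le> sqrt (y\<^sup>2 + inverse (real (Suc n)))" by (rule real_le_rsqrt) simp
    then show ?thesis using rad[of y n] by (simp add: abs_divide divide_le_eq_1)
  qed
  have \<tau>_le: "\<bar>\<tau> n y\<bar> \<le> 1" for n y
    unfolding \<tau>_def abs_mult using plateau_simps(3,4)[of B "B + 1" y]
    by (intro mult_le_one sgn_le) auto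
  have \<tau>_odd: "\<tau> n (- y) = - \<tau> n y" for n y by (simp add: \<tau>_def plateau_simps(5))
  have \<tau>_lim: "(\<lambda>n. \<tau> n y) \<longlonglongrightarrow> (if 0 < y then 1 else 0)" if "0 \<le> y" "y \<le> B" for y
  proof (cases "0 < y")
    case True
    have "(\<lambda>n. y / sqrt (y\<^sup>2 + inverse (real (Suc n)))) \<longlonglongrightarrow> y / sqrt (y\<^sup>2 + 0)"
      using True by (intro tendsto_intros LIMSEQ_inverse_real_of_nat) auto
    then show ?thesis using that True by (simp add: \<tau>_def plateau_simps(1))
  next
    case False then show ?thesis using that by (simp add: \<tau>_def)
  qed
  let ?f = "\<lambda>n x. 2 * g x * deriv w x + 2 * (\<bar>x\<bar> powr \<alpha> * s x) * \<tau> n (g x)"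
  have lower: "((?f n) has_integral integral {a..b} (?f n)) {a..b} \<and> ereal (integral {a..b} (?f n)) \<le> grushin_perimeter \<alpha> (region a b g)" for n
  proof -
    let ?\<phi>\<^sub>1 = "\<lambda>p. w (fst p) * ?\<psi> (snd p)" and ?\<phi>\<^sub>2 = "\<lambda>p. s (fst p) * \<tau> n (snd p)"
    have supp': "B + 1 \<le> \<bar>x\<bar> \<Longrightarrow> w x = 0" "B + 1 \<le> \<bar>x\<bar> \<Longrightarrow> s x = 0"
      "B + 1 \<le> \<bar>x\<bar> \<Longrightarrow> ?\<psi> x = 0" "B + 1 \<le> \<bar>x\<bar> \<Longrightarrow> \<tau> n x = 0" for x
      using supp[of x] B(2) by (auto simp: \<tau>_def plateau_simps(2))
    have \<phi>1: "?\<phi>\<^sub>1 \<in> C1c" "partial_x ?\<phi>\<^sub>1 = (\<lambda>p. deriv w (fst p) * ?\<psi> (snd p))"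
      using supp'(1,3) by (intro product_C1c[where M = "B + 1"] w C1_plateau; simp)+
    have \<phi>2: "?\<phi>\<^sub>2 \<in> C1c"
      using supp'(2,4) by (intro product_C1c[where M = "B + 1"] s \<tau>C1; simp)
    have u: "(?\<phi>\<^sub>1 p)\<^sup>2 + (?\<phi>\<^sub>2 p)\<^sup>2 \<le> 1" for p
    proof -
      have "(?\<psi> (snd p))\<^sup>2 \<le> 1" "(\<tau> n (snd p))\<^sup>2 \<le> 1"
        using \<tau>_le[of n "snd p"] plateau_simps(3,4)[of B "B + 1" "snd p"] by (auto simp: abs_square_le_1)
      then have "(w (fst p))\<^sup>2 * (?\<psi> (snd p))\<^sup>2 \<le> (w (fst p))\<^sup>2 * 1" "(s (fst p))\<^sup>2 * (\<tau> n (snd p))\<^sup>2 \<le> (s (fst p))\<^sup>2 * 1"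
        by (intro mult_left_mono; simp)+
      then show ?thesis using unit[of "fst p"] by (simp add: power_mult_distrib)
    qed
    let ?I = "LINT p:region a b g|lebesgue. partial_x ?\<phi>\<^sub>1 p + \<bar>fst p\<bar> powr \<alpha> * partial_y ?\<phi>\<^sub>2 p"
    have "((\<lambda>x. integral {- g x..g x} (\<lambda>y. partial_x ?\<phi>\<^sub>1 (x, y)) + \<bar>x\<bar> powr \<alpha> * (?\<phi>\<^sub>2 (x, g x) - ?\<phi>\<^sub>2 (x, - g x)))
       has_integral ?I) {a..b}"
      by (rule region_divergence_has_integral[OF g \<alpha> \<phi>1(1) \<phi>2])
    moreover have "integral {- g x..g x} (\<lambda>y. partial_x ?\<phi>\<^sub>1 (x, y)) + \<bar>x\<bar> powr \<alpha> * (?\<phi>\<^sub>2 (x, g x) - ?\<phi>\<^sub>2 (x, - g x)) = ?f n x"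
      if x: "x \<in> {a..b}" for x
    proof -
      have "integral {- g x..g x} (\<lambda>y. partial_x ?\<phi>\<^sub>1 (x, y)) = integral {- g x..g x} (\<lambda>y. deriv w x)"
        unfolding \<phi>1(2) using B(3)[OF x] by (intro integral_cong) (auto simp: plateau_simps(1) abs_le_iff)
      then show ?thesis using g(2)[of x] by (simp add: \<tau>_odd)
    qed
    ultimately have I: "(?f n has_integral ?I) {a..b}" by (rule has_integral_eq[rotated])
    note integral_unique[OF I]
    moreover have "(?f n has_integral integral {a..b} (?f n)) {a..b}"
      using I by (rule integrable_integral[OF has_integral_integrable])
    ultimately show ?thesis using perimeter_ge[OF \<phi>1(1) \<phi>2 u, where E = "region a b g" and \<alpha> = \<alpha>] by simp
  qed
  let ?F = "\<lambda>x. 2 * g x * deriv w x + 2 * (\<bar>x\<bar> powr \<alpha> * s x) * (if 0 < g x then 1 else 0)"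
  let ?h = "\<lambda>x. 2 * g x * \<bar>deriv w x\<bar> + 2 * (\<bar>x\<bar> powr \<alpha> * \<bar>s x\<bar>)"
  have "(\<lambda>n. integral {a..b} (?f n)) \<longlonglongrightarrow> integral {a..b} ?F"
  proof (rule dominated_convergence)
    show "?f n integrable_on {a..b}" for n using lower by blast
    have "continuous_on {a..b} (\<lambda>x. 2 * g x * \<bar>deriv w x\<bar>)" "continuous_on {a..b} (\<lambda>x. \<bar>s x\<bar>)"
      by (intro continuous_intros continuous_on_subset[OF g(1)] continuous_on_subset[OF C1_realD(2)[OF w]]
          continuous_on_subset[OF C1_realD(3)[OF s]]; simp)+
    then show "?h integrable_on {a..b}"
      by (intro integrable_add integrable_on_mult_right powr_weight_integrable[OF \<alpha>] integrable_continuous_real)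
    show "norm (?f n x) \<le> ?h x" if "x \<in> {a..b}" for n x
    proof -
      have "\<bar>x\<bar> powr \<alpha> * \<bar>s x\<bar> * \<bar>\<tau> n (g x)\<bar> \<le> \<bar>x\<bar> powr \<alpha> * \<bar>s x\<bar> * 1"
        by (intro mult_left_mono \<tau>_le) auto
      then have "\<bar>2 * (\<bar>x\<bar> powr \<alpha> * s x) * \<tau> n (g x)\<bar> \<le> 2 * (\<bar>x\<bar> powr \<alpha> * \<bar>s x\<bar>)"
        by (simp add: abs_mult)
      moreover have "\<bar>2 * g x * deriv w x\<bar> = 2 * g x * \<bar>deriv w x\<bar>" using g(2)[of x] by (simp add: abs_mult)
      ultimately show ?thesis unfolding real_norm_def by (intro order_trans[OF abs_triangle_ineq]) simp
    qed
    show "(\<lambda>n. ?f n x) \<longlonglongrightarrow> ?F x" if "x \<in> {a..b}" for x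
      using B(3)[OF that] g(2)[of x] by (intro tendsto_intros \<tau>_lim)
  qed
  moreover have "integral {a..b} ?F = integral {a..b} (\<lambda>x. 2 * g x * deriv w x + 2 * (\<bar>x\<bar> powr \<alpha> * s x))"
    by (rule integral_spike[of N]) (use N in \<open>auto simp: negligible_finite\<close>)
  ultimately have "(\<lambda>n. ereal (integral {a..b} (?f n))) \<longlonglongrightarrow>
      ereal (integral {a..b} (\<lambda>x. 2 * g x * deriv w x + 2 * (\<bar>x\<bar> powr \<alpha> * s x)))"
    by simp
  then show ?thesis
    by (rule LIMSEQ_le_const2) (use lower in auto)
qed

text \<open>
  The integrand of the lower bound obtained from \<open>w = - A\<close> and \<open>s = sqrt (1 - A\<^sup>2)\<close>.
\<close>

definition calibration_density :: "real \<Rightarrow> (real \<Rightarrow> real) \<Rightarrow> (real \<Rightarrow> real) \<Rightarrow> real \<Rightarrow> real" where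
  "calibration_density \<alpha> g A x = - (2 * g x * deriv A x) + 2 * (\<bar>x\<bar> powr \<alpha> * sqrt (1 - (A x)\<^sup>2))"

lemma calibration_density_integrable:
  assumes "\<alpha> \<ge> 0" "continuous_on UNIV g" "A C1_differentiable_on UNIV"
  shows "calibration_density \<alpha> g A integrable_on {a..b}"
proof -
  have "continuous_on {a..b} (\<lambda>x. - (2 * g x * deriv A x))" "continuous_on {a..b} (\<lambda>x. sqrt (1 - (A x)\<^sup>2))"
    by (intro continuous_intros continuous_on_subset[OF assms(2)] continuous_on_subset[OF C1_realD(2)[OF assms(3)]]
        continuous_on_subset[OF C1_realD(3)[OF assms(3)]]; simp)+
  then show ?thesis unfolding calibration_density_def[abs_def]
    by (intro integrable_add integrable_on_mult_right powr_weight_integrable[OF assms(1)] integrable_continuous_real)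
qed

lemma perimeter_ge_calibration:
  assumes \<alpha>: "\<alpha> \<ge> 0" and ab: "- r \<le> a" "a \<le> b" "b \<le> r"
    and g: "continuous_on UNIV g" "\<And>x. 0 \<le> g x"
    and N: "finite N" "\<And>x. x \<in> {a..b} - N \<Longrightarrow> 0 < g x"
    and A: "A C1_differentiable_on UNIV" "\<And>x. \<bar>A x\<bar> < 1"
  shows "ereal (integral {a..b} (calibration_density \<alpha> g A)) \<le> grushin_perimeter \<alpha> (region a b g)"
proof -
  let ?\<psi> = "plateau r (r + 1)"
  have sq: "0 < 1 - (A x)\<^sup>2" for x using A(2)[of x] by (simp add: abs_square_less_1)
  have S: "(\<lambda>x. sqrt (1 - (A x)\<^sup>2)) C1_differentiable_on UNIV"
    by (intro C1_real_sqrt sq C1_real_intros A)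
  let ?w = "\<lambda>x. - A x * ?\<psi> x" and ?s = "\<lambda>x. sqrt (1 - (A x)\<^sup>2) * ?\<psi> x"
  have unit: "(?w x)\<^sup>2 + (?s x)\<^sup>2 \<le> 1" for x
  proof -
    have "(?w x)\<^sup>2 + (?s x)\<^sup>2 = (?\<psi> x)\<^sup>2"
      using sq[of x] by (simp add: power_mult_distrib algebra_simps)
    also have "\<dots> \<le> 1" using plateau_simps(3,4)[of r "r + 1" x] by (simp add: abs_square_le_1)
    finally show ?thesis .
  qed
  have "ereal (integral {a..b} (\<lambda>x. 2 * g x * deriv ?w x + 2 * (\<bar>x\<bar> powr \<alpha> * ?s x))) \<le> grushin_perimeter \<alpha> (region a b g)"
  proof (rule perimeter_region_ge[OF \<alpha> ab(2) g N])
    show "?w C1_differentiable_on UNIV" "?s C1_differentiable_on UNIV"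
      by (intro C1_real_intros A C1_plateau S)+
    show "r + 1 \<le> \<bar>x\<bar> \<Longrightarrow> ?w x = 0 \<and> ?s x = 0" for x by (simp add: plateau_simps(2))
    show "(?w x)\<^sup>2 + (?s x)\<^sup>2 \<le> 1" for x by (rule unit)
  qed
  also have "integral {a..b} (\<lambda>x. 2 * g x * deriv ?w x + 2 * (\<bar>x\<bar> powr \<alpha> * ?s x))
     = integral {a..b} (calibration_density \<alpha> g A)"
  proof (rule integral_spike[of "{- r, r}"])
    fix x assume "x \<in> {a..b} - {- r, r}"
    then have x: "x \<in> {- r<..<r}" using ab by auto
    have "((\<lambda>x. - A x) has_real_derivative - deriv A x) (at x)"
      by (rule DERIV_minus[OF C1_realD(1)[OF A(1)]])
    then have "(?w has_real_derivative - deriv A x) (at x)"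
      by (rule has_field_derivative_transform_within_open[where S = "{- r<..<r}"])
         (use x in \<open>auto simp: plateau_simps(1)\<close>)
    then have "deriv ?w x = - deriv A x" by (rule DERIV_imp_deriv)
    moreover have "?\<psi> x = 1" using x by (intro plateau_simps(1)) auto
    ultimately show "calibration_density \<alpha> g A x = 2 * g x * deriv ?w x + 2 * (\<bar>x\<bar> powr \<alpha> * ?s x)"
      by (simp add: calibration_density_def)
  qed (simp add: negligible_finite)
  finally show ?thesis .
qed

lemma deriv_reflect:
  assumes "A C1_differentiable_on UNIV"
  shows "((\<lambda>x. A (- x)) has_real_derivative - deriv A (- x)) (at x)"
proof -
  have "((\<lambda>x::real. - x) has_real_derivative - 1) (at x)" by (auto intro!: derivative_eq_intros)
  from DERIV_chain2[OF C1_realD(1)[OF assms] this] show ?thesis by simp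
qed

text \<open>
  The halves are tested with \<open>A\<close> (and with its reflection), the whole set with the odd field
  \<open>B(x) - B(-x)\<close>. The fields \<open>A\<close> and \<open>B\<close> are independent of each other, and only \<open>B\<close> has to
  vanish on the axis.
\<close>

lemma double_perimeter_ge_pair:
  assumes \<alpha>: "\<alpha> \<ge> 0" and r: "0 < r"
    and g: "continuous_on UNIV g" "\<And>x. 0 \<le> g x" "\<And>x. g (- x) = g x" "\<And>x. x \<in> {0<..<r} \<Longrightarrow> 0 < g x"
    and A: "A C1_differentiable_on UNIV" "\<And>x. \<bar>A x\<bar> < 1"
    and B: "B C1_differentiable_on UNIV" "\<And>x. \<bar>B x\<bar> < 1" "\<And>x. x \<le> 0 \<Longrightarrow> B x = 0"
    and E: "E \<in> sets lebesgue" "eq_ae E (region (- r) r g)"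
  shows "ereal (integral {0..r} (calibration_density \<alpha> g A) + integral {0..r} (calibration_density \<alpha> g B))
     \<le> double_perimeter_x \<alpha> E"
proof -
  let ?J = "calibration_density \<alpha> g"
  let ?IA = "integral {0..r} (?J A)" and ?IB = "integral {0..r} (?J B)"
  have pos: "0 < g x" if "x \<in> {- r..r} - {- r, 0, r}" for x
    using g(4)[of "\<bar>x\<bar>"] g(3)[of x] that by (cases "x \<ge> 0") auto
  have neg: "(\<lambda>x. h (- x)) C1_differentiable_on UNIV" if "h C1_differentiable_on UNIV" for h :: "real \<Rightarrow> real"
    by (rule C1_real_compose[OF that]) (intro C1_real_intros)
  have right: "ereal ?IA \<le> grushin_perimeter \<alpha> (region 0 r g)"
    by (rule perimeter_ge_calibration[OF \<alpha>, where N = "{- r, 0, r}" and r = r]) (use r g pos A in auto)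
  have left: "ereal ?IA \<le> grushin_perimeter \<alpha> (region (- r) 0 g)"
  proof -
    let ?A = "\<lambda>x. - A (- x)"
    have "ereal (integral {- r..0} (?J ?A)) \<le> grushin_perimeter \<alpha> (region (- r) 0 g)"
      by (rule perimeter_ge_calibration[OF \<alpha>, where N = "{- r, 0, r}" and r = r])
         (use r g pos A in \<open>auto intro!: neg C1_real_intros\<close>)
    moreover have eq: "?J ?A x = ?J A (- x)" for x
    proof -
      have "deriv ?A x = deriv A (- x)"
        using DERIV_minus[OF deriv_reflect[OF A(1), of x]] by (intro DERIV_imp_deriv) simp
      then show ?thesis by (simp add: calibration_density_def g(3))
    qed
    moreover have "integral {- r..0} (\<lambda>x. ?J A (- x)) = ?IA"
      using Henstock_Kurzweil_Integration.integral_reflect_real[of r 0 "?J A"] by simp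
    ultimately show ?thesis unfolding eq by simp
  qed
  have whole: "ereal (2 * ?IB) \<le> grushin_perimeter \<alpha> (region (- r) r g)"
  proof -
    \<comment> \<open>at every point one of the two summands vanishes\<close>
    let ?A = "\<lambda>x. B x - B (- x)"
    have lt1: "\<bar>?A x\<bar> < 1" for x using B(2)[of x] B(2)[of "- x"] B(3)[of x] B(3)[of "- x"] by (cases "x \<le> 0") auto
    have C1: "?A C1_differentiable_on UNIV" by (intro C1_real_intros B neg)
    have "ereal (integral {- r..r} (?J ?A)) \<le> grushin_perimeter \<alpha> (region (- r) r g)"
      by (rule perimeter_ge_calibration[OF \<alpha>, where N = "{- r, 0, r}" and r = r]) (use r g pos C1 lt1 in auto)
    moreover have "integral {- r..r} (?J ?A) = 2 * ?IB"
    proof -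
      have dA: "deriv ?A x = deriv B x + deriv B (- x)" for x
        using DERIV_diff[OF C1_realD(1)[OF B(1), of x] deriv_reflect[OF B(1), of x]] by (intro DERIV_imp_deriv) simp
      have even: "?J ?A (- x) = ?J ?A x" for x
        unfolding calibration_density_def dA by (simp add: g(3) add.commute power2_commute)
      have "integral {0..r} (?J ?A) = ?IB"
      proof (rule integral_spike[of "{0}"])
        fix x assume "x \<in> {0..r} - {0}"
        then have x: "x > 0" by auto
        have "((\<lambda>x. 0) has_real_derivative 0) (at (- x))" by simp
        then have "(B has_real_derivative 0) (at (- x))"
          by (rule has_field_derivative_transform_within_open[where S = "{..<0}"]) (use x B(3) in auto)
        then have "deriv B (- x) = 0" by (rule DERIV_imp_deriv)
        then show "?J B x = ?J ?A x" using x B(3)[of "- x"] by (simp add: calibration_density_def dA)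
      qed simp
      moreover have "integral {- r..0} (?J ?A) = integral {0..r} (?J ?A)"
        using Henstock_Kurzweil_Integration.integral_reflect_real[of r 0 "?J ?A"] even by simp
      moreover have "integral {- r..0} (?J ?A) + integral {0..r} (?J ?A) = integral {- r..r} (?J ?A)"
        using r by (intro Henstock_Kurzweil_Integration.integral_combine calibration_density_integrable \<alpha> g C1) auto
      ultimately show ?thesis by simp
    qed
    ultimately show ?thesis by simp
  qed
  have "ereal (?IA + ?IB) = 1/2 * (ereal ?IA + ereal ?IA + ereal (2 * ?IB))"
    unfolding half_ereal_sum by simp
  also have "\<dots> \<le> double_perimeter_x \<alpha> E"
    unfolding double_perimeter_region[OF E r g(1)]
    by (intro half_ereal_mono add_mono left right whole)
  finally show ?thesis .
qed

text \<open>
  With a cutoff \<open>\<zeta>\<close> that is 0 near the axis and 1 for \<open>x \<ge> \<epsilon>\<close>, the fields are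
  \<open>A = \<theta> W (2 - \<zeta>)\<close> and \<open>B = \<theta> W \<zeta>\<close>. Their sum \<open>2 \<theta> W\<close> does not involve \<open>\<zeta>\<close>, so that the cutoff costs
  only a term of order \<open>\<epsilon>\<close>; this requires \<open>W (2 - \<zeta>) \<le> 1\<close> on the axis, hence \<open>W \<le> 1/2\<close>. The factor
  \<open>\<theta> < 1\<close> makes room for the clamping that bounds the fields on the whole line.
\<close>

lemma double_perimeter_ge_approx:
  assumes \<alpha>: "\<alpha> \<ge> 0" and r: "0 < r"
    and g: "continuous_on UNIV g" "\<And>x. 0 \<le> g x" "\<And>x. g (- x) = g x" "\<And>x. x \<in> {0<..<r} \<Longrightarrow> 0 < g x"
    and E: "E \<in> sets lebesgue" "eq_ae E (region (- r) r g)"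
    and W: "W C1_differentiable_on UNIV" "\<And>x. x \<in> {0..r} \<Longrightarrow> -1 \<le> W x \<and> W x \<le> 1/2"
    and \<theta>: "0 < \<theta>" "\<theta> < 1" and \<epsilon>: "0 < \<epsilon>" "\<epsilon> \<le> r" "\<And>x. x \<in> {0..\<epsilon>} \<Longrightarrow> 0 \<le> W x"
  shows "ereal (- 4 * \<theta> * integral {0..r} (\<lambda>x. g x * deriv W x)
     + 4 * integral {0..r} (\<lambda>x. \<bar>x\<bar> powr \<alpha> * sqrt (1 - (W x)\<^sup>2)) - 4 * r powr \<alpha> * \<epsilon>) \<le> double_perimeter_x \<alpha> E"
proof -
  let ?J = "calibration_density \<alpha> g"
  \<comment> \<open>clamping is the identity up to \<open>\<theta>\<close>, and its absolute value never exceeds \<open>\<mu> < 1\<close>\<close>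
  define \<mu> where "\<mu> = (1 + \<theta>) / 2"
  have \<mu>: "\<theta> < \<mu>" "\<mu> < 1" using \<theta> by (auto simp: \<mu>_def)
  define \<zeta> where "\<zeta> x = smooth_step ((x - \<epsilon>/2) / (\<epsilon>/2))" for x
  have \<zeta>: "x \<le> \<epsilon>/2 \<Longrightarrow> \<zeta> x = 0" "\<epsilon> \<le> x \<Longrightarrow> \<zeta> x = 1" "0 \<le> \<zeta> x" "\<zeta> x \<le> 1" for x
    using \<epsilon>(1) by (auto simp: \<zeta>_def divide_le_0_iff le_divide_eq smooth_step_simps intro!: smooth_step_simps(1,2))
  have \<zeta>C1: "\<zeta> C1_differentiable_on UNIV"
    unfolding \<zeta>_def[abs_def] divide_inverse
    by (rule C1_real_compose[OF C1_smooth_step]) (intro C1_real_intros)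
  define A where "A x = smooth_clamp \<theta> \<mu> (\<theta> * (W x * (2 - \<zeta> x)))" for x
  define B where "B x = smooth_clamp \<theta> \<mu> (\<theta> * (W x * \<zeta> x))" for x
  have AC1: "A C1_differentiable_on UNIV" and BC1: "B C1_differentiable_on UNIV"
    unfolding A_def[abs_def] B_def[abs_def]
    by (rule C1_real_compose[OF C1_smooth_clamp], intro C1_real_intros W \<zeta>C1)+
  have A1: "\<bar>A x\<bar> < 1" and B1: "\<bar>B x\<bar> < 1" for x
    using abs_smooth_clamp_le[of \<theta> \<mu>] \<theta> \<mu> unfolding A_def B_def by (meson le_less_trans less_imp_le)+
  have B0: "B x = 0" if "x \<le> 0" for x
    using \<zeta>(1)[of x] that \<epsilon>(1) by (simp add: B_def smooth_clamp_def)
  have small: "\<bar>W x * (2 - \<zeta> x)\<bar> \<le> 1" "\<bar>W x * \<zeta> x\<bar> \<le> 1" if x: "x \<in> {0..r}" for x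
  proof -
    have w: "\<bar>W x\<bar> \<le> 1" using W(2)[OF x] by auto
    show "\<bar>W x * \<zeta> x\<bar> \<le> 1" unfolding abs_mult using w \<zeta>(3,4)[of x] by (intro mult_le_one) auto
    show "\<bar>W x * (2 - \<zeta> x)\<bar> \<le> 1"
    proof (cases "x \<le> \<epsilon>")
      case True
      then have "0 \<le> W x" "W x \<le> 1/2" using \<epsilon>(3)[of x] W(2)[OF x] x by auto
      then have "W x * (2 - \<zeta> x) \<le> 1/2 * 2" "0 \<le> W x * (2 - \<zeta> x)"
        using \<zeta>(3,4)[of x] by (intro mult_mono mult_nonneg_nonneg; simp)+
      then show ?thesis by simp
    next
      case False then show ?thesis using \<zeta>(2)[of x] w by simp
    qed
  qed
  have Aeq: "A x = \<theta> * (W x * (2 - \<zeta> x))" and Beq: "B x = \<theta> * (W x * \<zeta> x)" if "x \<in> {0..r}" for x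
    unfolding A_def B_def using small[OF that] \<theta> \<mu>
    by (auto intro!: smooth_clamp_eq simp: abs_mult mult_le_cancel_left1)
  have sum: "A x + B x = 2 * \<theta> * W x" if "x \<in> {0..r}" for x
    unfolding Aeq[OF that] Beq[OF that] by (simp add: algebra_simps)
  have dsum: "deriv A x + deriv B x = 2 * \<theta> * deriv W x" if x: "x \<in> {0<..<r}" for x
  proof -
    have "((\<lambda>x. A x + B x) has_real_derivative deriv A x + deriv B x) (at x)"
      by (intro DERIV_add C1_realD AC1 BC1)
    moreover have "((\<lambda>x. A x + B x) has_real_derivative 2 * \<theta> * deriv W x) (at x)"
    proof (rule has_field_derivative_transform_within_open[where S = "{0<..<r}"])
      show "((\<lambda>x. 2 * \<theta> * W x) has_real_derivative 2 * \<theta> * deriv W x) (at x)"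
        by (intro DERIV_cmult C1_realD W)
    qed (use x sum in auto)
    ultimately show ?thesis by (rule DERIV_unique)
  qed
  let ?h = "\<lambda>x. \<bar>x\<bar> powr \<alpha> * sqrt (1 - (W x)\<^sup>2)"
  let ?c = "\<lambda>x. if x \<in> {0..\<epsilon>} then 4 * r powr \<alpha> else 0"
  have gW: "(\<lambda>x. g x * deriv W x) integrable_on {0..r}"
    using C1_realD(2)[OF W(1)] g(1)
    by (intro integrable_continuous_real continuous_intros; blast intro: continuous_on_subset)
  have hi: "?h integrable_on {0..r}"
    using C1_realD(3)[OF W(1)]
    by (intro powr_weight_integrable \<alpha> continuous_intros; blast intro: continuous_on_subset)
  have "((\<lambda>x. 4 * r powr \<alpha>) has_integral 4 * r powr \<alpha> * \<epsilon>) {0..\<epsilon>}"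
    using has_integral_const_real[of "4 * r powr \<alpha>" 0 \<epsilon>] \<epsilon>(1) by (simp add: mult.commute)
  then have ci: "(?c has_integral 4 * r powr \<alpha> * \<epsilon>) {0..r}"
    using \<epsilon>(2) by (subst has_integral_restrict) auto
  have lower: "((\<lambda>x. - 4 * \<theta> * (g x * deriv W x) + 4 * ?h x - ?c x) has_integral
      (- 4 * \<theta> * integral {0..r} (\<lambda>x. g x * deriv W x) + 4 * integral {0..r} ?h - 4 * r powr \<alpha> * \<epsilon>)) {0..r}"
    by (intro has_integral_diff has_integral_add has_integral_mult_right ci integrable_integral gW hi)
  have upper: "((\<lambda>x. ?J A x + ?J B x) has_integral (integral {0..r} (?J A) + integral {0..r} (?J B))) {0..r}"
    by (intro has_integral_add integrable_integral calibration_density_integrable \<alpha> g AC1 BC1)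
  have "- 4 * \<theta> * integral {0..r} (\<lambda>x. g x * deriv W x) + 4 * integral {0..r} ?h - 4 * r powr \<alpha> * \<epsilon>
     \<le> integral {0..r} (?J A) + integral {0..r} (?J B)"
  proof (rule has_integral_le[OF lower[unfolded has_integral_Icc_iff_Ioo] upper[unfolded has_integral_Icc_iff_Ioo]])
    fix x assume x: "x \<in> {0<..<r}"
    then have x': "x \<in> {0..r}" by auto
    have "?J A x + ?J B x = - 2 * g x * (deriv A x + deriv B x)
        + 2 * (\<bar>x\<bar> powr \<alpha> * (sqrt (1 - (A x)\<^sup>2) + sqrt (1 - (B x)\<^sup>2)))"
      by (simp add: calibration_density_def algebra_simps)
    moreover have "- 2 * g x * (deriv A x + deriv B x) = - 4 * \<theta> * (g x * deriv W x)"
      unfolding dsum[OF x] by simp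
    moreover have "4 * ?h x - ?c x \<le> 2 * (\<bar>x\<bar> powr \<alpha> * (sqrt (1 - (A x)\<^sup>2) + sqrt (1 - (B x)\<^sup>2)))"
    proof (cases "x \<le> \<epsilon>")
      case True
      have "sqrt (1 - (W x)\<^sup>2) \<le> 1" by simp
      moreover have "\<bar>x\<bar> powr \<alpha> \<le> r powr \<alpha>" using x \<alpha> by (intro powr_mono2) auto
      ultimately have "?h x \<le> r powr \<alpha> * 1"
        using W(2)[OF x'] by (intro mult_mono) (auto simp: abs_square_le_1)
      moreover have "0 \<le> sqrt (1 - (A x)\<^sup>2) + sqrt (1 - (B x)\<^sup>2)"
        using A1[of x] B1[of x] by (intro add_nonneg_nonneg) (auto simp: abs_square_le_1)
      ultimately show ?thesis using True x by (smt (verit) atLeastAtMost_iff greaterThanLessThan_iff mult_nonneg_nonneg powr_ge_zero)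
    next
      case False
      then have eq: "A x = \<theta> * W x" "B x = \<theta> * W x" using \<zeta>(2)[of x] Aeq[OF x'] Beq[OF x'] by auto
      have "(\<theta> * W x)\<^sup>2 \<le> (W x)\<^sup>2"
        unfolding power_mult_distrib using \<theta> by (intro mult_left_le_one_le) (auto simp: abs_square_le_1)
      then have "sqrt (1 - (W x)\<^sup>2) \<le> sqrt (1 - (\<theta> * W x)\<^sup>2)" by simp
      then have "\<bar>x\<bar> powr \<alpha> * sqrt (1 - (W x)\<^sup>2) \<le> \<bar>x\<bar> powr \<alpha> * sqrt (1 - (\<theta> * W x)\<^sup>2)"
        by (intro mult_left_mono) auto
      then show ?thesis using False by (simp add: eq)
    qed
    ultimately show "- 4 * \<theta> * (g x * deriv W x) + 4 * ?h x - ?c x \<le> ?J A x + ?J B x" by linarith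
  qed
  moreover have "ereal (integral {0..r} (?J A) + integral {0..r} (?J B)) \<le> double_perimeter_x \<alpha> E"
    by (rule double_perimeter_ge_pair[OF \<alpha> r g AC1 A1 BC1 B1 B0 E])
  ultimately show ?thesis by (meson ereal_less_eq(3) order_trans)
qed

text \<open>
  The calibration inequality: the previous estimate in the limit \<open>\<theta> \<rightarrow> 1\<close>, \<open>\<epsilon> \<rightarrow> 0\<close>.
\<close>

lemma double_perimeter_ge:
  assumes \<alpha>: "\<alpha> \<ge> 0" and r: "0 < r"
    and g: "continuous_on UNIV g" "\<And>x. 0 \<le> g x" "\<And>x. g (- x) = g x" "\<And>x. x \<in> {0<..<r} \<Longrightarrow> 0 < g x"
    and E: "E \<in> sets lebesgue" "eq_ae E (region (- r) r g)"
    and W: "W C1_differentiable_on UNIV" "\<And>x. x \<in> {0..r} \<Longrightarrow> -1 \<le> W x \<and> W x \<le> 1/2" "W 0 = 1/2"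
  shows "ereal (- 4 * integral {0..r} (\<lambda>x. g x * deriv W x)
     + 4 * integral {0..r} (\<lambda>x. \<bar>x\<bar> powr \<alpha> * sqrt (1 - (W x)\<^sup>2))) \<le> double_perimeter_x \<alpha> E"
proof -
  have "isCont W 0" using C1_realD(1)[OF W(1)] by (rule DERIV_isCont)
  then have "\<forall>\<^sub>F x in at 0. dist (W x) (W 0) < 1/2" unfolding isCont_def by (rule tendstoD) simp
  then obtain d where d: "d > 0" "\<And>x. x \<noteq> 0 \<Longrightarrow> dist x 0 < d \<Longrightarrow> dist (W x) (W 0) < 1/2"
    unfolding eventually_at by auto
  \<comment> \<open>on \<open>[0,e]\<close> the function \<open>W\<close> is nonnegative, because it is continuous and \<open>W(0) = 1/2\<close>\<close>
  define e where "e = min (d / 2) r"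
  have e: "0 < e" "e \<le> r" using d r by (auto simp: e_def)
  have We: "0 \<le> W x" if "x \<in> {0..e}" for x
    using d(2)[of x] W(3) that d(1) by (cases "x = 0") (auto simp: e_def dist_real_def abs_if split: if_splits)
  let ?a = "\<lambda>n. inverse (real (Suc n))"
  let ?P = "integral {0..r} (\<lambda>x. g x * deriv W x)" and ?Q = "integral {0..r} (\<lambda>x. \<bar>x\<bar> powr \<alpha> * sqrt (1 - (W x)\<^sup>2))"
  let ?X = "\<lambda>n. - 4 * (1 - ?a n / 2) * ?P + 4 * ?Q - 4 * r powr \<alpha> * (e * ?a n)"
  have a: "0 < ?a n" "?a n \<le> 1" for n by (auto simp: inverse_le_1_iff)
  have bound: "ereal (?X n) \<le> double_perimeter_x \<alpha> E" for n
  proof (rule double_perimeter_ge_approx[OF \<alpha> r g E W(1,2)])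
    show "0 < 1 - ?a n / 2" "1 - ?a n / 2 < 1" using a[of n] by linarith+
    show "0 < e * ?a n" using a[of n] e by simp
    have le: "e * ?a n \<le> e * 1" using a[of n] e by (intro mult_left_mono) auto
    then show "e * ?a n \<le> r" using e by linarith
    show "0 \<le> W x" if "x \<in> {0..e * ?a n}" for x using that le by (intro We) auto
  qed
  have "?X \<longlonglongrightarrow> - 4 * (1 - 0 / 2) * ?P + 4 * ?Q - 4 * r powr \<alpha> * (e * 0)"
    by (intro tendsto_intros LIMSEQ_inverse_real_of_nat) auto
  then have lim: "(\<lambda>n. ereal (?X n)) \<longlonglongrightarrow> ereal (- 4 * ?P + 4 * ?Q)" by simp
  show ?thesis by (rule LIMSEQ_le_const2[OF lim]) (intro exI allI impI bound)
qed

section \<open>Auxiliary inequalities and positivity of the profile\<close>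

text \<open>
  The function \<open>b z + z\<^sup>-\<^sup>b\<close> has its strict minimum at \<open>z = 1\<close>.
\<close>

lemma scale_rigidity:
  fixes b z :: real
  assumes "0 < b" "0 < z" "b * z + z powr (- b) \<le> b + 1"
  shows "z = 1"
proof -
  have "1 + - b * ln z \<le> z powr (- b)"
    using exp_ge_add_one_self[of "- b * ln z"] assms(2) by (simp add: powr_def)
  then have "b * (z - 1) \<le> b * ln z" using assms(3) by (simp add: algebra_simps)
  then have "z - 1 \<le> ln z" using assms(1) by simp
  then show ?thesis using ln_le_minus_one[OF assms(2)] ln_eq_minus_one[OF assms(2)] by linarith
qed

text \<open>
  The concave function \<open>sqrt (1 - b\<^sup>2)\<close> lies above its tangent at \<open>a\<close> up to a quadratic error. The
  constant degenerates as \<open>\<bar>a\<bar>\<close> tends to 1, and the power of \<open>A\<close> in it is tracked because the calibration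
  \<open>u\<close> reaches \<open>-1\<close> at the right end.
\<close>

lemma sqrt_tangent_bound:
  fixes a b :: real
  assumes a: "\<bar>a\<bar> < 1" and b: "\<bar>b\<bar> \<le> 1"
  defines "A \<equiv> sqrt (1 - a\<^sup>2)"
  shows "A - a * (b - a) / A - 3 * (b - a)\<^sup>2 / A ^ 3 \<le> sqrt (1 - b\<^sup>2)"
proof -
  define B where "B = sqrt (1 - b\<^sup>2)"
  define D where "D = b - a"
  have A: "0 < A" "A \<le> 1" using a by (auto simp: A_def abs_square_less_1)
  have B: "0 \<le> B" using b by (auto simp: B_def abs_square_le_1)
  have sq: "A\<^sup>2 = 1 - a\<^sup>2" "B\<^sup>2 = 1 - b\<^sup>2" using a b by (auto simp: A_def B_def abs_square_le_1)
  define S where "S = A + B"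
  have S: "0 < S" "A \<le> S" using A B by (auto simp: S_def)
  have "(B - A) * S = - D * (a + b)"
    using sq unfolding S_def D_def by (simp add: power2_eq_square algebra_simps)
  then have BA: "B - A = - D * (a + b) / S" using S nonzero_eq_divide_eq[of S "B - A" "- D * (a + b)"] by simp
  have "B - A + a * D / A = D * (a * S - (a + b) * A) / (S * A)"
    unfolding BA using S A by (simp add: field_simps)
  also have "a * S - (a + b) * A = a * (B - A) - D * A"
    by (simp add: S_def D_def algebra_simps)
  also have "\<dots> = - D * (A + a * (a + b) / S)"
    unfolding BA by (simp add: algebra_simps)
  finally have eq: "B - A + a * D / A = - (D\<^sup>2 * ((A + a * (a + b) / S) / (S * A)))"
    by (simp add: power2_eq_square)
  have "a * (a + b) \<le> \<bar>a\<bar> * \<bar>a + b\<bar>" by (metis abs_ge_self abs_mult)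
  also have "\<dots> \<le> 1 * 2" using a b by (intro mult_mono) auto
  finally have ab: "a * (a + b) \<le> 2" by simp
  have "a * (a + b) / S \<le> 2 / A"
    using ab S A by (intro order_trans[OF divide_right_mono[OF ab] divide_left_mono]) auto
  moreover have "A \<le> 1 / A" using A by (simp add: le_divide_eq mult_le_one)
  ultimately have num: "A + a * (a + b) / S \<le> 3 / A" by simp
  have "(A + a * (a + b) / S) / (S * A) \<le> (3 / A) / (S * A)"
    using num S A by (intro divide_right_mono) auto
  also have "\<dots> \<le> (3 / A) / (A * A)"
    using S A by (intro divide_left_mono mult_right_mono mult_pos_pos divide_nonneg_pos) auto
  also have "\<dots> = 3 / A ^ 3" by (simp add: power3_eq_cube)
  finally have "D\<^sup>2 * ((A + a * (a + b) / S) / (S * A)) \<le> D\<^sup>2 * (3 / A ^ 3)"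
    by (rule mult_left_mono) simp
  then show ?thesis using eq unfolding B_def[symmetric] D_def[symmetric] by simp
qed

text \<open>
  Convexity of the transformed set excludes profiles that vanish on a subinterval. For those, the
  perimeter would not see the part of \<open>[0,r]\<close> on which the profile vanishes.
\<close>

lemma transformed_convex_interior_pos:
  assumes conv: "x_transformed_convex \<alpha> (profile_set f r)" and \<alpha>: "\<alpha> \<ge> 0"
    and f: "\<And>x. x \<in> {0..r} \<Longrightarrow> 0 \<le> f x"
    and x0: "x0 \<in> {0<..r}" "0 < f x0" and x: "x \<in> {0<..<r}"
  shows "0 < f x"
proof (cases "x = x0")
  case False
  define X where "X x = x powr (\<alpha> + 1) / (\<alpha> + 1)" for x :: real
  have X_less: "X a < X b" if "0 < a" "a < b" for a b
    unfolding X_def using that \<alpha> by (intro divide_strict_right_mono powr_less_mono2) auto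
  have X_inj: "a = b" if "0 < a" "0 < b" "X a = X b" for a b
    using that X_less[of a b] X_less[of b a] by (cases a b rule: linorder_cases) auto
  have mem: "(X a, y) \<in> Psi \<alpha> ` pos_x (profile_set f r)" if "a \<in> {0<..r}" "\<bar>y\<bar> \<le> f a" for a y
    by (rule image_eqI[of _ _ "(a, y)"]) (use that in \<open>auto simp: Psi_def X_def pos_x_def profile_set_def\<close>)
  \<comment> \<open>\<open>x\<close> lies between \<open>z\<close> and \<open>x0\<close>, so that the segment from the image of \<open>(z, 0)\<close> to that of \<open>(x0, f x0)\<close> passes above \<open>x\<close>\<close>
  define z where "z = (if x < x0 then x / 2 else r)"
  have z: "z \<in> {0<..r}" using x x0 by (auto simp: z_def)
  define t where "t = (X x - X z) / (X x0 - X z)"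
  have t: "0 < t" "t < 1"
  proof -
    have "X z < X x \<and> X x < X x0 \<or> X x0 < X x \<and> X x < X z"
      using False x x0 by (auto simp: z_def intro!: X_less)
    then show "0 < t" "t < 1" by (auto simp: t_def divide_less_eq_1 zero_less_divide_iff)
  qed
  have ne: "X x0 - X z \<noteq> 0" using t by (auto simp: t_def)
  have "(1 - t) *\<^sub>R (X z, 0) + t *\<^sub>R (X x0, f x0) \<in> Psi \<alpha> ` pos_x (profile_set f r)"
    using conv t z x0 f[of z] unfolding x_transformed_convex_def
    by (intro convexD mem) auto
  also have "(1 - t) *\<^sub>R (X z, 0) + t *\<^sub>R (X x0, f x0) = (X x, t * f x0)"
  proof -
    have "(1 - t) * X z + t * X x0 = X z + t * (X x0 - X z)" by (simp add: algebra_simps)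
    also have "\<dots> = X x" using ne by (simp add: t_def)
    finally show ?thesis by simp
  qed
  finally obtain a y where ay: "(a, y) \<in> pos_x (profile_set f r)" "Psi \<alpha> (a, y) = (X x, t * f x0)"
    by (metis imageE surj_pair)
  then have a: "0 < a" "a \<le> r" "\<bar>y\<bar> \<le> f a" by (auto simp: pos_x_def profile_set_def)
  then have "X a = X x" "y = t * f x0" using ay(2) by (auto simp: Psi_def X_def)
  then have "a = x" using X_inj[of a x] a x by simp
  have "0 < t * f x0" using t x0 by simp
  then show ?thesis using a(3) \<open>y = t * f x0\<close> \<open>a = x\<close> by simp
qed (use x0 in simp)

lemma antiderivative_on_line:
  fixes d :: "real \<Rightarrow> real"
  assumes "continuous_on UNIV d"
  obtains \<eta> where "\<And>x. (\<eta> has_real_derivative d x) (at x)" "\<eta> 0 = 0"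
proof -
  have "\<exists>F. \<forall>x. -\<infinity> < ereal x \<longrightarrow> ereal x < \<infinity> \<longrightarrow> (F has_vector_derivative d x) (at x)"
    by (rule einterval_antiderivative)
       (use assms in \<open>auto simp: continuous_on_eq_continuous_at\<close>)
  then obtain F where F: "\<And>x. (F has_real_derivative d x) (at x)"
    by (auto simp: has_real_derivative_iff_has_vector_derivative)
  show thesis
    by (rule that[of "\<lambda>x. F x - F 0"]) (auto intro!: derivative_eq_intros F)
qed

section \<open>Calibrating a regular minimizer\<close>

text \<open>
  The properties of a regular minimizer that are used below, in terms of the even extension of its
  profile.
\<close>

lemma regular_minimizer_facts:
  assumes \<alpha>: "\<alpha> \<ge> 0" and v: "v > 0" and min: "x_regular_minimizer_with_profile \<alpha> v E f r"
  defines "g \<equiv> even_extension f r"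
  shows "0 < r" "E \<in> sets lebesgue" "eq_ae E (region (- r) r g)"
    "continuous_on UNIV g" "\<And>x. 0 \<le> g x" "\<And>x. g (- x) = g x" "\<And>x. x \<in> {0..r} \<Longrightarrow> g x = f x"
    "integral {0..r} g = v / 2" "\<And>x. x \<in> {0<..<r} \<Longrightarrow> 0 < g x"
    "\<And>E'. E' \<in> admissible_x v \<Longrightarrow> double_perimeter_x \<alpha> E \<le> double_perimeter_x \<alpha> E'"
proof -
  note m = min[unfolded x_regular_minimizer_with_profile_def is_minimizer_x_def]
  show r: "0 < r" and E: "E \<in> sets lebesgue" and "\<And>E'. E' \<in> admissible_x v \<Longrightarrow> double_perimeter_x \<alpha> E \<le> double_perimeter_x \<alpha> E'"
    using m by (auto simp: admissible_x_def)
  have f: "continuous_on {0..r} f" "\<And>x. x \<in> {0..r} \<Longrightarrow> 0 \<le> f x" using m by auto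
  show ae: "eq_ae E (region (- r) r g)"
    using m by (simp add: g_def profile_set_eq_region)
  show g: "continuous_on UNIV g" "\<And>x. 0 \<le> g x" "\<And>x. g (- x) = g x"
    unfolding g_def using f r by (auto intro!: even_extension_continuous even_extension_nonneg)
  show gf: "\<And>x. x \<in> {0..r} \<Longrightarrow> g x = f x" by (simp add: g_def)
  have "ennreal v = ennreal (2 * integral {0..r} g)"
    using half_region_measures(1)[OF E ae r g] m by (auto simp: admissible_x_def)
  moreover have "0 \<le> integral {0..r} g"
    by (intro integral_nonneg integrable_continuous_real continuous_on_subset[OF g(1)] g(2)) auto
  ultimately show I: "integral {0..r} g = v / 2" using v by simp
  have "\<exists>x \<in> {0<..<r}. g x \<noteq> 0"
  proof (rule ccontr)
    assume "\<not> ?thesis"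
    then have "integral {0..r} g = integral {0..r} (\<lambda>x. 0)"
      by (intro integral_spike[of "{0, r}"]) (auto simp: negligible_finite)
    then show False using I v by simp
  qed
  then obtain x0 where x0: "x0 \<in> {0<..<r}" "g x0 \<noteq> 0" by blast
  then have "0 < f x0" using gf[of x0] g(2)[of x0] by simp
  then show "0 < g x" if "x \<in> {0<..<r}" for x
    using transformed_convex_interior_pos[of \<alpha> f r x0 x] m \<alpha> x0 that gf[of x] by simp
qed

text \<open>
  The slope \<open>q\<close> is matched to the radius, so that \<open>W(r) = -1\<close>; this is the natural boundary condition
  at the right end.
\<close>

lemma linear_calibration:
  fixes q :: real
  assumes \<alpha>: "\<alpha> \<ge> 0" and q: "q > 0" and r: "r = 3 / (2 * q)"
    and g: "continuous_on UNIV g" "\<And>x. 0 \<le> g x" "\<And>x. g (- x) = g x" "\<And>x. x \<in> {0<..<r} \<Longrightarrow> 0 < g x"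
    and E: "E \<in> sets lebesgue" "eq_ae E (region (- r) r g)"
  shows "ereal (4 * q * integral {0..r} g + 4 * (bubble_flux \<alpha> / q powr (\<alpha> + 1))) \<le> double_perimeter_x \<alpha> E"
proof -
  let ?W = "\<lambda>x. 1/2 - q * x"
  have dW: "deriv ?W x = - q" for x
    by (rule DERIV_imp_deriv) (auto intro!: derivative_eq_intros)
  have "ereal (- 4 * integral {0..r} (\<lambda>x. g x * deriv ?W x)
     + 4 * integral {0..r} (\<lambda>x. \<bar>x\<bar> powr \<alpha> * sqrt (1 - (?W x)\<^sup>2))) \<le> double_perimeter_x \<alpha> E"
  proof (rule double_perimeter_ge[OF \<alpha> _ g E])
    show "?W C1_differentiable_on UNIV" by (intro C1_real_intros)
    show "- 1 \<le> ?W x \<and> ?W x \<le> 1/2" if "x \<in> {0..r}" for x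
      using affine_range[OF q, of x] that r by auto
  qed (use q r in auto)
  also have "integral {0..r} (\<lambda>x. g x * deriv ?W x) = - q * integral {0..r} g"
    unfolding dW by (simp add: mult.commute)
  also have "integral {0..r} (\<lambda>x. \<bar>x\<bar> powr \<alpha> * sqrt (1 - (?W x)\<^sup>2))
     = integral {0..r} (\<lambda>x. x powr \<alpha> * sqrt (1 - (?W x)\<^sup>2))"
    by (intro integral_cong) auto
  also have "\<dots> = bubble_flux \<alpha> / q powr (\<alpha> + 1)"
    unfolding r by (rule integral_unique[OF flux_scaled_has_integral[OF \<alpha> q]])
  finally show ?thesis by (simp add: mult.assoc)
qed

text \<open>
  The term \<open>\<integral> x\<^sup>\<alpha> sqrt (1 - W\<^sup>2)\<close> of the lower bound for the perturbed calibration \<open>W = u + e \<eta>\<close>, to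
  first order in \<open>e\<close>.
  The first-order term is \<open>- e u \<eta> x\<^sup>\<alpha> / sqrt (1 - u\<^sup>2) = - e F' \<eta>\<close> with \<open>F\<close> the optimal profile, and integration by
  parts moves the derivative to \<open>\<eta>\<close>. The quadratic error stays bounded up to the right end, where
  \<open>\<eta>\<close> vanishes at least to first order and \<open>1 - u\<^sup>2\<close> exactly to first order.
\<close>

lemma perimeter_tangent_bound:
  fixes \<eta> d :: "real \<Rightarrow> real"
  assumes \<alpha>: "\<alpha> \<ge> 0" and p: "p > 0" and R: "R = 3 / (2 * p)"
    and \<eta>: "\<And>x. (\<eta> has_real_derivative d x) (at x)" "continuous_on UNIV d" "\<eta> 0 = 0" "\<eta> R = 0"
    and M: "M > 0" "\<And>x. x \<in> {0..R} \<Longrightarrow> \<bar>\<eta> x\<bar> \<le> M * x \<and> \<bar>\<eta> x\<bar> \<le> M * (R - x)"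
    and e: "0 < e" "e \<le> p / M"
  shows "bubble_flux \<alpha> / p powr (\<alpha> + 1) + e * integral {0..R} (\<lambda>x. optimal_profile \<alpha> p x * d x)
      - e\<^sup>2 * (12 * M\<^sup>2 / p\<^sup>2 * R powr \<alpha> * R)
    \<le> integral {0..R} (\<lambda>x. \<bar>x\<bar> powr \<alpha> * sqrt (1 - (1/2 - p * x + e * \<eta> x)\<^sup>2))"
    and "\<And>x. x \<in> {0..R} \<Longrightarrow> -1 \<le> 1/2 - p * x + e * \<eta> x \<and> 1/2 - p * x + e * \<eta> x \<le> 1/2"
proof -
  let ?u = "\<lambda>x. 1/2 - p * x" and ?F = "optimal_profile \<alpha> p"
  let ?W = "\<lambda>x. ?u x + e * \<eta> x"
  let ?F' = "\<lambda>x. ?u x * x powr \<alpha> / sqrt (1 - (?u x)\<^sup>2)"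
  have R0: "R > 0" using p R by simp
  have pR: "p * R = 3/2" using p R by simp
  have eM: "e * M \<le> p" using e M by (simp add: pos_le_divide_eq)
  show range: "-1 \<le> ?W x \<and> ?W x \<le> 1/2" if x: "x \<in> {0..R}" for x
  proof -
    have "e * \<bar>\<eta> x\<bar> \<le> e * (M * x)" "e * \<bar>\<eta> x\<bar> \<le> e * (M * (R - x))"
      using M(2)[OF x] e by (auto intro: mult_left_mono)
    moreover have "e * (M * x) \<le> p * x" "e * (M * (R - x)) \<le> p * (R - x)"
      using eM x by (auto simp: mult.assoc[symmetric] intro!: mult_right_mono)
    moreover have "\<bar>e * \<eta> x\<bar> = e * \<bar>\<eta> x\<bar>" using e by (simp add: abs_mult)
    moreover have "p * (R - x) = 3/2 - p * x" using pR by (simp add: right_diff_distrib)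
    ultimately show ?thesis by linarith
  qed
  have \<eta>_cont: "continuous_on S \<eta>" for S
    using \<eta>(1) by (meson DERIV_continuous_on has_field_derivative_at_within)
  have F_cont: "continuous_on {0..R} ?F" unfolding R by (rule optimal_profile_continuous[OF \<alpha> p])
  have product: "((\<lambda>x. ?F' x * \<eta> x + d x * ?F x) has_integral (?F R * \<eta> R - ?F 0 * \<eta> 0)) {0..R}"
  proof (rule fundamental_theorem_of_calculus_interior)
    fix x assume "x \<in> {0<..<R}"
    then have "(?F has_real_derivative ?F' x) (at x)"
      unfolding R by (rule optimal_profile_derivative[OF \<alpha> p])
    from DERIV_mult[OF this \<eta>(1)[of x]]
    show "((\<lambda>x. ?F x * \<eta> x) has_vector_derivative ?F' x * \<eta> x + d x * ?F x) (at x)"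
      by (simp add: has_real_derivative_iff_has_vector_derivative)
  qed (use R0 F_cont \<eta>_cont in \<open>auto intro!: continuous_intros\<close>)
  have "((\<lambda>x. d x * ?F x) has_integral integral {0..R} (\<lambda>x. ?F x * d x)) {0..R}"
    unfolding mult.commute[of "d _"]
    by (intro integrable_integral integrable_continuous_real continuous_intros F_cont continuous_on_subset[OF \<eta>(2)]) simp
  from has_integral_diff[OF product this]
  have parts: "((\<lambda>x. ?F' x * \<eta> x) has_integral - integral {0..R} (\<lambda>x. ?F x * d x)) {0..R}"
    using \<eta>(3,4) by simp
  define c where "c = 12 * M\<^sup>2 / p\<^sup>2 * R powr \<alpha>"
  have flux: "((\<lambda>x. x powr \<alpha> * sqrt (1 - (?u x)\<^sup>2)) has_integral bubble_flux \<alpha> / p powr (\<alpha> + 1)) {0..R}"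
    unfolding R by (rule flux_scaled_has_integral[OF \<alpha> p])
  have const: "((\<lambda>x. e\<^sup>2 * c) has_integral e\<^sup>2 * (c * R)) {0..R}"
    using has_integral_const_real[of "e\<^sup>2 * c" 0 R] R0 by (simp add: mult_ac)
  have lower: "((\<lambda>x. x powr \<alpha> * sqrt (1 - (?u x)\<^sup>2) - e * (?F' x * \<eta> x) - e\<^sup>2 * c) has_integral
     (bubble_flux \<alpha> / p powr (\<alpha> + 1) - e * (- integral {0..R} (\<lambda>x. ?F x * d x)) - e\<^sup>2 * (c * R))) {0..R}"
    by (intro has_integral_diff has_integral_mult_right flux parts const)
  have upper: "((\<lambda>x. \<bar>x\<bar> powr \<alpha> * sqrt (1 - (?W x)\<^sup>2)) has_integral
      integral {0..R} (\<lambda>x. \<bar>x\<bar> powr \<alpha> * sqrt (1 - (?W x)\<^sup>2))) {0..R}"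
    by (intro integrable_integral powr_weight_integrable \<alpha> continuous_intros \<eta>_cont)
  have "bubble_flux \<alpha> / p powr (\<alpha> + 1) - e * (- integral {0..R} (\<lambda>x. ?F x * d x)) - e\<^sup>2 * (c * R)
     \<le> integral {0..R} (\<lambda>x. \<bar>x\<bar> powr \<alpha> * sqrt (1 - (?W x)\<^sup>2))"
  proof (rule has_integral_le[OF lower[unfolded has_integral_Icc_iff_Ioo] upper[unfolded has_integral_Icc_iff_Ioo]])
    fix x assume x: "x \<in> {0<..<R}"
    then have x': "x \<in> {0..R}" by auto
    have u: "?u x \<in> {-1<..<1/2}" using x unfolding R by (rule affine_range_interior[OF p])
    define A where "A = sqrt (1 - (?u x)\<^sup>2)"
    have sq: "0 < 1 - (?u x)\<^sup>2" using u by (intro one_minus_square_pos) auto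
    then have A: "0 < A" "A\<^sup>2 = 1 - (?u x)\<^sup>2" "A \<le> 1" by (auto simp: A_def)
    have tangent: "A - ?u x * (e * \<eta> x) / A - 3 * (e * \<eta> x)\<^sup>2 / A ^ 3 \<le> sqrt (1 - (?W x)\<^sup>2)"
      using sqrt_tangent_bound[of "?u x" "?W x"] u range[OF x'] by (simp add: A_def abs_if)
    have Rx: "0 < R - x" using x by simp
    \<comment> \<open>\<open>1 - u\<^sup>2 = (1 - u) (1 + u)\<close> with \<open>1 + u = p (R - x)\<close> and \<open>1 - u \<ge> 1/2\<close>\<close>
    have "p * (R - x) / 2 \<le> A\<^sup>2"
    proof -
      have "A\<^sup>2 = (1 - ?u x) * (p * (R - x))"
        unfolding A(2) right_diff_distrib pR by (simp add: power2_eq_square algebra_simps)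
      moreover have "1/2 * (p * (R - x)) \<le> (1 - ?u x) * (p * (R - x))"
        using u Rx p by (intro mult_right_mono) auto
      ultimately show ?thesis by simp
    qed
    then have "(p * (R - x) / 2)\<^sup>2 \<le> (A\<^sup>2)\<^sup>2" using Rx p by (intro power_mono) auto
    also have "(A\<^sup>2)\<^sup>2 = A * A ^ 3" by (simp add: power2_eq_square power3_eq_cube)
    also have "\<dots> \<le> 1 * A ^ 3" using A by (intro mult_right_mono) auto
    finally have A3: "(p * (R - x) / 2)\<^sup>2 \<le> A ^ 3" by simp
    have "\<bar>\<eta> x\<bar>\<^sup>2 \<le> (M * (R - x))\<^sup>2" using M(2)[OF x'] by (intro power_mono) auto
    then have "3 * (e * \<eta> x)\<^sup>2 \<le> 3 * (e\<^sup>2 * (M * (R - x))\<^sup>2)"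
      by (simp add: power_mult_distrib mult_left_mono)
    then have "3 * (e * \<eta> x)\<^sup>2 / A ^ 3 \<le> 3 * (e\<^sup>2 * (M * (R - x))\<^sup>2) / (p * (R - x) / 2)\<^sup>2"
      using A3 Rx p by (intro frac_le) auto
    also have "\<dots> = e\<^sup>2 * (12 * M\<^sup>2 / p\<^sup>2)"
      using Rx by (simp add: power_mult_distrib power_divide)
    finally have err: "3 * (e * \<eta> x)\<^sup>2 / A ^ 3 \<le> e\<^sup>2 * (12 * M\<^sup>2 / p\<^sup>2)" .
    then have "A - ?u x * (e * \<eta> x) / A - e\<^sup>2 * (12 * M\<^sup>2 / p\<^sup>2) \<le> sqrt (1 - (?W x)\<^sup>2)"
      using tangent by linarith
    then have "x powr \<alpha> * (A - ?u x * (e * \<eta> x) / A - e\<^sup>2 * (12 * M\<^sup>2 / p\<^sup>2)) \<le> x powr \<alpha> * sqrt (1 - (?W x)\<^sup>2)"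
      by (rule mult_left_mono) simp
    moreover have "x powr \<alpha> * (A - ?u x * (e * \<eta> x) / A - e\<^sup>2 * (12 * M\<^sup>2 / p\<^sup>2))
       = x powr \<alpha> * A - e * (?u x * x powr \<alpha> / A * \<eta> x) - x powr \<alpha> * (e\<^sup>2 * (12 * M\<^sup>2 / p\<^sup>2))"
      by (simp add: right_diff_distrib mult_ac)
    moreover have "x powr \<alpha> * (e\<^sup>2 * (12 * M\<^sup>2 / p\<^sup>2)) \<le> e\<^sup>2 * c"
    proof -
      have "x powr \<alpha> \<le> R powr \<alpha>" using x \<alpha> by (intro powr_mono2) auto
      then have "x powr \<alpha> * (e\<^sup>2 * (12 * M\<^sup>2 / p\<^sup>2)) \<le> R powr \<alpha> * (e\<^sup>2 * (12 * M\<^sup>2 / p\<^sup>2))"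
        by (rule mult_right_mono) simp
      then show ?thesis by (simp add: c_def mult_ac)
    qed
    moreover have "\<bar>x\<bar> = x" using x by simp
    ultimately show "x powr \<alpha> * sqrt (1 - (?u x)\<^sup>2) - e * (?F' x * \<eta> x) - e\<^sup>2 * c \<le> \<bar>x\<bar> powr \<alpha> * sqrt (1 - (?W x)\<^sup>2)"
      unfolding A_def[symmetric] by linarith
  qed
  then show "bubble_flux \<alpha> / p powr (\<alpha> + 1) + e * integral {0..R} (\<lambda>x. ?F x * d x)
      - e\<^sup>2 * (12 * M\<^sup>2 / p\<^sup>2 * R powr \<alpha> * R)
    \<le> integral {0..R} (\<lambda>x. \<bar>x\<bar> powr \<alpha> * sqrt (1 - (?W x)\<^sup>2))"
    by (simp add: c_def)
qed

section \<open>Radius and profile of a regular minimizer\<close>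

text \<open>
  The minimal value is obtained together with the radius: the upper and the lower bound coincide
  once \<open>q = p\<close>.
\<close>

lemma regular_minimizer_radius:
  assumes \<alpha>: "\<alpha> \<ge> 0" and p: "p > 0" and v: "v = 2 * bubble_moment \<alpha> / p powr (\<alpha> + 2)"
    and min: "x_regular_minimizer_with_profile \<alpha> v E f r"
  shows "r = 3 / (2 * p)"
    "double_perimeter_x \<alpha> E = ereal (4 * (bubble_flux \<alpha> + bubble_moment \<alpha>) / p powr (\<alpha> + 1))"
proof -
  let ?C = "bubble_flux \<alpha>" and ?K = "bubble_moment \<alpha>"
  have v0: "v > 0" using v bubble_moment_pos[OF \<alpha>] p by simp
  note m = regular_minimizer_facts[OF \<alpha> v0 min]
  \<comment> \<open>the slope for which the linear calibration reaches \<open>-1\<close> at \<open>r\<close>\<close>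
  define q where "q = 3 / (2 * r)"
  have q: "q > 0" "r = 3 / (2 * q)" using m(1) by (simp_all add: q_def)
  have upper: "double_perimeter_x \<alpha> E \<le> ereal (4 * (?C + ?K) / p powr (\<alpha> + 1))"
    using m(10)[OF optimal_set_upper_bound(1)[OF \<alpha> p v]] optimal_set_upper_bound(2)[OF \<alpha> p v] by (rule order_trans)
  have lower: "ereal (4 * q * (v / 2) + 4 * (?C / q powr (\<alpha> + 1))) \<le> double_perimeter_x \<alpha> E"
    using linear_calibration[OF \<alpha> q m(4,5,6,9,2,3)] unfolding m(8) .
  define P where "P = p powr (\<alpha> + 1)"
  have P: "P > 0" using p by (simp add: P_def)
  have K: "?K = (\<alpha> + 1) * ?C" by (rule moment_eq_flux[OF \<alpha>])
  have C: "?C > 0" by (rule bubble_flux_pos[OF \<alpha>])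
  have pP: "p powr (\<alpha> + 2) = p * P" using p by (simp add: P_def powr_mult_base add.commute)
  define z where "z = q / p"
  have z: "z > 0" using q p by (simp add: z_def)
  have qz: "q = z * p" using p by (simp add: z_def)
  have zP: "q powr (\<alpha> + 1) = z powr (\<alpha> + 1) * P" unfolding qz P_def using z p by (simp add: powr_mult)
  have compare: "4 * q * (v / 2) + 4 * (?C / q powr (\<alpha> + 1)) \<le> 4 * (?C + ?K) / P"
    using order_trans[OF lower upper] by (simp add: P_def)
  have left: "4 * q * (v / 2) + 4 * (?C / q powr (\<alpha> + 1)) = 4 * ?C / P * ((\<alpha> + 1) * z + z powr (- (\<alpha> + 1)))"
  proof -
    have "4 * q * (v / 2) = 4 * ?C / P * ((\<alpha> + 1) * z)"
      unfolding v pP K qz using p by simp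
    moreover have "4 * (?C / q powr (\<alpha> + 1)) = 4 * ?C / P * z powr (- (\<alpha> + 1))"
      unfolding zP powr_minus_divide[of z] by simp
    ultimately show ?thesis by (simp only: distrib_left)
  qed
  have right: "4 * (?C + ?K) / P = 4 * ?C / P * ((\<alpha> + 1) + 1)"
    unfolding K by (simp add: algebra_simps add_divide_distrib)
  note compare[unfolded left right]
  moreover have "0 < 4 * ?C / P" using C P by simp
  ultimately have "(\<alpha> + 1) * z + z powr (- (\<alpha> + 1)) \<le> (\<alpha> + 1) + 1"
    by (simp only: mult_le_cancel_left_pos)
  then have "z = 1" using \<alpha> z by (intro scale_rigidity[of "\<alpha> + 1"]) auto
  then have "q = p" using qz by simp
  then show "r = 3 / (2 * p)" using q by simp
  have "4 * q * (v / 2) + 4 * (?C / q powr (\<alpha> + 1)) = 4 * (?C + ?K) / p powr (\<alpha> + 1)"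
    unfolding \<open>q = p\<close> v pP P_def[symmetric] using p by (simp add: add_divide_distrib)
  then show "double_perimeter_x \<alpha> E = ereal (4 * (?C + ?K) / p powr (\<alpha> + 1))"
    using lower upper by simp
qed

lemma regular_minimizer_profile:
  assumes \<alpha>: "\<alpha> \<ge> 0" and p: "p > 0" and v: "v = 2 * bubble_moment \<alpha> / p powr (\<alpha> + 2)"
    and min: "x_regular_minimizer_with_profile \<alpha> v E f r" and x: "x \<in> {0..r}"
  shows "f x = optimal_profile \<alpha> p x"
proof -
  let ?C = "bubble_flux \<alpha>" and ?K = "bubble_moment \<alpha>" and ?F = "optimal_profile \<alpha> p"
  have v0: "v > 0" using v bubble_moment_pos[OF \<alpha>] p by simp
  note m = regular_minimizer_facts[OF \<alpha> v0 min]
  note R = regular_minimizer_radius(1)[OF \<alpha> p v min]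
  define g where "g = even_extension f r"
  note m = m[folded g_def]
  have r: "r > 0" by (rule m(1))
  define h where "h = even_extension ?F r"
  have F_cont: "continuous_on {0..r} ?F" unfolding R by (rule optimal_profile_continuous[OF \<alpha> p])
  have h: "continuous_on UNIV h" unfolding h_def by (rule even_extension_continuous[OF F_cont r])
  have hF: "h x = ?F x" if "x \<in> {0..r}" for x using that by (simp add: h_def)
  define d where "d x = h x - g x" for x
  have d: "continuous_on UNIV d" unfolding d_def[abs_def] by (intro continuous_intros h m(4))
  have ic: "(u has_integral integral {0..r} u) {0..r}" if "continuous_on UNIV u" for u :: "real \<Rightarrow> real"
    by (intro integrable_integral integrable_continuous_real continuous_on_subset[OF that]) simp
  have "integral {0..r} h = integral {0..r} ?F" by (intro integral_cong hF)
  also have "\<dots> = v / 2"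
    unfolding R using optimal_profile_has_integral[OF \<alpha> p] v by (simp add: integral_unique)
  finally have "(d has_integral (v / 2 - v / 2)) {0..r}"
    unfolding d_def[abs_def] using has_integral_diff[OF ic[OF h] ic[OF m(4)]] m(8) by metis
  then have d0: "(d has_integral 0) {0..r}" by simp
  obtain \<eta> where \<eta>: "\<And>x. (\<eta> has_real_derivative d x) (at x)" "\<eta> 0 = 0"
    by (rule antiderivative_on_line[OF d]) blast
  have "(d has_integral \<eta> r - \<eta> 0) {0..r}"
    using r \<eta>(1) by (intro fundamental_theorem_of_calculus)
      (auto simp: has_real_derivative_iff_has_vector_derivative[symmetric] intro: has_field_derivative_at_within)
  then have \<eta>r: "\<eta> r = 0" using has_integral_unique[OF d0] \<eta>(2) by simp
  have \<eta>C1: "\<eta> C1_differentiable_on UNIV" by (rule C1_realI[OF \<eta>(1) d])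
  \<comment> \<open>a Lipschitz bound for \<open>\<eta>\<close>, which vanishes at both ends\<close>
  have "bounded (d ` {0..r})"
    by (intro compact_imp_bounded compact_continuous_image continuous_on_subset[OF d]) auto
  then obtain M0 where M0: "\<And>x. x \<in> {0..r} \<Longrightarrow> \<bar>d x\<bar> \<le> M0" unfolding bounded_real by blast
  define M where "M = max M0 1"
  have M: "M > 0" "\<And>x. x \<in> {0..r} \<Longrightarrow> \<bar>d x\<bar> \<le> M" using M0 by (auto simp: M_def intro: le_max_iff_disj[THEN iffD2])
  have lip: "\<bar>\<eta> x - \<eta> y\<bar> \<le> M * \<bar>x - y\<bar>" if "x \<in> {0..r}" "y \<in> {0..r}" for x y
  proof -
    have "norm (\<eta> x - \<eta> y) \<le> M * norm (x - y)"
      by (rule field_differentiable_bound[of "{0..r}" \<eta> d])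
        (use that M(2) \<eta>(1) in \<open>auto intro: has_field_derivative_at_within\<close>)
    then show ?thesis by simp
  qed
  have \<eta>_bound: "\<bar>\<eta> x\<bar> \<le> M * x \<and> \<bar>\<eta> x\<bar> \<le> M * (r - x)" if "x \<in> {0..r}" for x
    using lip[OF that, of 0] lip[OF that, of r] that r \<eta>(2) \<eta>r by auto
  define c where "c = 12 * M\<^sup>2 / p\<^sup>2 * r powr \<alpha> * r"
  let ?D = "integral {0..r} (\<lambda>x. (d x)\<^sup>2)"
  have key: "?D \<le> e * c" if e: "0 < e" "e \<le> p / M" for e
  proof -
    let ?W = "\<lambda>x. 1/2 - p * x + e * \<eta> x"
    have tangent: "?C / p powr (\<alpha> + 1) + e * integral {0..r} (\<lambda>x. ?F x * d x)
        - e\<^sup>2 * (12 * M\<^sup>2 / p\<^sup>2 * r powr \<alpha> * r)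
      \<le> integral {0..r} (\<lambda>x. \<bar>x\<bar> powr \<alpha> * sqrt (1 - (?W x)\<^sup>2))"
      and range: "-1 \<le> ?W x \<and> ?W x \<le> 1/2" if "x \<in> {0..r}" for x
      using perimeter_tangent_bound[OF \<alpha> p R \<eta>(1) d \<eta>(2) \<eta>r M(1) _ e] \<eta>_bound that by blast+
    have dW: "deriv ?W x = - p + e * d x" for x
      by (rule DERIV_imp_deriv) (auto intro!: derivative_eq_intros \<eta>(1))
    have "ereal (- 4 * integral {0..r} (\<lambda>x. g x * deriv ?W x)
       + 4 * integral {0..r} (\<lambda>x. \<bar>x\<bar> powr \<alpha> * sqrt (1 - (?W x)\<^sup>2))) \<le> double_perimeter_x \<alpha> E"
    proof (rule double_perimeter_ge[OF \<alpha> r m(4,5,6,9,2,3)])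
      show "?W C1_differentiable_on UNIV" by (intro C1_real_intros \<eta>C1)
    qed (use range \<eta>(2) in auto)
    then have le: "- 4 * integral {0..r} (\<lambda>x. g x * deriv ?W x)
       + 4 * integral {0..r} (\<lambda>x. \<bar>x\<bar> powr \<alpha> * sqrt (1 - (?W x)\<^sup>2)) \<le> 4 * (?C + ?K) / p powr (\<alpha> + 1)"
      unfolding regular_minimizer_radius(2)[OF \<alpha> p v min] by simp
    have gd: "continuous_on UNIV (\<lambda>x. g x * d x)" by (intro continuous_intros m(4) d)
    have "((\<lambda>x. - p * g x + e * (g x * d x)) has_integral (- p * (v / 2) + e * integral {0..r} (\<lambda>x. g x * d x))) {0..r}"
      using ic[OF m(4)] ic[OF gd] unfolding m(8) by (intro has_integral_add has_integral_mult_right)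
    then have "integral {0..r} (\<lambda>x. - p * g x + e * (g x * d x)) = - p * (v / 2) + e * integral {0..r} (\<lambda>x. g x * d x)"
      by (rule integral_unique)
    then have i1: "integral {0..r} (\<lambda>x. g x * deriv ?W x) = - p * (v / 2) + e * integral {0..r} (\<lambda>x. g x * d x)"
      unfolding dW by (simp add: algebra_simps)
    have flux: "?C / p powr (\<alpha> + 1) + e * integral {0..r} (\<lambda>x. ?F x * d x) - e * (e * c)
      \<le> integral {0..r} (\<lambda>x. \<bar>x\<bar> powr \<alpha> * sqrt (1 - (?W x)\<^sup>2))"
      using tangent[OF x] by (simp add: c_def power2_eq_square mult.assoc)
    have le': "4 * (p * (v / 2)) - 4 * (e * integral {0..r} (\<lambda>x. g x * d x))
       + 4 * integral {0..r} (\<lambda>x. \<bar>x\<bar> powr \<alpha> * sqrt (1 - (?W x)\<^sup>2)) \<le> 4 * (?C + ?K) / p powr (\<alpha> + 1)"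
      using le unfolding i1 by simp
    have "4 * (p * (v / 2)) = 4 * ?K / p powr (\<alpha> + 1)"
    proof -
      have "p powr (\<alpha> + 2) = p * p powr (\<alpha> + 1)" using p by (simp add: powr_mult_base add.commute)
      then show ?thesis unfolding v using p by simp
    qed
    moreover have "4 * (?C + ?K) / p powr (\<alpha> + 1) = 4 * (?C / p powr (\<alpha> + 1)) + 4 * ?K / p powr (\<alpha> + 1)"
      by (simp add: add_divide_distrib)
    ultimately have "e * integral {0..r} (\<lambda>x. ?F x * d x) - e * integral {0..r} (\<lambda>x. g x * d x) \<le> e * (e * c)"
      using le' flux by linarith
    then have "e * (integral {0..r} (\<lambda>x. ?F x * d x) - integral {0..r} (\<lambda>x. g x * d x)) \<le> e * (e * c)"
      by (simp only: right_diff_distrib)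
    then have "integral {0..r} (\<lambda>x. ?F x * d x) - integral {0..r} (\<lambda>x. g x * d x) \<le> e * c"
      using e(1) by (simp only: mult_le_cancel_left_pos)
    moreover have "?D = integral {0..r} (\<lambda>x. ?F x * d x) - integral {0..r} (\<lambda>x. g x * d x)"
    proof -
      have hd: "continuous_on UNIV (\<lambda>x. h x * d x)" by (intro continuous_intros h d)
      have "integral {0..r} (\<lambda>x. ?F x * d x) = integral {0..r} (\<lambda>x. h x * d x)"
        by (intro integral_cong) (simp add: hF)
      moreover have "(\<lambda>x. (d x)\<^sup>2) = (\<lambda>x. h x * d x - g x * d x)"
        by (auto simp: d_def power2_eq_square algebra_simps)
      ultimately show ?thesis
        using integral_unique[OF has_integral_diff[OF ic[OF hd] ic[OF gd]]] by simp
    qed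
    ultimately show ?thesis by simp
  qed
  \<comment> \<open>the limit \<open>e \<rightarrow> 0\<close>\<close>
  have "?D \<le> 0"
  proof (rule tendsto_lowerbound)
    show "((\<lambda>e. e * c) \<longlongrightarrow> 0) (at_right 0)" by (auto intro!: tendsto_eq_intros)
    have "\<forall>\<^sub>F e in at_right 0. e \<in> {0<..<p / M}"
      using p M(1) by (intro eventually_at_right_real) simp
    then show "\<forall>\<^sub>F e in at_right 0. ?D \<le> e * c"
      by eventually_elim (auto intro: key)
  qed simp
  moreover have sq: "continuous_on {0..r} (\<lambda>x. (d x)\<^sup>2)" by (intro continuous_intros continuous_on_subset[OF d]) simp
  moreover have "0 \<le> ?D" by (intro integral_nonneg integrable_continuous_real sq) simp
  ultimately have "(d x)\<^sup>2 = 0"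
    using integral_eq_0_iff[OF sq] r x by simp
  then show ?thesis using x hF[OF x] m(7)[OF x] by (simp add: d_def)
qed

section \<open>Regularity and shape of the optimal profile\<close>

text \<open>
  The functions \<open>x\<^sup>a (1 - u\<^sup>2)\<^sup>b q(x)\<close> with \<open>q\<close> a polynomial form a class that is closed under
  differentiation; the first derivative of the optimal profile belongs to it.
\<close>

lemma weighted_poly_derivative:
  fixes p a b :: real
  assumes p: "p > 0" and x: "x \<in> {0<..<3 / (2 * p)}"
  defines "U \<equiv> [:1/2, - p:]"
  defines "W \<equiv> 1 - U\<^sup>2"
  shows "((\<lambda>x. x powr a * (1 - (1/2 - p * x)\<^sup>2) powr b * poly q x) has_real_derivative
     x powr (a - 1) * (1 - (1/2 - p * x)\<^sup>2) powr (b - 1) *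
       poly (smult a (W * q) + smult (2 * p * b) (U * [:0, 1:] * q) + [:0, 1:] * W * pderiv q) x) (at x)"
proof -
  define u where "u = 1/2 - p * x"
  define w where "w = 1 - u\<^sup>2"
  have w: "w > 0" unfolding w_def u_def
    using affine_range_interior[OF p x] by (intro one_minus_square_pos) auto
  have x0: "x > 0" using x by simp
  have "((\<lambda>x. 1 - (1/2 - p * x)\<^sup>2) has_real_derivative 2 * p * u) (at x)"
    by (auto intro!: derivative_eq_intros simp: u_def)
  from DERIV_chain2[OF has_real_derivative_powr[OF w[unfolded w_def u_def]] this]
  have dw: "((\<lambda>x. (1 - (1/2 - p * x)\<^sup>2) powr b) has_real_derivative b * w powr (b - 1) * (2 * p * u)) (at x)"
    unfolding w_def u_def .
  have deriv: "((\<lambda>x. x powr a * (1 - (1/2 - p * x)\<^sup>2) powr b * poly q x) has_real_derivative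
     (a * x powr (a - 1) * w powr b + b * w powr (b - 1) * (2 * p * u) * x powr a) * poly q x
       + poly (pderiv q) x * (x powr a * w powr b)) (at x)"
    unfolding w_def u_def
    by (intro DERIV_mult has_real_derivative_powr x0 poly_DERIV dw[unfolded w_def u_def])
  have xa: "x powr a = x powr (a - 1) * x"
    using x0 powr_add[of x "a - 1" 1] by simp
  have wb: "w powr b = w powr (b - 1) * w"
    using w powr_add[of w "b - 1" 1] by simp
  have "poly W x = w" "poly U x = u"
    by (simp_all add: W_def U_def w_def u_def mult.commute[of p x])
  then have poly_eq: "poly (smult a (W * q) + smult (2 * p * b) (U * [:0, 1:] * q) + [:0, 1:] * W * pderiv q) x
      = a * (w * poly q x) + 2 * p * b * (u * x * poly q x) + x * w * poly (pderiv q) x"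
    by (simp add: algebra_simps)
  have "(a * P * (Q * w) + b * Q * (2 * p * u) * (P * x)) * s + s' * ((P * x) * (Q * w))
      = P * Q * (a * (w * s) + 2 * p * b * (u * x * s) + x * w * s')" for P Q s s' :: real
    by (simp add: algebra_simps)
  then have "(a * x powr (a - 1) * w powr b + b * w powr (b - 1) * (2 * p * u) * x powr a) * poly q x
       + poly (pderiv q) x * (x powr a * w powr b)
     = x powr (a - 1) * w powr (b - 1) *
       poly (smult a (W * q) + smult (2 * p * b) (U * [:0, 1:] * q) + [:0, 1:] * W * pderiv q) x"
    unfolding poly_eq xa wb by blast
  from deriv[unfolded this] show ?thesis unfolding w_def u_def .
qed

lemma optimal_profile_smooth:
  assumes \<alpha>: "\<alpha> \<ge> 0" and p: "p > 0" and r: "r = 3 / (2 * p)"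
    and f: "\<And>x. x \<in> {0..r} \<Longrightarrow> f x = optimal_profile \<alpha> p x"
  shows "(deriv ^^ n) f differentiable_on {0<..<r}"
proof -
  let ?w = "\<lambda>x. 1 - (1/2 - p * x)\<^sup>2"
  have d1: "(f has_real_derivative (1/2 - p * x) * x powr \<alpha> / sqrt (?w x)) (at x)" if x: "x \<in> {0<..<r}" for x
    by (rule has_field_derivative_transform_within_open[where S = "{0<..<r}"])
       (use x f optimal_profile_derivative[OF \<alpha> p, of x] r in auto)
  have form: "\<exists>a b q. \<forall>x \<in> {0<..<r}. (deriv ^^ Suc n) f x = x powr a * ?w x powr b * poly q x" for n
  proof (induction n)
    case 0
    have "(deriv ^^ Suc 0) f x = x powr \<alpha> * ?w x powr (- (1/2)) * poly [:1/2, - p:] x" if x: "x \<in> {0<..<r}" for x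
    proof -
      have "0 < ?w x" using affine_range_interior[OF p, of x] x r by (intro one_minus_square_pos) auto
      then have "?w x powr (- (1/2)) = 1 / sqrt (?w x)" by (simp add: powr_minus_divide powr_half_sqrt)
      then show ?thesis using DERIV_imp_deriv[OF d1[OF x]] by (simp add: mult.commute)
    qed
    then show ?case by blast
  next
    case (Suc n)
    then obtain a b q where IH: "\<And>x. x \<in> {0<..<r} \<Longrightarrow> (deriv ^^ Suc n) f x = x powr a * ?w x powr b * poly q x"
      by blast
    let ?q = "smult a ((1 - [:1/2, - p:]\<^sup>2) * q) + smult (2 * p * b) ([:1/2, - p:] * [:0, 1:] * q)
        + [:0, 1:] * (1 - [:1/2, - p:]\<^sup>2) * pderiv q"
    have "(deriv ^^ Suc (Suc n)) f x = x powr (a - 1) * ?w x powr (b - 1) * poly ?q x" if x: "x \<in> {0<..<r}" for x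
    proof -
      have "((deriv ^^ Suc n) f has_real_derivative x powr (a - 1) * ?w x powr (b - 1) * poly ?q x) (at x)"
        by (rule has_field_derivative_transform_within_open[OF weighted_poly_derivative[OF p, of x a b q], where S = "{0<..<r}"])
          (use x r IH in auto)
      then show ?thesis by (simp add: DERIV_imp_deriv)
    qed
    then show ?case by blast
  qed
  show ?thesis
  proof (cases n)
    case 0
    have "f differentiable (at x)" if "x \<in> {0<..<r}" for x
      unfolding real_differentiable_def by (rule exI[of _ "(1/2 - p * x) * x powr \<alpha> / sqrt (?w x)"], rule d1[OF that])
    then show ?thesis unfolding 0 funpow_0 by (rule differentiable_at_imp_differentiable_on)
  next
    case (Suc m)
    obtain a b q where eq: "\<And>x. x \<in> {0<..<r} \<Longrightarrow> (deriv ^^ Suc m) f x = x powr a * ?w x powr b * poly q x"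
      using form[of m] by blast
    have "(deriv ^^ Suc m) f differentiable (at x)" if x: "x \<in> {0<..<r}" for x
    proof -
      have "((deriv ^^ Suc m) f has_real_derivative x powr (a - 1) * ?w x powr (b - 1) *
          poly (smult a ((1 - [:1/2, - p:]\<^sup>2) * q) + smult (2 * p * b) ([:1/2, - p:] * [:0, 1:] * q)
            + [:0, 1:] * (1 - [:1/2, - p:]\<^sup>2) * pderiv q) x) (at x)"
        by (rule has_field_derivative_transform_within_open[OF weighted_poly_derivative[OF p, of x a b q], where S = "{0<..<r}"])
          (use x r eq in auto)
      then show ?thesis unfolding real_differentiable_def by (rule exI)
    qed
    then show ?thesis unfolding Suc by (rule differentiable_at_imp_differentiable_on)
  qed
qed

lemma profile_qualitative:
  assumes \<alpha>: "\<alpha> \<ge> 0" and p: "p > 0" and r: "r = 3 / (2 * p)"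
    and f: "\<And>x. x \<in> {0..r} \<Longrightarrow> f x = optimal_profile \<alpha> p x"
  shows "0 < f 0" "f r = 0" "filterlim (deriv f) at_bot (at_left r)"
    "\<alpha> > 0 \<Longrightarrow> (deriv f \<longlongrightarrow> 0) (at_right 0)"
    "\<And>x. x \<in> {0..r} \<Longrightarrow> x \<noteq> 1 / (2 * p) \<Longrightarrow> f x < f (1 / (2 * p))"
proof -
  have r0: "r > 0" using p r by simp
  let ?u = "\<lambda>x. 1/2 - p * x"
  have u: "?u x \<in> {-1<..<1/2}" if "x \<in> {0<..<r}" for x
    using that unfolding r by (rule affine_range_interior[OF p])
  have sq: "0 < sqrt (1 - (?u x)\<^sup>2)" if "x \<in> {0<..<r}" for x
    using one_minus_square_pos[of "?u x"] u[OF that] by auto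
  have d1: "(f has_real_derivative ?u x * x powr \<alpha> / sqrt (1 - (?u x)\<^sup>2)) (at x)" if x: "x \<in> {0<..<r}" for x
    by (rule has_field_derivative_transform_within_open[where S = "{0<..<r}"])
       (use x f optimal_profile_derivative[OF \<alpha> p, of x] r in auto)
  have deriv_f: "deriv f x = ?u x * x powr \<alpha> / sqrt (1 - (?u x)\<^sup>2)" if x: "x \<in> {0<..<r}" for x
    by (rule DERIV_imp_deriv[OF d1[OF x]])
  have "0 < (1/2) powr \<alpha> * sqrt (1 - (1/2)\<^sup>2)" by (simp add: power2_eq_square)
  also have "\<dots> \<le> profile_primitive \<alpha> (1/2)" by (rule profile_primitive_ge[OF \<alpha>]) simp
  finally show "0 < f 0" using f[of 0] r0 p by (simp add: optimal_profile_def)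
  have pr: "1/2 - p * r = -1" using p r by simp
  show "f r = 0" using f[of r] r0 unfolding optimal_profile_def pr by simp
  show "filterlim (deriv f) at_bot (at_left r)"
  proof -
    have ev: "\<forall>\<^sub>F x in at_left r. x \<in> {0<..<r}" using r0 by (intro eventually_at_left_real)
    have "((\<lambda>x. ?u x * x powr \<alpha>) \<longlongrightarrow> ?u r * r powr \<alpha>) (at_left r)"
      using r0 by (intro tendsto_intros) auto
    then have num: "((\<lambda>x. ?u x * x powr \<alpha>) \<longlongrightarrow> - (r powr \<alpha>)) (at_left r)" unfolding pr by simp
    have "((\<lambda>x. sqrt (1 - (?u x)\<^sup>2)) \<longlongrightarrow> sqrt (1 - (?u r)\<^sup>2)) (at_left r)" by (intro tendsto_intros)
    then have "((\<lambda>x. sqrt (1 - (?u x)\<^sup>2)) \<longlongrightarrow> 0) (at_left r)" unfolding pr by simp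
    then have "filterlim (\<lambda>x. inverse (sqrt (1 - (?u x)\<^sup>2))) at_top (at_left r)"
      by (rule filterlim_inverse_at_top) (use ev sq in \<open>auto elim: eventually_mono\<close>)
    then have "filterlim (\<lambda>x. ?u x * x powr \<alpha> * inverse (sqrt (1 - (?u x)\<^sup>2))) at_bot (at_left r)"
      using num r0 by (intro filterlim_tendsto_neg_mult_at_bot[OF num]) auto
    moreover have "\<forall>\<^sub>F x in at_left r. ?u x * x powr \<alpha> * inverse (sqrt (1 - (?u x)\<^sup>2)) = deriv f x"
      using ev by eventually_elim (simp add: deriv_f inverse_eq_divide)
    ultimately show ?thesis by (rule filterlim_cong[OF refl refl, THEN iffD1, rotated])
  qed
  show "(deriv f \<longlongrightarrow> 0) (at_right 0)" if "\<alpha> > 0"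
  proof -
    have "\<forall>\<^sub>F x in at_right (0::real). 0 \<le> x"
      by (auto simp: eventually_at_filter)
    then have pw: "((\<lambda>x. x powr \<alpha>) \<longlongrightarrow> 0 powr \<alpha>) (at_right 0)"
      using that by (intro tendsto_powr' tendsto_ident_at tendsto_const) auto
    have "sqrt (1 - (?u 0)\<^sup>2) \<noteq> 0" by (simp add: power2_eq_square)
    then have "((\<lambda>x. ?u x * x powr \<alpha> / sqrt (1 - (?u x)\<^sup>2)) \<longlongrightarrow> ?u 0 * 0 powr \<alpha> / sqrt (1 - (?u 0)\<^sup>2)) (at_right 0)"
      by (intro tendsto_divide tendsto_mult pw tendsto_intros)
    then have lim: "((\<lambda>x. ?u x * x powr \<alpha> / sqrt (1 - (?u x)\<^sup>2)) \<longlongrightarrow> 0) (at_right 0)" by simp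
    have "\<forall>\<^sub>F x in at_right 0. x \<in> {0<..<r}" using r0 by (intro eventually_at_right_real)
    then have "\<forall>\<^sub>F x in at_right 0. ?u x * x powr \<alpha> / sqrt (1 - (?u x)\<^sup>2) = deriv f x"
      by eventually_elim (simp add: deriv_f)
    with lim show ?thesis by (rule Lim_transform_eventually)
  qed
  define m where "m = 1 / (2 * p)"
  have m: "0 < m" "m < r" using p r by (auto simp: m_def divide_strict_right_mono)
  have pm: "p * m = 1/2" using p by (simp add: m_def)
  have cont: "continuous_on {0..r} f"
    by (rule continuous_on_eq[OF optimal_profile_continuous[OF \<alpha> p, folded r]]) (simp add: f)
  show "f x < f (1 / (2 * p))" if x: "x \<in> {0..r}" "x \<noteq> 1 / (2 * p)" for x
    unfolding m_def[symmetric]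
  proof (cases "x < m")
    case True
    show "f x < f m"
    proof (rule DERIV_pos_imp_increasing_open[OF True])
      fix y assume y: "x < y" "y < m"
      then have "y \<in> {0<..<r}" using x m by auto
      moreover have "0 < ?u y" using mult_strict_left_mono[OF y(2) p] pm by simp
      ultimately show "\<exists>z. (f has_real_derivative z) (at y) \<and> 0 < z"
        using d1[of y] sq[of y] by (intro exI[of _ "?u y * y powr \<alpha> / sqrt (1 - (?u y)\<^sup>2)"]) (auto intro!: divide_pos_pos mult_pos_pos)
    qed (use x m in \<open>auto intro: continuous_on_subset[OF cont]\<close>)
  next
    case False
    then have "m < x" using x by (simp add: m_def)
    then show "f x < f m"
    proof (rule DERIV_neg_imp_decreasing_open)
      fix y assume y: "m < y" "y < x"
      then have "y \<in> {0<..<r}" using x m by auto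
      moreover have "?u y < 0" using mult_strict_left_mono[OF y(1) p] pm by simp
      ultimately show "\<exists>z. (f has_real_derivative z) (at y) \<and> z < 0"
        using d1[of y] sq[of y] by (intro exI[of _ "?u y * y powr \<alpha> / sqrt (1 - (?u y)\<^sup>2)"]) (auto intro!: divide_neg_pos mult_neg_pos)
    qed (use x m in \<open>auto intro: continuous_on_subset[OF cont]\<close>)
  qed
qed

theorem theorem4p4:
  fixes \<alpha> v r k :: real and f :: "real \<Rightarrow> real" and E :: "(real \<times> real) set"
  assumes "\<alpha> \<ge> 0" and "v > 0"
    and "x_regular_minimizer_with_profile \<alpha> v E f r"
    and k_def: "k = - ((- (2 / v) *
          integral {-1..1/2} (\<lambda>t. t * (1/2 - t) powr (\<alpha> + 1) / sqrt (1 - t\<^sup>2))) powr (1 / (\<alpha> + 2)))"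
  shows "(\<forall>E'. x_regular_minimizer \<alpha> v E' \<longrightarrow> eq_ae E' E)
    \<and> (\<forall>x\<in>{0..r}. f x = - (1 / \<bar>k\<bar> powr (\<alpha> + 1)) *
          integral {-1..k * x + 1/2} (\<lambda>t. t * (1/2 - t) powr \<alpha> / sqrt (1 - t\<^sup>2)))
    \<and> (\<forall>n. (deriv ^^ n) f differentiable_on {0<..<r})
    \<and> r = - (3 / (2 * k))
    \<and> f 0 > 0 \<and> f r = 0
    \<and> filterlim (deriv f) at_bot (at_left r)
    \<and> (\<alpha> > 0 \<longrightarrow>
          (deriv f \<longlongrightarrow> 0) (at_right 0) \<and>
          - (1 / (2 * k)) \<in> {0..r} \<and>
          (\<forall>x\<in>{0..r}. x \<noteq> - (1 / (2 * k)) \<longrightarrow> f x < f (- (1 / (2 * k)))))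
    \<and> double_perimeter_x \<alpha> E = (INF E'\<in>admissible_x v. double_perimeter_x \<alpha> E')
    \<and> double_perimeter_x \<alpha> E = ereal (2 / \<bar>k\<bar> powr (\<alpha> + 1) *
          integral {-1..1/2} (\<lambda>t. (2 - t) * (1/2 - t) powr \<alpha> / sqrt (1 - t\<^sup>2)))"
proof -
  note \<alpha> = assms(1) and min = assms(3)
  define p where "p = (2 * bubble_moment \<alpha> / v) powr (1 / (\<alpha> + 2))"
  have base: "0 < 2 * bubble_moment \<alpha> / v" using bubble_moment_pos[OF \<alpha>] assms(2) by simp
  then have p: "p > 0" unfolding p_def powr_gt_zero by (rule less_imp_neq[symmetric])
  have k: "k = - p" unfolding k_def p_def bubble_moment_def by simp
  have "1 / (\<alpha> + 2) * (\<alpha> + 2) = 1" using \<alpha> by simp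
  then have "p powr (\<alpha> + 2) = 2 * bubble_moment \<alpha> / v"
    unfolding p_def powr_powr using powr_one[OF less_imp_le[OF base]] by metis
  then have v: "v = 2 * bubble_moment \<alpha> / p powr (\<alpha> + 2)"
    using bubble_moment_pos[OF \<alpha>] assms(2) by simp
  note r = regular_minimizer_radius(1)[OF \<alpha> p v min]
  note f = regular_minimizer_profile[OF \<alpha> p v min]
  have ae: "eq_ae E' (profile_set (optimal_profile \<alpha> p) r)"
    if min': "x_regular_minimizer_with_profile \<alpha> v E' f' r'" for E' f' r'
  proof -
    have "r' = r" using regular_minimizer_radius(1)[OF \<alpha> p v min'] r by simp
    then have "profile_set f' r' = profile_set (optimal_profile \<alpha> p) r"
      using regular_minimizer_profile[OF \<alpha> p v min'] by (auto simp: profile_set_def)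
    then show ?thesis using min' by (simp add: x_regular_minimizer_with_profile_def)
  qed
  have unique: "\<forall>E'. x_regular_minimizer \<alpha> v E' \<longrightarrow> eq_ae E' E"
    using ae[OF min, THEN eq_ae_sym] by (auto simp: x_regular_minimizer_def dest!: ae intro: eq_ae_trans)
  have formula: "\<forall>x\<in>{0..r}. f x = - (1 / \<bar>k\<bar> powr (\<alpha> + 1)) *
      integral {-1..k * x + 1/2} (\<lambda>t. t * (1/2 - t) powr \<alpha> / sqrt (1 - t\<^sup>2))"
    using f p by (simp add: optimal_profile_def profile_primitive_def k add.commute)
  have smooth: "\<forall>n. (deriv ^^ n) f differentiable_on {0<..<r}"
    using optimal_profile_smooth[OF \<alpha> p r f] by blast
  have radius: "r = - (3 / (2 * k))" using r by (simp add: k)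
  note q = profile_qualitative[OF \<alpha> p r f]
  have m: "- (1 / (2 * k)) = 1 / (2 * p)" by (simp add: k)
  have "1 / (2 * p) \<in> {0..r}" using p unfolding r by (simp add: divide_right_mono)
  then have maximum: "\<alpha> > 0 \<longrightarrow> (deriv f \<longlongrightarrow> 0) (at_right 0) \<and> - (1 / (2 * k)) \<in> {0..r} \<and>
      (\<forall>x\<in>{0..r}. x \<noteq> - (1 / (2 * k)) \<longrightarrow> f x < f (- (1 / (2 * k))))"
    unfolding m using q(4,5) by blast
  have infimum: "double_perimeter_x \<alpha> E = (INF E'\<in>admissible_x v. double_perimeter_x \<alpha> E')"
    using min by (intro antisym INF_greatest INF_lower)
      (auto simp: x_regular_minimizer_with_profile_def is_minimizer_x_def)
  have "double_perimeter_x \<alpha> E = ereal (2 / \<bar>k\<bar> powr (\<alpha> + 1) *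
      integral {-1..1/2} (\<lambda>t. (2 - t) * (1/2 - t) powr \<alpha> / sqrt (1 - t\<^sup>2)))"
    unfolding regular_minimizer_radius(2)[OF \<alpha> p v min] perimeter_integral_eq[OF \<alpha>]
    using p by (simp add: k)
  then show ?thesis
    by (intro conjI unique formula smooth radius q(1,2,3) maximum infimum)
qed

end
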